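(* Assume (H1)–(H3) as written out in the context, let $\lambda_*=\lambda_j(k_* )$ lie on an isolated arc of homoclinic essential spectrum (as defined in the context), and suppose $D^0_1(\lambda_* )\neq0$ and $D^0_2(\lambda_* )\ne0$. Write $\gamma=e^{ikX^\varepsilon}$, $k\in\mathbb R$. Then there exists $C_1>0$ such that for any $C>0$, for $X^\varepsilon$ sufficiently large, every $\gamma$-eigenvalue in $B(\lambda_*,C/X^\varepsilon)$ (i.e. every zero of $E^\varepsilon(\cdot,\gamma)$ there) lies within distance $C_1/X^\varepsilon$ of the set $$\{\lambda_j(\kappa):\ \kappa\equiv k \bmod 2\pi/X^\varepsilon\}.$$
   Context: Setting. For $\varepsilon\ge 0$ in a one-parameter family, consider first-order $N\times N$ systems $W'=A^\varepsilon(x,\lambda)W$, $\lambda\in\mathbb C$ (the eigenvalue equations of linearizations about periodic waves $\bar u^\varepsilon$, $\varepsilon>0$, and a limiting homoclinic wave, $\varepsilon=0$), where $A^\varepsilon$ is analytic in $\lambda$, $C^1$ in $x$, continuous in $\varepsilon$ for $\varepsilon>0$, and, for $\varepsilon>0$, periodic in $x$ with period $X^\varepsilon>0$. Hypotheses (for each $M>0$, with $C(M)>0$ and $\nu,\bar\theta>0$ independent of $\varepsilon$): (H1) $X^\varepsilon\to\infty$ as $\varepsilon\to0$. (H2) There is a matrix $A^0_\infty(\lambda)$, independent of $x$, with $|A^0(x,\lambda)-A^0_\infty(\lambda)|\le C(M)e^{-\nu|x|}$ for all $x\in\mathbb R$, $|\lambda|\le M$. (H3) $|A^\varepsilon(x,\lambda)-A^0(x,\lambda)|\le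 C(M)e^{-\bar\theta X^\varepsilon/2}$ for $|\lambda|\le M$, $|x|\le X^\varepsilon/2$. Periodic Evans function. For $\varepsilon>0$ let $\Psi^\varepsilon(x,\lambda)$ be the solution operator of $W'=A^\varepsilon W$ with $\Psi^\varepsilon(0,\lambda)=\mathrm{Id}$. For $|\gamma|=1$, $E^\varepsilon(\lambda,\gamma)=\det(\Psi^\varepsilon(X^\varepsilon,\lambda)-\gamma\,\mathrm{Id})$; its zeros $\lambda$ are the $\gamma$-eigenvalues of $\bar u^\varepsilon$. Domains of hyperbolicity. The set of $\lambda$ for which $A^0_\infty(\lambda)$ has a purely imaginary eigenvalue $ik$, $k\in\mathbb R$, is a finite union of curves $\lambda_j(k)$ (the homoclinic essential spectrum); the open connected components $\Lambda_r$ of its complement are the domains of hyperbolicity. Isolated arc. $\lambda_*=\lambda_j(k_* )$ lies on an isolated arc if it lies on a single curve $\lambda_j$ and $k_*$ is a nondegenerate root and the unique solution of $\lambda_j(k)=\lambda_*$: that is, $ik_*$ is a simple eigenvalue of $A^0_\infty(\lambda_* )$, all other eigenvalues of $A^0_\infty(\lambda_* )$ have nonzero real part, and, with $\mu_c(\lambda)$ the analytic eigenvalue of $A^0_\infty(\lambda)$ near $\lambda_*$ with $\mu_c(\lambda_* )=ik_*$, one has $\mu_c'(\lambda_* )\ne0$, the curve $\lambda_j$ near $k_*$ being given by $\mu_c(\lambda_j(k))=ik$. Near $\lambda_*$, $\lambda_j$ separates two domains of hyperbolicity $\Lambda_1$ and $\Lambda_2$, labelled so that $\Re\mu_c>0$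 on $\Lambda_1$ and $\Re\mu_c<0$ on $\Lambda_2$ (near $\lambda_*$). Let $\Pi_c,\Pi_{ss},\Pi_{su}$ be the spectral projections of $A^0_\infty(\lambda)$, analytic near $\lambda_*$, which at $\lambda_*$ are the center, stable and unstable projections. Conjugators. $P^0_\pm(x,\lambda)$ ($x\ge0$, resp. $x\le 0$) denote bounded, uniformly invertible matrix functions, analytic in $\lambda$ near $\lambda_*$, with $(P^0_\pm)'=A^0P^0_\pm-P^0_\pm A^0_\infty$ and $P^0_\pm-\mathrm{Id}=O(e^{-\bar\eta|x|})$ for some (any) $0<\bar\eta<\min(\bar\theta,\nu)$. (Such $P^0_\pm$ exist.) Homoclinic Evans functions. On a domain $\Lambda_r$, $D^0_r(\lambda)=\det(P^0_-R^-_\infty,P^0_+R^+_\infty)|_{x=0}/\det(R^-_\infty,R^+_\infty)$, where the columns of $R^-_\infty$, $R^+_\infty$ are any bases of the unstable and stable subspaces of $A^0_\infty(\lambda)$. Both $D^0_1$ and $D^0_2$ extend analytically to a neighborhood of $\lambda_*$: with $R^{su},R^c,R^{ss}$ bases of the ranges of $\Pi_{su},\Pi_c,\Pi_{ss}$, $$D^0_1=\frac{\det(P^0_-R^{su},P^0_-R^c,P^0_+R^{ss})|_{x=0}}{\det(R^{su},R^c,R^{ss})},\qquad D^0_2=\frac{\det(P^0_-R^{su},P^0_+R^c,P^0_+R^{ss})|_{x=0}}{\det(R^{su},R^c,R^{ss})}.$$ $B(\lambda_*,\rho)$ is the open disk of radius $\rho$ about $\lambda_*$ in $\mathbb C$.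 *)

theory Defs
  imports "HOL-Complex_Analysis.Complex_Analysis"
begin

section \<open>Matrix analyticity and spectral notions\<close>

definition matrix_analytic_on :: "(complex \<Rightarrow> complex^'n^'n) \<Rightarrow> complex set \<Rightarrow> bool" where
  "matrix_analytic_on F U \<longleftrightarrow> (\<forall>i j. (\<lambda>z. F z $ i $ j) analytic_on U)"

definition eigenvalue :: "complex^'n^'n \<Rightarrow> complex \<Rightarrow> bool" where
  "eigenvalue B \<mu> \<longleftrightarrow> (\<exists>v. v \<noteq> 0 \<and> B *v v = \<mu> *s v)"

definition gen_eigenspace :: "complex^'n^'n \<Rightarrow> complex \<Rightarrow> (complex^'n) set" where
  "gen_eigenspace B \<mu> = {v. \<exists>m. ((\<lambda>w. (B - mat \<mu>) *v w) ^^ m) v = 0}"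

text \<open>\<open>vec.dim\<close> and \<open>vec.span\<close> are the dimension and the span over the complex field;
  the unqualified \<open>dim\<close> and \<open>span\<close> would be the real ones.\<close>

definition algebraic_multiplicity :: "complex^'n^'n \<Rightarrow> complex \<Rightarrow> nat" where
  "algebraic_multiplicity B \<mu> = vec.dim (gen_eigenspace B \<mu>)"

definition spectral_subspace :: "complex^'n^'n \<Rightarrow> complex set \<Rightarrow> (complex^'n) set" where
  "spectral_subspace B T = vec.span (\<Union>\<mu>\<in>T. gen_eigenspace B \<mu>)"

definition spectral_projection :: "complex^'n^'n \<Rightarrow> complex set \<Rightarrow> complex^'n^'n \<Rightarrow> bool" where
  "spectral_projection B T Q \<longleftrightarrow>
     Q ** Q = Q \<and>
     range (\<lambda>v. Q *v v) = spectral_subspace B T \<and>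
     {v. Q *v v = 0} = spectral_subspace B (- T)"

text \<open>Analytic continuation to a neighbourhood of \<open>zs\<close> of the spectral projection of
  \<open>Ainf zs\<close> belonging to \<open>T\<close>. Away from \<open>zs\<close> the spectral set is not prescribed
  (a center eigenvalue may leave the imaginary axis).\<close>

definition analytic_spectral_projection ::
    "(complex \<Rightarrow> complex^'n^'n) \<Rightarrow> complex \<Rightarrow> complex set \<Rightarrow> (complex \<Rightarrow> complex^'n^'n) \<Rightarrow> bool" where
  "analytic_spectral_projection Ainf zs T Q \<longleftrightarrow>
     matrix_analytic_on Q {zs} \<and>
     spectral_projection (Ainf zs) T (Q zs) \<and>
     (\<forall>\<^sub>F z in nhds zs. \<exists>T'. spectral_projection (Ainf z) T' (Q z))"

section \<open>The family of systems and the hypotheses (H1)--(H3)\<close>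

text \<open>The spectral parameter is written \<open>z\<close>, the coefficient matrix \<open>A \<epsilon> x z\<close>, the period \<open>X \<epsilon>\<close>;
  \<open>I\<close> is the parameter interval.\<close>

definition system_family ::
    "real set \<Rightarrow> (real \<Rightarrow> real \<Rightarrow> complex \<Rightarrow> complex^'n^'n) \<Rightarrow> (real \<Rightarrow> real) \<Rightarrow> bool" where
  "system_family I A X \<longleftrightarrow>
     is_interval I \<and> 0 \<in> I \<and> I \<subseteq> {0..} \<and> I \<noteq> {0} \<and>
     (\<forall>\<epsilon>\<in>I. \<forall>x. matrix_analytic_on (A \<epsilon> x) UNIV) \<and>
     (\<forall>\<epsilon>\<in>I. \<forall>z. (\<lambda>x. A \<epsilon> x z) C1_differentiable_on UNIV) \<and>
     (\<forall>x z. continuous_on (I \<inter> {0<..}) (\<lambda>\<epsilon>. A \<epsilon> x z)) \<and>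
     (\<forall>\<epsilon>\<in>I. \<epsilon> > 0 \<longrightarrow> X \<epsilon> > 0 \<and> (\<forall>x z. A \<epsilon> (x + X \<epsilon>) z = A \<epsilon> x z))"

definition H1 :: "(real \<Rightarrow> real) \<Rightarrow> bool" where
  "H1 X \<longleftrightarrow> filterlim X at_top (at_right 0)"

definition H2 ::
    "(real \<Rightarrow> real \<Rightarrow> complex \<Rightarrow> complex^'n^'n) \<Rightarrow> (complex \<Rightarrow> complex^'n^'n) \<Rightarrow> real \<Rightarrow> bool" where
  "H2 A Ainf \<nu> \<longleftrightarrow>
     (\<forall>M>0. \<exists>K>0. \<forall>x z. norm z \<le> M \<longrightarrow>
        norm (A 0 x z - Ainf z) \<le> K * exp (- \<nu> * \<bar>x\<bar>))"

definition H3 ::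
    "real set \<Rightarrow> (real \<Rightarrow> real \<Rightarrow> complex \<Rightarrow> complex^'n^'n) \<Rightarrow> (real \<Rightarrow> real) \<Rightarrow> real \<Rightarrow> bool" where
  "H3 I A X \<theta> \<longleftrightarrow>
     (\<forall>M>0. \<exists>K>0. \<forall>\<epsilon>\<in>I. \<epsilon> > 0 \<longrightarrow>
        (\<forall>x z. norm z \<le> M \<longrightarrow> \<bar>x\<bar> \<le> X \<epsilon> / 2 \<longrightarrow>
           norm (A \<epsilon> x z - A 0 x z) \<le> K * exp (- \<theta> * X \<epsilon> / 2)))"

section \<open>Periodic Evans function\<close>

definition solution_operator ::
    "(real \<Rightarrow> complex \<Rightarrow> complex^'n^'n) \<Rightarrow> (real \<Rightarrow> complex \<Rightarrow> complex^'n^'n) \<Rightarrow> bool" where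
  "solution_operator B \<Psi> \<longleftrightarrow>
     (\<forall>z. \<Psi> 0 z = mat 1) \<and>
     (\<forall>x z. ((\<lambda>y. \<Psi> y z) has_vector_derivative (B x z ** \<Psi> x z)) (at x))"

definition periodic_evans ::
    "(real \<Rightarrow> complex \<Rightarrow> complex^'n^'n) \<Rightarrow> real \<Rightarrow> complex \<Rightarrow> complex \<Rightarrow> complex" where
  "periodic_evans \<Psi> L z \<gamma> = det (\<Psi> L z - mat \<gamma>)"

section \<open>Homoclinic essential spectrum and isolated arcs\<close>

definition essential_spectrum :: "(complex \<Rightarrow> complex^'n^'n) \<Rightarrow> complex set" where
  "essential_spectrum Ainf = {z. \<exists>k::real. eigenvalue (Ainf z) (\<i> * of_real k)}"

text \<open>The finitely many curves are \<open>lam 0, \<dots>, lam (m - 1)\<close>.\<close>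

definition spectral_curves ::
    "(complex \<Rightarrow> complex^'n^'n) \<Rightarrow> nat \<Rightarrow> (nat \<Rightarrow> real \<Rightarrow> complex) \<Rightarrow> bool" where
  "spectral_curves Ainf m lam \<longleftrightarrow>
     essential_spectrum Ainf = (\<Union>j<m. range (lam j)) \<and>
     (\<forall>j<m. continuous_on UNIV (lam j) \<and>
        (\<forall>k. eigenvalue (Ainf (lam j k)) (\<i> * of_real k)))"

text \<open>\<open>\<mu>c\<close> is the analytic center eigenvalue; only its germ at \<open>lam j ks\<close> matters.\<close>

definition isolated_arc ::
    "(complex \<Rightarrow> complex^'n^'n) \<Rightarrow> nat \<Rightarrow> (nat \<Rightarrow> real \<Rightarrow> complex) \<Rightarrow> nat \<Rightarrow> real
       \<Rightarrow> (complex \<Rightarrow> complex) \<Rightarrow> bool" where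
  "isolated_arc Ainf m lam j ks \<mu>c \<longleftrightarrow>
     j < m \<and>
     (\<forall>i<m. i \<noteq> j \<longrightarrow> lam j ks \<notin> range (lam i)) \<and>
     (\<forall>k. lam j k = lam j ks \<longrightarrow> k = ks) \<and>
     algebraic_multiplicity (Ainf (lam j ks)) (\<i> * of_real ks) = 1 \<and>
     (\<forall>\<mu>. eigenvalue (Ainf (lam j ks)) \<mu> \<and> \<mu> \<noteq> \<i> * of_real ks \<longrightarrow> Re \<mu> \<noteq> 0) \<and>
     \<mu>c analytic_on {lam j ks} \<and>
     \<mu>c (lam j ks) = \<i> * of_real ks \<and>
     (\<forall>\<^sub>F z in nhds (lam j ks). eigenvalue (Ainf z) (\<mu>c z)) \<and>
     deriv \<mu>c (lam j ks) \<noteq> 0 \<and>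
     (\<forall>\<^sub>F k in nhds ks. \<mu>c (lam j k) = \<i> * of_real k)"

section \<open>Conjugators and homoclinic Evans functions\<close>

text \<open>Used with \<open>H = {0..}\<close> for the conjugator on the right half-line and \<open>H = {..0}\<close> for the
  one on the left; \<open>U\<close> is a neighbourhood of \<open>zs\<close>. All bounds are uniform in
  \<open>x \<in> H\<close> and \<open>z \<in> U\<close>; derivatives at the endpoint \<open>0\<close> are one-sided.\<close>

definition conjugator_on ::
    "real set \<Rightarrow> complex set \<Rightarrow> (real \<Rightarrow> complex \<Rightarrow> complex^'n^'n) \<Rightarrow> (complex \<Rightarrow> complex^'n^'n)
       \<Rightarrow> real \<Rightarrow> (real \<Rightarrow> complex \<Rightarrow> complex^'n^'n) \<Rightarrow> bool" where
  "conjugator_on H U A0 Ainf \<eta> P \<longleftrightarrow>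
     (\<forall>x\<in>H. matrix_analytic_on (P x) U) \<and>
     (\<forall>x\<in>H. \<forall>z\<in>U. ((\<lambda>y. P y z) has_vector_derivative
        (A0 x z ** P x z - P x z ** Ainf z)) (at x within H)) \<and>
     (\<exists>K. \<forall>x\<in>H. \<forall>z\<in>U. invertible (P x z) \<and>
        norm (P x z) \<le> K \<and> norm (matrix_inv (P x z)) \<le> K) \<and>
     (\<exists>K. \<forall>x\<in>H. \<forall>z\<in>U. norm (P x z - mat 1) \<le> K * exp (- \<eta> * \<bar>x\<bar>))"

definition conjugators_near ::
    "complex \<Rightarrow> (real \<Rightarrow> complex \<Rightarrow> complex^'n^'n) \<Rightarrow> (complex \<Rightarrow> complex^'n^'n) \<Rightarrow> real
       \<Rightarrow> (real \<Rightarrow> complex \<Rightarrow> complex^'n^'n) \<Rightarrow> (real \<Rightarrow> complex \<Rightarrow> complex^'n^'n) \<Rightarrow> bool" where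
  "conjugators_near zs A0 Ainf \<eta> Pm Pp \<longleftrightarrow>
     (\<exists>U. open U \<and> zs \<in> U \<and>
        conjugator_on {..0} U A0 Ainf \<eta> Pm \<and> conjugator_on {0..} U A0 Ainf \<eta> Pp)"

text \<open>The bases \<open>(Rsu, Rc, Rss)\<close> are stored as the columns of one square matrix \<open>R\<close>: those with
  index in \<open>Jsu\<close> form \<open>Rsu\<close>, those in \<open>Jc\<close> form \<open>Rc\<close>, and the remaining ones \<open>Rss\<close>. The order of the
  columns is irrelevant, since a permutation changes numerator and denominator of the
  Evans functions by the same sign.\<close>

definition spectral_frame ::
    "complex^'n^'n \<Rightarrow> complex^'n^'n \<Rightarrow> complex^'n^'n \<Rightarrow> 'n set \<Rightarrow> 'n set \<Rightarrow> complex^'n^'n \<Rightarrow> bool" where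
  "spectral_frame Qsu Qc Qss Jsu Jc R \<longleftrightarrow>
     Jsu \<inter> Jc = {} \<and> invertible R \<and>
     vec.span ((\<lambda>i. column i R) ` Jsu) = range (\<lambda>v. Qsu *v v) \<and>
     vec.span ((\<lambda>i. column i R) ` Jc) = range (\<lambda>v. Qc *v v) \<and>
     vec.span ((\<lambda>i. column i R) ` (- (Jsu \<union> Jc))) = range (\<lambda>v. Qss *v v)"

text \<open>Columns with index in \<open>J\<close> are transported by \<open>Pm\<close>, the others by \<open>Pp\<close>.\<close>

definition evans_quotient ::
    "complex^'n^'n \<Rightarrow> complex^'n^'n \<Rightarrow> complex^'n^'n \<Rightarrow> 'n set \<Rightarrow> complex" where
  "evans_quotient Pm Pp R J =
     det (\<chi> i j. if j \<in> J then (Pm ** R) $ i $ j else (Pp ** R) $ i $ j) / det R"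

text \<open>The two homoclinic Evans functions, extended to a neighbourhood of the point on the
  essential spectrum. Where the center eigenvalue has positive real part, the columns in
  \<open>Jsu \<union> Jc\<close> are a basis of the unstable subspace of \<open>Ainf z\<close> and the others one of the stable
  subspace, so \<open>homoclinic_evans1\<close> is the Evans function of that domain of hyperbolicity;
  where it has negative real part the same holds for \<open>homoclinic_evans2\<close> with \<open>Jsu\<close>.\<close>

definition homoclinic_evans1 ::
    "(real \<Rightarrow> complex \<Rightarrow> complex^'n^'n) \<Rightarrow> (real \<Rightarrow> complex \<Rightarrow> complex^'n^'n)
       \<Rightarrow> (complex \<Rightarrow> complex^'n^'n) \<Rightarrow> 'n set \<Rightarrow> 'n set \<Rightarrow> complex \<Rightarrow> complex" where
  "homoclinic_evans1 Pm Pp R Jsu Jc z = evans_quotient (Pm 0 z) (Pp 0 z) (R z) (Jsu \<union> Jc)"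

definition homoclinic_evans2 ::
    "(real \<Rightarrow> complex \<Rightarrow> complex^'n^'n) \<Rightarrow> (real \<Rightarrow> complex \<Rightarrow> complex^'n^'n)
       \<Rightarrow> (complex \<Rightarrow> complex^'n^'n) \<Rightarrow> 'n set \<Rightarrow> complex \<Rightarrow> complex" where
  "homoclinic_evans2 Pm Pp R Jsu z = evans_quotient (Pm 0 z) (Pp 0 z) (R z) Jsu"

end

theory Submission
  imports Defs
begin

text \<open>A zero of the periodic Evans function gives a solution \<open>W\<close> on one period with
  \<open>W (X/2) = \<gamma> W (- X/2)\<close>. The conjugators turn it into solutions \<open>Z\<close> on the two half-periods of a
  small perturbation of the constant coefficient system. There the stable part is negligible where
  a half-period ends, the unstable part where it starts, and the center part is multiplied by
  \<open>exp (\<mu>c z X/2)\<close> up to a small error. At the origin the nonvanishing of the two homoclinic Evans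
  functions says that the left center component controls the right one and conversely, with
  constants that depend on the base point only. Since the center components at the two ends of the
  period have the same modulus, \<open>exp (Re (\<mu>c z) X)\<close> is bounded above and below independently
  of \<open>C\<close>, that is, \<open>Re (\<mu>c z) = O(1/X)\<close>. Some \<open>\<kappa>\<close> congruent to \<open>k\<close> is within \<open>\<pi>/X\<close> of
  \<open>Im (\<mu>c z)\<close>, and the local inverse of \<open>\<mu>c\<close> gives the claim.\<close>

text \<open>The order of the quantifiers shapes the estimates: \<open>C1\<close> is fixed before
  \<open>C\<close>, whereas the center growth over a half-period is a priori bounded only by a
  constant that depends on \<open>C\<close>. So \<open>C\<close> may enter smallness thresholds
  only, and the final bound \<open>2 * \<kappa> * K1\<close> is made of projections and matching
  constants at the base point \<open>zs\<close>. Projections, Evans determinants and decay rates are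
  therefore frozen at \<open>zs\<close>. Freezing costs the error \<open>Ainf z - Ainf zs\<close>.
  In the hyperbolic directions exponential decay absorbs it; along the center direction it would
  accumulate over the whole half-period. There the growth is read off by a left eigenvector of
  \<open>Ainf z\<close> itself, which leaves only the exponentially small error of (H3) times the
  period. All errors are relative to the supremum \<open>N\<close> of the conjugated solutions on
  both halves; \<open>N\<close> is in turn bounded by the center component at the origin, so the
  errors can be absorbed there. In \<open>C1 = L * (ln (2 * \<kappa> * K1) + pi)\<close> the
  logarithm bounds the real part, \<open>pi\<close> is half the spacing of the admissible wave
  numbers, and \<open>L\<close> is a Lipschitz constant of the local inverse of
  \<open>\<mu>c\<close>.\<close>

no_notation fps_nth (infixl "$" 75)

section \<open>Norm estimates for complex matrices\<close>

text \<open>\<open>norm A\<close> is the Euclidean norm of all entries, so Cauchy-Schwarz on each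
  row gives constant 1 and products are estimated without a dimension factor.\<close>

lemma norm_matrix_vector_mult_le:
  fixes A :: "complex^'n^'m"
  shows "norm (A *v x) \<le> norm A * norm x"
proof -
  have row: "norm ((A *v x) $ i) \<le> norm (A $ i) * norm x" for i
  proof -
    have "norm ((A *v x) $ i) \<le> (\<Sum>j\<in>UNIV. \<bar>norm (A $ i $ j)\<bar> * \<bar>norm (x $ j)\<bar>)"
      unfolding matrix_vector_mult_def by (simp add: sum_norm_le norm_mult)
    also have "\<dots> \<le> norm (A $ i) * norm x"
      unfolding norm_vec_def by (rule L2_set_mult_ineq)
    finally show ?thesis .
  qed
  have "norm (A *v x) \<le> L2_set (\<lambda>i. norm (A $ i) * norm x) UNIV"
    unfolding norm_vec_def[of "A *v x"] by (rule L2_set_mono) (use row in auto)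
  also have "\<dots> = norm A * norm x"
    by (simp add: norm_vec_def[of A] L2_set_left_distrib)
  finally show ?thesis .
qed

lemma mat_vector_mult: "mat \<mu> *v (x :: 'a::semiring_1^'n) = \<mu> *s x"
  by (simp add: vec_eq_iff matrix_vector_mult_def mat_def if_distrib if_distribR cong: if_cong)

lemma norm_vector_smult:
  fixes x :: "complex^'n"
  shows "norm (c *s x) = norm c * norm x"
  by (simp add: norm_vec_def norm_mult L2_set_right_distrib)

lemma vector_smult_of_real: "(of_real r :: complex) *s x = r *\<^sub>R x"
  by (simp add: vec_eq_iff vector_scaleR_component scaleR_conv_of_real[where 'a = complex])

lemma bounded_bilinear_matrix_vector_mult:
  "bounded_bilinear (\<lambda>(A :: complex^'n^'m) x. A *v x)"
proof
  show "(r *\<^sub>R A) *v x = r *\<^sub>R (A *v x)" for r and A :: "complex^'n^'m" and x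
    by (simp add: vec_eq_iff matrix_vector_mult_def scaleR_right.sum)
  show "\<exists>K. \<forall>(A :: complex^'n^'m) x. norm (A *v x) \<le> norm A * norm x * K"
    by (rule exI[of _ 1]) (simp add: norm_matrix_vector_mult_le)
qed (auto simp: algebra_simps linear_scale[OF matrix_vector_mul_linear])

lemma norm_matrix_matrix_mult_le:
  fixes A :: "complex^'n^'m" and B :: "complex^'k^'n"
  shows "norm (A ** B) \<le> norm A * norm B"
proof -
  have transp: "norm (transpose M) = norm M" for M :: "complex^'a::finite^'b::finite"
  proof -
    have "(\<Sum>i\<in>UNIV. \<Sum>j\<in>UNIV. (norm (M $ j $ i))\<^sup>2) = (\<Sum>i\<in>UNIV. \<Sum>j\<in>UNIV. (norm (M $ i $ j))\<^sup>2)"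
      by (rule sum.swap)
    then show ?thesis
      by (simp add: norm_vec_def L2_set_def transpose_def sum_nonneg)
  qed
  have row: "norm ((A ** B) $ i) \<le> norm (A $ i) * norm B" for i
  proof -
    have "(A ** B) $ i = transpose B *v (A $ i)"
      by (simp add: vec_eq_iff matrix_matrix_mult_def matrix_vector_mult_def transpose_def mult.commute
          del: transpose_matrix_vector)
    then show ?thesis
      using norm_matrix_vector_mult_le[of "transpose B" "A $ i"] by (simp add: transp mult.commute)
  qed
  have "norm (A ** B) \<le> L2_set (\<lambda>i. norm (A $ i) * norm B) UNIV"
    unfolding norm_vec_def[of "A ** B"] by (rule L2_set_mono) (use row in auto)
  also have "\<dots> = norm A * norm B"
    by (simp add: norm_vec_def[of A] L2_set_left_distrib)
  finally show ?thesis .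
qed

lemma bounded_bilinear_matrix_matrix_mult:
  "bounded_bilinear (\<lambda>(A :: complex^'n^'m) (B :: complex^'k^'n). A ** B)"
proof
  show "\<exists>K. \<forall>(A :: complex^'n^'m) (B :: complex^'k^'n). norm (A ** B) \<le> norm A * norm B * K"
    by (rule exI[of _ 1]) (simp add: norm_matrix_matrix_mult_le)
qed (auto simp: vec_eq_iff matrix_matrix_mult_def algebra_simps sum.distrib scaleR_right.sum)

lemma bounded_bilinear_vector_smult:
  "bounded_bilinear (\<lambda>c (x :: complex^'n). c *s x)"
proof
  show "\<exists>K. \<forall>c (x :: complex^'n). norm (c *s x) \<le> norm c * norm x * K"
    by (rule exI[of _ 1]) (simp add: norm_vector_smult)
qed (auto simp: vec_eq_iff algebra_simps)

lemmas has_vector_derivative_matrix_vector_mult =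
  bounded_bilinear.has_vector_derivative[OF bounded_bilinear_matrix_vector_mult]

lemmas has_vector_derivative_matrix_matrix_mult =
  bounded_bilinear.has_vector_derivative[OF bounded_bilinear_matrix_matrix_mult]

lemmas has_vector_derivative_vector_smult =
  bounded_bilinear.has_vector_derivative[OF bounded_bilinear_vector_smult]

section \<open>Decay on spectral subspaces\<close>

text \<open>The weighted energy \<open>exp (- (2 * norm B) * s) * (D s \<bullet> D s)\<close> does
  not increase and starts at 0. The lemma is applied to the commutator of \<open>B\<close> with a
  propagator.\<close>

lemma linear_ode_zero_unique:
  fixes D :: "real \<Rightarrow> complex^'k^'n"
  assumes D: "\<And>t. t \<ge> 0 \<Longrightarrow> (D has_vector_derivative (B ** D t)) (at t)"
    and "D 0 = 0" "t \<ge> 0"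
  shows "D t = 0"
proof -
  define f where "f s = exp (- (2 * norm B) * s) * (D s \<bullet> D s)" for s
  have "\<exists>y. (f has_real_derivative y) (at s) \<and> y \<le> 0" if "0 \<le> s" "s \<le> t" for s
  proof -
    have "((\<lambda>s. D s \<bullet> D s) has_vector_derivative (D s \<bullet> (B ** D s) + (B ** D s) \<bullet> D s)) (at s)"
      by (rule bounded_bilinear.has_vector_derivative[OF bounded_bilinear_inner D[OF \<open>0 \<le> s\<close>] D[OF \<open>0 \<le> s\<close>]])
    then have d: "((\<lambda>s. D s \<bullet> D s) has_real_derivative (2 * (D s \<bullet> (B ** D s)))) (at s)"
      by (simp add: has_real_derivative_iff_has_vector_derivative inner_commute)
    let ?e = "exp (- (2 * norm B) * s)"
    have "(f has_real_derivative (?e * (2 * (D s \<bullet> (B ** D s))) + ?e * (- (2 * norm B)) * (D s \<bullet> D s))) (at s)"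
      unfolding f_def by (auto intro!: derivative_eq_intros d)
    moreover have "D s \<bullet> (B ** D s) \<le> norm B * (D s \<bullet> D s)"
    proof -
      have "D s \<bullet> (B ** D s) \<le> norm (D s) * norm (B ** D s)"
        by (rule norm_cauchy_schwarz)
      also have "\<dots> \<le> norm (D s) * (norm B * norm (D s))"
        by (intro mult_left_mono norm_matrix_matrix_mult_le) auto
      finally show ?thesis
        by (simp add: dot_square_norm power2_eq_square algebra_simps)
    qed
    then have "?e * (2 * (D s \<bullet> (B ** D s))) + ?e * (- (2 * norm B)) * (D s \<bullet> D s) \<le> 0"
      by (simp add: algebra_simps)
    ultimately show ?thesis by blast
  qed
  then have "f t \<le> f 0"
    using DERIV_nonpos_imp_nonincreasing[of 0 t f] \<open>t \<ge> 0\<close> by blast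
  then have "D t \<bullet> D t \<le> 0"
    using \<open>D 0 = 0\<close> by (simp add: f_def mult_le_0_iff)
  then show ?thesis
    by (metis inner_eq_zero_iff inner_ge_zero order_antisym)
qed

text \<open>The orbit is given by its equation, constant and rate, all existential. The property is
  thus closed under sums of orbits with different rates, which is what induction over a span of
  generalized eigenspaces requires.\<close>

definition decaying_orbit :: "complex^'n^'n \<Rightarrow> complex^'n \<Rightarrow> bool" where
  "decaying_orbit B v \<longleftrightarrow> (\<exists>w K \<alpha>. 0 < \<alpha> \<and> w 0 = v \<and>
     (\<forall>t. (w has_vector_derivative (B *v w t)) (at t)) \<and>
     (\<forall>t\<ge>0. norm (w t) \<le> K * exp (- \<alpha> * t)))"

lemma power_div_fact_le_exp:
  assumes "0 \<le> (x :: real)"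
  shows "x ^ k / fact k \<le> exp x"
proof -
  have "(\<lambda>n. x ^ n /\<^sub>R fact n) sums exp x" by (rule exp_converges)
  then have "(\<Sum>n\<in>{k}. x ^ n /\<^sub>R fact n) \<le> exp x"
    using assms by (metis (no_types, lifting) divide_nonneg_pos divideR_right fact_gt_zero finite.emptyI
        finite_insert scaleR_nonneg_nonneg inverse_nonnegative_iff_nonnegative fact_ge_zero
        sum_le_suminf sums_iff zero_le_power)
  then show ?thesis by (simp add: divide_inverse mult.commute)
qed

text \<open>With \<open>N = B - mat \<mu>\<close> nilpotent on \<open>v\<close>, the orbit is
  \<open>exp (t \<mu>)\<close> times the finite exponential sum of \<open>t N\<close> applied to
  \<open>v\<close>.\<close>

lemma decaying_orbit_gen_eigenspace:
  fixes B :: "complex^'n^'n"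
  assumes "v \<in> gen_eigenspace B \<mu>" "Re \<mu> < 0"
  shows "decaying_orbit B v"
proof -
  define N where "N w = (B - mat \<mu>) *v w" for w
  obtain m where m: "(N ^^ m) v = 0"
    using assms(1) unfolding gen_eigenspace_def N_def by auto
  have N_sum: "N (\<Sum>k\<in>S. c k *\<^sub>R u k) = (\<Sum>k\<in>S. c k *\<^sub>R N (u k))" for S :: "nat set" and c u
    unfolding N_def by (simp add: linear_sum[OF matrix_vector_mul_linear] linear_scale[OF matrix_vector_mul_linear])
  define p where "p t = (\<Sum>k<m. (t ^ k / fact k) *\<^sub>R (N ^^ k) v)" for t :: real
  define w where "w t = exp (of_real t * \<mu>) *s p t" for t :: real
  \<comment> \<open>Half of the decay rate is kept; the other half pays for the polynomial factor
    through \<open>t ^ k / fact k \<le> exp (\<alpha> * t) / \<alpha> ^ k\<close>.\<close>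
  define \<alpha> where "\<alpha> = - Re \<mu> / 2"
  have "\<alpha> > 0" using assms(2) by (simp add: \<alpha>_def)
  have "w 0 = v"
  proof (cases m)
    case 0
    then show ?thesis using m by (simp add: w_def p_def)
  next
    case (Suc m')
    have "p 0 = (\<Sum>k<m. if k = 0 then v else 0)"
      unfolding p_def by (intro sum.cong) auto
    then show ?thesis using Suc by (simp add: w_def)
  qed
  have "(p has_vector_derivative N (p t)) (at t)" for t
  proof -
    have "(p has_vector_derivative (\<Sum>k<m. (real k * t ^ (k - 1) / fact k) *\<^sub>R (N ^^ k) v)) (at t)"
      unfolding p_def
      by (rule has_vector_derivative_sum) (auto intro!: derivative_eq_intros simp: divide_simps)
    \<comment> \<open>Differentiation shifts the index by one. The top term that appears to be
      missing is \<open>N ((N ^^ m') v)\<close>, which vanishes by the choice of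
      \<open>m\<close>.\<close>
    also have "(\<Sum>k<m. (real k * t ^ (k - 1) / fact k) *\<^sub>R (N ^^ k) v)
        = (\<Sum>k<m. (t ^ k / fact k) *\<^sub>R N ((N ^^ k) v))"
    proof (cases m)
      case (Suc m')
      have "(\<Sum>k<m. (real k * t ^ (k - 1) / fact k) *\<^sub>R (N ^^ k) v)
          = (\<Sum>k<m'. (t ^ k / fact k) *\<^sub>R N ((N ^^ k) v))"
        unfolding Suc sum.lessThan_Suc_shift
        by (simp add: divide_simps del: of_nat_Suc)
      moreover have "N ((N ^^ m') v) = 0" using m Suc by simp
      ultimately show ?thesis using Suc by simp
    qed simp
    finally show ?thesis unfolding N_sum p_def .
  qed note p = this
  have "(w has_vector_derivative (B *v w t)) (at t)" for t
  proof -
    have e: "((\<lambda>t. exp (of_real t * \<mu>)) has_vector_derivative (exp (of_real t * \<mu>) * \<mu>)) (at t)"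
      by (rule has_vector_derivative_real_field) (auto intro!: derivative_eq_intros)
    have "(w has_vector_derivative (exp (of_real t * \<mu>) *s N (p t) + (exp (of_real t * \<mu>) * \<mu>) *s p t)) (at t)"
      unfolding w_def by (rule has_vector_derivative_vector_smult[OF e p])
    moreover have "exp (of_real t * \<mu>) *s N (p t) + (exp (of_real t * \<mu>) * \<mu>) *s p t = B *v w t"
    proof -
      show ?thesis
        by (simp add: mat_vector_mult N_def w_def vector_scalar_commute matrix_vector_mult_diff_rdistrib
            vector_ssub_ldistrib vector_smult_assoc)
    qed
    ultimately show ?thesis by simp
  qed
  moreover have "norm (w t) \<le> (\<Sum>k<m. norm ((N ^^ k) v) / \<alpha> ^ k) * exp (- \<alpha> * t)" if "t \<ge> 0" for t
  proof -
    have "norm (p t) \<le> (\<Sum>k<m. exp (\<alpha> * t) * (norm ((N ^^ k) v) / \<alpha> ^ k))"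
      unfolding p_def
    proof (rule sum_norm_le)
      fix k
      have "t ^ k / fact k = ((\<alpha> * t) ^ k / fact k) / \<alpha> ^ k"
        using \<open>\<alpha> > 0\<close> by (simp add: power_mult_distrib)
      also have "\<dots> \<le> exp (\<alpha> * t) / \<alpha> ^ k"
        using \<open>\<alpha> > 0\<close> \<open>t \<ge> 0\<close> by (intro divide_right_mono power_div_fact_le_exp) auto
      finally have "t ^ k / fact k * norm ((N ^^ k) v) \<le> exp (\<alpha> * t) / \<alpha> ^ k * norm ((N ^^ k) v)"
        by (rule mult_right_mono) simp
      then show "norm ((t ^ k / fact k) *\<^sub>R (N ^^ k) v) \<le> exp (\<alpha> * t) * (norm ((N ^^ k) v) / \<alpha> ^ k)"
        using \<open>t \<ge> 0\<close> by simp
    qed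
    then have "norm (p t) \<le> exp (\<alpha> * t) * (\<Sum>k<m. norm ((N ^^ k) v) / \<alpha> ^ k)"
      by (simp only: sum_distrib_left)
    moreover have "norm (w t) = exp (- (2 * \<alpha>) * t) * norm (p t)"
      by (simp add: w_def norm_vector_smult \<alpha>_def mult.commute)
    ultimately have "norm (w t) \<le> exp (- (2 * \<alpha>) * t) * (exp (\<alpha> * t) * (\<Sum>k<m. norm ((N ^^ k) v) / \<alpha> ^ k))"
      by simp
    also have "\<dots> = (\<Sum>k<m. norm ((N ^^ k) v) / \<alpha> ^ k) * (exp (- (2 * \<alpha>) * t) * exp (\<alpha> * t))"
      by simp
    also have "exp (- (2 * \<alpha>) * t) * exp (\<alpha> * t) = exp (- \<alpha> * t)"
      by (simp flip: exp_add)
    finally show ?thesis .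
  qed
  ultimately show ?thesis
    unfolding decaying_orbit_def using \<open>\<alpha> > 0\<close> \<open>w 0 = v\<close> by blast
qed

lemma decaying_orbit_add:
  assumes "decaying_orbit B u" "decaying_orbit B v"
  shows "decaying_orbit B (u + v)"
proof -
  obtain w K \<alpha> where w: "0 < \<alpha>" "w 0 = u" "\<And>t. (w has_vector_derivative (B *v w t)) (at t)"
    "\<And>t. t \<ge> 0 \<Longrightarrow> norm (w t) \<le> K * exp (- \<alpha> * t)"
    using assms(1) unfolding decaying_orbit_def by auto
  obtain w' K' \<alpha>' where w': "0 < \<alpha>'" "w' 0 = v" "\<And>t. (w' has_vector_derivative (B *v w' t)) (at t)"
    "\<And>t. t \<ge> 0 \<Longrightarrow> norm (w' t) \<le> K' * exp (- \<alpha>' * t)"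
    using assms(2) unfolding decaying_orbit_def by auto
  have "norm (w t + w' t) \<le> (\<bar>K\<bar> + \<bar>K'\<bar>) * exp (- min \<alpha> \<alpha>' * t)" if "t \<ge> 0" for t
  proof -
    have "norm (w t) \<le> \<bar>K\<bar> * exp (- min \<alpha> \<alpha>' * t)"
      by (rule order_trans[OF w(4)[OF that]], rule mult_mono) (use that in \<open>auto simp: mult_right_mono\<close>)
    moreover have "norm (w' t) \<le> \<bar>K'\<bar> * exp (- min \<alpha> \<alpha>' * t)"
      by (rule order_trans[OF w'(4)[OF that]], rule mult_mono) (use that in \<open>auto simp: mult_right_mono\<close>)
    ultimately show ?thesis
      using norm_triangle_ineq[of "w t" "w' t"] by (simp add: algebra_simps)
  qed
  moreover have "((\<lambda>t. w t + w' t) has_vector_derivative (B *v (w t + w' t))) (at t)" for t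
    using has_vector_derivative_add[OF w(3) w'(3)] by (simp add: matrix_vector_right_distrib)
  ultimately show ?thesis
    unfolding decaying_orbit_def using w(1,2) w'(1,2)
    by (intro exI[of _ "\<lambda>t. w t + w' t"] exI[of _ "\<bar>K\<bar> + \<bar>K'\<bar>"] exI[of _ "min \<alpha> \<alpha>'"]) auto
qed

lemma decaying_orbit_smult:
  assumes "decaying_orbit B v"
  shows "decaying_orbit B (c *s v)"
proof -
  obtain w K \<alpha> where w: "0 < \<alpha>" "w 0 = v" "\<And>t. (w has_vector_derivative (B *v w t)) (at t)"
    "\<And>t. t \<ge> 0 \<Longrightarrow> norm (w t) \<le> K * exp (- \<alpha> * t)"
    using assms(1) unfolding decaying_orbit_def by auto
  have "norm (c *s w t) \<le> norm c * K * exp (- \<alpha> * t)" if "t \<ge> 0" for t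
    using mult_left_mono[OF w(4)[OF that], of "norm c"] by (simp add: norm_vector_smult mult.assoc)
  moreover have "((\<lambda>t. c *s w t) has_vector_derivative (B *v (c *s w t))) (at t)" for t
    using has_vector_derivative_vector_smult[OF has_vector_derivative_const w(3), of c]
    by (simp add: vector_scalar_commute)
  ultimately show ?thesis
    unfolding decaying_orbit_def using w(1,2) by (intro exI[of _ "\<lambda>t. c *s w t"]) auto
qed

lemma decaying_orbit_spectral_subspace:
  assumes "v \<in> spectral_subspace B T" "T \<subseteq> {\<mu>. Re \<mu> < 0}"
  shows "decaying_orbit B v"
  using assms(1) unfolding spectral_subspace_def
proof (induction rule: vec.span_induct_alt)
  case base
  show ?case
    unfolding decaying_orbit_def by (intro exI[of _ "\<lambda>_. 0"] exI[of _ 0] exI[of _ 1]) auto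
next
  case (step c x y)
  then have "decaying_orbit B x"
    using assms(2) decaying_orbit_gen_eigenspace by blast
  with step show ?case
    by (intro decaying_orbit_add decaying_orbit_smult)
qed

section \<open>Invariance of spectral subspaces and the propagator on the stable one\<close>

lemma gen_eigenspace_invariant:
  assumes "v \<in> gen_eigenspace B \<mu>"
  shows "B *v v \<in> gen_eigenspace B \<mu>"
proof -
  have comm: "((\<lambda>w. (B - mat \<mu>) *v w) ^^ m) (B *v u) = B *v (((\<lambda>w. (B - mat \<mu>) *v w) ^^ m) u)" for m u
  proof (induction m)
    case (Suc m)
    then show ?case
      by (simp add: mat_vector_mult matrix_vector_mult_diff_rdistrib matrix_vector_mult_diff_distrib vector_scalar_commute)
  qed simp
  show ?thesis
  proof -
    obtain m where "((\<lambda>w. (B - mat \<mu>) *v w) ^^ m) v = 0"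
      using assms unfolding gen_eigenspace_def by blast
    then have "((\<lambda>w. (B - mat \<mu>) *v w) ^^ m) (B *v v) = 0"
      by (simp only: comm matrix_vector_mult_0_right)
    then show ?thesis unfolding gen_eigenspace_def by blast
  qed
qed

lemma spectral_subspace_invariant:
  assumes "v \<in> spectral_subspace B T"
  shows "B *v v \<in> spectral_subspace B T"
  using assms unfolding spectral_subspace_def
proof (induction rule: vec.span_induct_alt)
  case base
  then show ?case by (simp add: vec.span_zero)
next
  case (step c x y)
  then have "B *v x \<in> vec.span (\<Union>\<mu>\<in>T. gen_eigenspace B \<mu>)"
    by (auto intro!: vec.span_base gen_eigenspace_invariant)
  with step show ?case
    by (simp add: matrix_vector_right_distrib vector_scalar_commute vec.span_add vec.span_scale)
qed

text \<open>Range and kernel of \<open>Q\<close> are spectral subspaces, hence both invariant under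
  \<open>B\<close>; a projection along two invariant complements commutes with
  \<open>B\<close>.\<close>

lemma spectral_projection_commute:
  assumes "spectral_projection B T Q"
  shows "B ** Q = Q ** B"
proof -
  have Q: "Q *v (Q *v v) = Q *v v" for v
    using assms by (metis matrix_vector_mul_assoc spectral_projection_def)
  have "B *v (Q *v v) = Q *v (B *v v)" for v
  proof -
    have "Q *v v \<in> spectral_subspace B T"
      using assms unfolding spectral_projection_def by blast
    then have "B *v (Q *v v) \<in> range (\<lambda>v. Q *v v)"
      using spectral_subspace_invariant assms unfolding spectral_projection_def by blast
    then have 1: "Q *v (B *v (Q *v v)) = B *v (Q *v v)"
      using Q by auto
    have "v - Q *v v \<in> {v. Q *v v = 0}"
      using Q by (simp add: matrix_vector_mult_diff_distrib)
    then have "B *v (v - Q *v v) \<in> {v. Q *v v = 0}"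
      using spectral_subspace_invariant assms unfolding spectral_projection_def by blast
    then have "Q *v (B *v v) = Q *v (B *v (Q *v v))"
      by (simp add: matrix_vector_mult_diff_distrib)
    with 1 show ?thesis by simp
  qed
  then show ?thesis
    by (subst matrix_eq) (simp flip: matrix_vector_mul_assoc)
qed

text \<open>\<open>S t\<close> is \<open>exp (t B) Q\<close>, built column by column from decaying
  orbits. Columns give the equation \<open>S' = B S\<close>, but variation of constants
  differentiates \<open>S (x - t)\<close> on the left of a solution and wants
  \<open>S' = S B\<close>; the two agree because \<open>Q\<close> commutes with
  \<open>B\<close>.\<close>

lemma spectral_decay:
  fixes B :: "complex^'n^'n"
  assumes Q: "spectral_projection B T Q" and T: "T \<subseteq> {\<mu>. Re \<mu> < 0}"
  obtains S K \<alpha> where "0 < \<alpha>" "0 < K" "S 0 = Q"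
    "\<And>t. t \<ge> 0 \<Longrightarrow> (S has_vector_derivative (S t ** B)) (at t)"
    "\<And>t. t \<ge> 0 \<Longrightarrow> norm (S t) \<le> K * exp (- \<alpha> * t)"
proof -
  have "decaying_orbit B (column i Q)" for i
  proof -
    have "column i Q = Q *v axis i 1"
      by (simp add: vec_eq_iff column_def matrix_vector_mult_def axis_def if_distrib cong: if_cong)
    then show ?thesis
      using Q T decaying_orbit_spectral_subspace unfolding spectral_projection_def by fastforce
  qed
  then obtain w K \<alpha> where w: "\<And>i. 0 < \<alpha> i" "\<And>i. w i 0 = column i Q"
    "\<And>i t. (w i has_vector_derivative (B *v w i t)) (at t)"
    "\<And>i t. t \<ge> 0 \<Longrightarrow> norm (w i t) \<le> K i * exp (- \<alpha> i * t)"
    unfolding decaying_orbit_def by metis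
  define a where "a = Min (range \<alpha>)"
  have a: "0 < a" "\<And>i. a \<le> \<alpha> i"
    using w(1) unfolding a_def by (auto simp: Min_gr_iff)
  \<comment> \<open>\<open>E j v\<close> is the matrix whose column \<open>j\<close> is
    \<open>v\<close> and whose other columns vanish, so that a sum of such terms assembles the
    columns linearly.\<close>
  define E :: "'n \<Rightarrow> complex^'n \<Rightarrow> complex^'n^'n" where "E j v = (\<chi> i k. if k = j then v $ i else 0)" for j v
  have "linear (E j)" for j
    by (rule linearI) (auto simp: E_def vec_eq_iff)
  then have E: "bounded_linear (E j)" for j
    by (simp add: linear_conv_bounded_linear)
  obtain C where C: "\<And>j v. norm (E j v) \<le> norm v * C j"
    using bounded_linear.bounded[OF E] by metis
  define S where "S t = (\<Sum>j\<in>UNIV. E j (w j t))" for t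
  have "S 0 = Q"
    by (simp add: S_def E_def w(2) column_def vec_eq_iff if_distrib cong: if_cong)
  have dS: "(S has_vector_derivative (B ** S t)) (at t)" for t
  proof -
    have "(S has_vector_derivative (\<Sum>j\<in>UNIV. E j (B *v w j t))) (at t)"
      unfolding S_def
      by (intro has_vector_derivative_sum bounded_linear.has_vector_derivative[OF E] w(3))
    moreover have "E j (B *v v) = B ** E j v" for j v
      by (simp add: E_def vec_eq_iff matrix_matrix_mult_def matrix_vector_mult_def)
    moreover have "(\<Sum>j\<in>UNIV. B ** E j (w j t)) = B ** S t"
      unfolding S_def
      by (rule linear_sum[symmetric], rule bounded_linear.linear,
          rule bounded_bilinear.bounded_linear_right[OF bounded_bilinear_matrix_matrix_mult])
    ultimately show ?thesis by simp
  qed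
  \<comment> \<open>The commutator satisfies \<open>D' = B D\<close> and vanishes at 0, where
    \<open>S 0 = Q\<close>.\<close>
  have comm: "B ** S t - S t ** B = 0" if "t \<ge> 0" for t
  proof (rule linear_ode_zero_unique[OF _ _ that, where B = B])
    fix t :: real
    have "((\<lambda>t. B ** S t - S t ** B) has_vector_derivative
        (B ** (B ** S t) + 0 ** S t - (S t ** 0 + (B ** S t) ** B))) (at t)"
      by (intro has_vector_derivative_diff has_vector_derivative_matrix_matrix_mult dS
          has_vector_derivative_const)
    then show "((\<lambda>t. B ** S t - S t ** B) has_vector_derivative (B ** (B ** S t - S t ** B))) (at t)"
      by (simp add: matrix_mul_assoc bounded_bilinear.diff_right[OF bounded_bilinear_matrix_matrix_mult]
          bounded_bilinear.zero_left[OF bounded_bilinear_matrix_matrix_mult]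
          bounded_bilinear.zero_right[OF bounded_bilinear_matrix_matrix_mult])
  next
    show "B ** S 0 - S 0 ** B = 0"
      using spectral_projection_commute[OF Q] \<open>S 0 = Q\<close> by simp
  qed
  \<comment> \<open>The summand 1 only makes the constant positive.\<close>
  have bound: "norm (S t) \<le> (1 + (\<Sum>j\<in>UNIV. \<bar>K j\<bar> * \<bar>C j\<bar>)) * exp (- a * t)" if "t \<ge> 0" for t
  proof -
    have "norm (E j (w j t)) \<le> (\<bar>K j\<bar> * \<bar>C j\<bar>) * exp (- a * t)" for j
    proof -
      have "norm (w j t) \<le> \<bar>K j\<bar> * exp (- a * t)"
        by (rule order_trans[OF w(4)[OF that]], rule mult_mono) (use that a in \<open>auto simp: mult_right_mono\<close>)
      moreover have "norm (E j (w j t)) \<le> norm (w j t) * \<bar>C j\<bar>"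
        by (rule order_trans[OF C], rule mult_left_mono) auto
      ultimately have "norm (E j (w j t)) \<le> \<bar>K j\<bar> * exp (- a * t) * \<bar>C j\<bar>"
        by (meson abs_ge_zero mult_right_mono order_trans)
      then show ?thesis by (simp add: mult_ac)
    qed
    then have "norm (S t) \<le> (\<Sum>j\<in>UNIV. (\<bar>K j\<bar> * \<bar>C j\<bar>) * exp (- a * t))"
      unfolding S_def by (intro sum_norm_le) auto
    also have "\<dots> \<le> (1 + (\<Sum>j\<in>UNIV. \<bar>K j\<bar> * \<bar>C j\<bar>)) * exp (- a * t)"
      by (simp add: sum_distrib_right distrib_right)
    finally show ?thesis .
  qed
  show ?thesis
  proof (rule that[of a "1 + (\<Sum>j\<in>UNIV. \<bar>K j\<bar> * \<bar>C j\<bar>)" S])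
    show "(S has_vector_derivative (S t ** B)) (at t)" if "t \<ge> 0" for t
      using dS[of t] comm[OF that] by simp
    have "0 \<le> (\<Sum>j\<in>UNIV. \<bar>K j\<bar> * \<bar>C j\<bar>)"
      by (intro sum_nonneg) auto
    then show "0 < 1 + (\<Sum>j\<in>UNIV. \<bar>K j\<bar> * \<bar>C j\<bar>)" by linarith
  qed (use a(1) \<open>S 0 = Q\<close> bound in auto)
qed

section \<open>Perturbed constant coefficient systems on an interval\<close>

lemma has_vector_derivative_interior_Icc:
  fixes Z :: "real \<Rightarrow> 'a::real_normed_vector"
  assumes "(Z has_vector_derivative D) (at t within {a..b})" "a < t" "t < b"
  shows "(Z has_vector_derivative D) (at t)"
  using assms at_within_Icc_at[of a t b] by simp

text \<open>Variation of constants. Since \<open>S' = S B\<close>, the constant coefficient part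
  cancels in the derivative of \<open>S (x - t) *v Z t\<close> and only \<open>G t - B\<close>
  remains. The perturbation is weighted with a decaying exponential, so its total effect is at most
  \<open>K * \<delta> * N / \<alpha>\<close> whatever the length \<open>L\<close>.\<close>

lemma stable_component_bound:
  fixes S :: "real \<Rightarrow> complex^'n^'n" and Z :: "real \<Rightarrow> complex^'n"
  assumes S0: "S 0 = Q"
    and S': "\<And>t. t \<ge> 0 \<Longrightarrow> (S has_vector_derivative (S t ** B)) (at t)"
    and S: "\<And>t. t \<ge> 0 \<Longrightarrow> norm (S t) \<le> K * exp (- \<alpha> * t)" "0 < \<alpha>" "0 < K"
    and Z': "\<And>x. x \<in> {0..L} \<Longrightarrow> (Z has_vector_derivative (G x *v Z x)) (at x within {0..L})"
    and G: "\<And>x. x \<in> {0..L} \<Longrightarrow> norm (G x - B) \<le> \<delta>"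
    and N: "\<And>x. x \<in> {0..L} \<Longrightarrow> norm (Z x) \<le> N"
    and x: "x \<in> {0..L}"
  shows "norm (Q *v Z x) \<le> K * exp (- \<alpha> * x) * norm (Z 0) + K * \<delta> * N / \<alpha>"
proof -
  have pos: "0 \<le> \<delta>" "0 \<le> N"
    using G[OF x] N[OF x] by (meson norm_ge_zero order_trans)+
  have init: "norm (S x *v Z 0) \<le> K * exp (- \<alpha> * x) * norm (Z 0)"
    by (rule order_trans[OF norm_matrix_vector_mult_le]) (use S(1)[of x] x in \<open>auto intro: mult_right_mono\<close>)
  show ?thesis
  proof (cases "x = 0")
    case True
    then show ?thesis
      using init S0 pos S(2,3) by (simp add: add_increasing2)
  next
    case False
    then have "0 < x" using x by auto
    define y where "y t = S (x - t) *v Z t" for t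
    \<comment> \<open>An antiderivative of the bound on \<open>y'\<close>; comparing the increments
      of \<open>y\<close> and \<open>\<phi>\<close> takes the place of integration.\<close>
    define \<phi> where "\<phi> t = K * \<delta> * N / \<alpha> * exp (- \<alpha> * (x - t))" for t
    have dy: "(y has_vector_derivative (S (x - t) *v ((G t - B) *v Z t))) (at t within {0..L})"
      if "t \<in> {0..x}" for t
    proof -
      have r: "((\<lambda>t. x - t) has_real_derivative -1) (at t within {0..L})"
        by (auto intro!: derivative_eq_intros)
      have "((\<lambda>t. S (x - t)) has_vector_derivative ((-1) *\<^sub>R (S (x - t) ** B))) (at t within {0..L})"
        using vector_diff_chain_within[OF r[unfolded has_real_derivative_iff_has_vector_derivative]
            has_vector_derivative_at_within[OF S'[of "x - t"]]] that
        by (simp add: o_def)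
      then have "(y has_vector_derivative (S (x - t) *v (G t *v Z t) + ((-1) *\<^sub>R (S (x - t) ** B)) *v Z t)) (at t within {0..L})"
        unfolding y_def using that x by (intro has_vector_derivative_matrix_vector_mult Z') auto
      moreover have "((-1) *\<^sub>R (S (x - t) ** B)) *v Z t = - (S (x - t) *v (B *v Z t))"
        by (simp add: matrix_vector_mul_assoc bounded_bilinear.minus_left[OF bounded_bilinear_matrix_vector_mult])
      ultimately show ?thesis
        by (simp add: matrix_vector_mult_diff_distrib matrix_vector_mult_diff_rdistrib)
    qed
    have "norm (y x - y 0) \<le> \<phi> x - \<phi> 0"
    proof (rule differentiable_bound_general[OF \<open>0 < x\<close>])
      show "continuous_on {0..x} y"
        unfolding continuous_on_eq_continuous_within
        using has_vector_derivative_continuous[OF has_vector_derivative_within_subset[OF dy]] x by fastforce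
      show "continuous_on {0..x} \<phi>"
        unfolding \<phi>_def by (intro continuous_intros)
      fix t assume t: "0 < t" "t < x"
      show "(y has_vector_derivative (S (x - t) *v ((G t - B) *v Z t))) (at t)"
        using dy[of t] t x by (intro has_vector_derivative_interior_Icc[of y _ t 0 L]) auto
      show "(\<phi> has_vector_derivative (K * \<delta> * N * exp (- \<alpha> * (x - t)))) (at t)"
        unfolding \<phi>_def has_real_derivative_iff_has_vector_derivative[symmetric]
        using S(2) by (auto intro!: derivative_eq_intros)
      have "norm (S (x - t) *v ((G t - B) *v Z t)) \<le> norm (S (x - t)) * (norm (G t - B) * norm (Z t))"
        by (meson mult_left_mono norm_ge_zero norm_matrix_vector_mult_le order_trans)
      also have "\<dots> \<le> (K * exp (- \<alpha> * (x - t))) * (\<delta> * N)"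
        using t x pos S(3) by (intro mult_mono S G N) auto
      finally show "norm (S (x - t) *v ((G t - B) *v Z t)) \<le> K * \<delta> * N * exp (- \<alpha> * (x - t))"
        by (simp add: mult_ac)
    qed
    also have "\<dots> \<le> K * \<delta> * N / \<alpha>"
      unfolding \<phi>_def using pos S(2,3) by simp
    finally have "norm (Q *v Z x - S x *v Z 0) \<le> K * \<delta> * N / \<alpha>"
      by (simp add: y_def S0)
    with init show ?thesis
      using norm_triangle_sub[of "Q *v Z x" "S x *v Z 0"] by linarith
  qed
qed

lemma has_vector_derivative_reflect:
  fixes Z :: "real \<Rightarrow> 'a::real_normed_vector"
  assumes "(Z has_vector_derivative D) (at (c - x) within S)"
  shows "((\<lambda>x. Z (c - x)) has_vector_derivative (- D)) (at x within ((\<lambda>x. c - x) ` S))"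
proof -
  have r: "((\<lambda>t. c - t) has_real_derivative -1) (at x within ((\<lambda>x. c - x) ` S))"
    by (auto intro!: derivative_eq_intros)
  have "(\<lambda>x. c - x) ` ((\<lambda>x. c - x) ` S) = S"
    by (auto simp: image_image)
  then show ?thesis
    using vector_diff_chain_within[OF r[unfolded has_real_derivative_iff_has_vector_derivative], of Z D] assms
    by (simp add: o_def)
qed

lemma matrix_uminus_vector_mult: "(- A) *v x = - (A *v (x :: complex^'n))"
  by (rule bounded_bilinear.minus_left[OF bounded_bilinear_matrix_vector_mult])

text \<open>The reflection \<open>x \<mapsto> L - x\<close> turns the unstable part of
  \<open>B\<close> into the stable part of \<open>- B\<close>, so the component is small away from
  the right end.\<close>

lemma unstable_component_bound:
  fixes S :: "real \<Rightarrow> complex^'n^'n" and Z :: "real \<Rightarrow> complex^'n"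
  assumes S0: "S 0 = Q"
    and S': "\<And>t. t \<ge> 0 \<Longrightarrow> (S has_vector_derivative (S t ** (- B))) (at t)"
    and S: "\<And>t. t \<ge> 0 \<Longrightarrow> norm (S t) \<le> K * exp (- \<alpha> * t)" "0 < \<alpha>" "0 < K"
    and Z': "\<And>x. x \<in> {0..L} \<Longrightarrow> (Z has_vector_derivative (G x *v Z x)) (at x within {0..L})"
    and G: "\<And>x. x \<in> {0..L} \<Longrightarrow> norm (G x - B) \<le> \<delta>"
    and N: "\<And>x. x \<in> {0..L} \<Longrightarrow> norm (Z x) \<le> N"
    and x: "x \<in> {0..L}"
  shows "norm (Q *v Z x) \<le> K * exp (- \<alpha> * (L - x)) * norm (Z L) + K * \<delta> * N / \<alpha>"
proof -
  have img: "(\<lambda>x. L - x) ` {0..L} = {0..L}"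
    by (simp add: image_diff_atLeastAtMost)
  have "norm (Q *v Z (L - (L - x))) \<le> K * exp (- \<alpha> * (L - x)) * norm (Z (L - 0)) + K * \<delta> * N / \<alpha>"
  proof (rule stable_component_bound[OF S0 S' S, where Z = "\<lambda>x. Z (L - x)" and G = "\<lambda>x. - G (L - x)" and L = L])
    fix x assume x: "x \<in> {0..L}"
    then have "L - x \<in> {0..L}" by auto
    from has_vector_derivative_reflect[OF Z'[OF this]]
    show "((\<lambda>x. Z (L - x)) has_vector_derivative - G (L - x) *v Z (L - x)) (at x within {0..L})"
      by (simp add: img matrix_uminus_vector_mult)
    show "norm (Z (L - x)) \<le> N" using N x by auto
    show "norm (- G (L - x) - - B) \<le> \<delta>"
      using G[of "L - x"] x by (simp add: norm_minus_commute)
  qed (use x in auto)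
  then show ?thesis by simp
qed

text \<open>A left eigenvector \<open>f\<close> of \<open>A\<close> reduces the system to the scalar
  equation with rate \<open>\<mu>\<close> and forcing \<open>f ((G - A) *v Z)\<close>. There is no
  decay here, so the error carries the factor \<open>L\<close>. One \<open>exp c\<close> bounds the
  integrating factor, the other arises when it is multiplied back.\<close>

lemma center_component_bound:
  fixes f :: "complex^'n \<Rightarrow> complex" and Z :: "real \<Rightarrow> complex^'n"
  assumes f: "bounded_linear f" "\<And>v. f (A *v v) = \<mu> * f v" "\<And>v. norm (f v) \<le> F * norm v"
    and Z': "\<And>x. x \<in> {0..L} \<Longrightarrow> (Z has_vector_derivative (G x *v Z x)) (at x within {0..L})"
    and G: "\<And>x. x \<in> {0..L} \<Longrightarrow> norm (G x - A) \<le> \<delta>"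
    and N: "\<And>x. x \<in> {0..L} \<Longrightarrow> norm (Z x) \<le> N"
    and \<mu>: "\<bar>Re \<mu>\<bar> * L \<le> c"
    and F: "0 \<le> F"
    and x: "x \<in> {0..L}"
  shows "\<bar>norm (f (Z x)) - exp (Re \<mu> * x) * norm (f (Z 0))\<bar> \<le> exp (2 * c) * F * \<delta> * N * L"
proof -
  have pos: "0 \<le> \<delta>" "0 \<le> N" "0 \<le> L"
    using G[OF x] N[OF x] x by (auto intro: order_trans[OF norm_ge_zero])
  have ex: "exp (Re \<mu> * t) \<le> exp c" "exp (- Re \<mu> * t) \<le> exp c" if "t \<in> {0..L}" for t
  proof -
    have "\<bar>Re \<mu> * t\<bar> \<le> c"
      using that \<mu> by (simp add: abs_mult) (meson abs_ge_zero mult_left_mono order_trans)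
    then show "exp (Re \<mu> * t) \<le> exp c" "exp (- Re \<mu> * t) \<le> exp c" by auto
  qed
  have bound: "norm (f (Z x) - exp (of_real x * \<mu>) * f (Z 0)) \<le> exp (2 * c) * F * \<delta> * N * L"
  proof (cases "x = 0")
    case True
    then show ?thesis using pos F by simp
  next
    case False
    then have "0 < x" using x by auto
    define y where "y t = exp (- of_real t * \<mu>) * f (Z t)" for t :: real
    define \<phi> where "\<phi> t = exp c * F * \<delta> * N * t" for t
    have dy: "(y has_vector_derivative (exp (- of_real t * \<mu>) * f ((G t - A) *v Z t))) (at t within {0..L})"
      if "t \<in> {0..x}" for t
    proof -
      have e: "((\<lambda>t. exp (- of_real t * \<mu>)) has_vector_derivative (exp (- of_real t * \<mu>) * (- \<mu>))) (at t within {0..L})"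
        by (rule has_vector_derivative_real_field) (auto intro!: derivative_eq_intros)
      have "((\<lambda>t. f (Z t)) has_vector_derivative (f (G t *v Z t))) (at t within {0..L})"
        using that x by (intro bounded_linear.has_vector_derivative[OF f(1) Z']) auto
      from has_vector_derivative_mult[OF e this] show ?thesis
        unfolding y_def
        by (simp add: matrix_vector_mult_diff_rdistrib linear_diff[OF bounded_linear.linear[OF f(1)]] f(2) algebra_simps)
    qed
    have "norm (y x - y 0) \<le> \<phi> x - \<phi> 0"
    proof (rule differentiable_bound_general[OF \<open>0 < x\<close>])
      show "continuous_on {0..x} y"
        unfolding continuous_on_eq_continuous_within
        using has_vector_derivative_continuous[OF has_vector_derivative_within_subset[OF dy]] x by fastforce
      show "continuous_on {0..x} \<phi>"
        unfolding \<phi>_def by (intro continuous_intros)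
      fix t assume t: "0 < t" "t < x"
      show "(y has_vector_derivative (exp (- of_real t * \<mu>) * f ((G t - A) *v Z t))) (at t)"
        using dy[of t] t x by (intro has_vector_derivative_interior_Icc[of y _ t 0 L]) auto
      show "(\<phi> has_vector_derivative (exp c * F * \<delta> * N)) (at t)"
        unfolding \<phi>_def has_real_derivative_iff_has_vector_derivative[symmetric]
        by (auto intro!: derivative_eq_intros)
      have "norm (f ((G t - A) *v Z t)) \<le> F * (norm (G t - A) * norm (Z t))"
        by (meson F f(3) mult_left_mono norm_matrix_vector_mult_le order_trans)
      also have "\<dots> \<le> F * (\<delta> * N)"
        using t x pos F by (intro mult_left_mono mult_mono G N) auto
      finally have "norm (f ((G t - A) *v Z t)) \<le> F * (\<delta> * N)" .
      then have "exp (- Re \<mu> * t) * norm (f ((G t - A) *v Z t)) \<le> exp c * (F * (\<delta> * N))"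
        using t x by (intro mult_mono ex) auto
      then show "norm (exp (- of_real t * \<mu>) * f ((G t - A) *v Z t)) \<le> exp c * F * \<delta> * N"
        by (simp add: norm_mult mult_ac)
    qed
    also have "\<dots> \<le> exp c * F * \<delta> * N * L"
      unfolding \<phi>_def using x pos F by (auto intro!: mult_left_mono)
    finally have *: "norm (y x - y 0) \<le> exp c * F * \<delta> * N * L" .
    have "f (Z x) - exp (of_real x * \<mu>) * f (Z 0) = exp (of_real x * \<mu>) * (y x - y 0)"
      by (simp add: y_def right_diff_distrib mult.assoc[symmetric] flip: exp_add)
    then have "norm (f (Z x) - exp (of_real x * \<mu>) * f (Z 0)) = exp (Re \<mu> * x) * norm (y x - y 0)"
      by (simp add: norm_mult mult.commute)
    also have "\<dots> \<le> exp c * (exp c * F * \<delta> * N * L)"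
      using * ex x by (intro mult_mono) auto
    also have "\<dots> = exp (2 * c) * F * \<delta> * N * L"
      by (simp add: mult.assoc[symmetric] flip: exp_add)
    finally show ?thesis .
  qed
  have "norm (exp (of_real x * \<mu>) * f (Z 0)) = exp (Re \<mu> * x) * norm (f (Z 0))"
    by (simp add: norm_mult mult.commute)
  with bound show ?thesis
    using norm_triangle_ineq3[of "f (Z x)" "exp (of_real x * \<mu>) * f (Z 0)"] by linarith
qed

section \<open>Spectral decomposition at the base point\<close>

lemma spectral_subspace_mono: "T \<subseteq> T' \<Longrightarrow> spectral_subspace B T \<subseteq> spectral_subspace B T'"
  unfolding spectral_subspace_def by (intro vec.span_mono) auto

lemma spectral_projection_disjoint:
  assumes "spectral_projection B T Q" "spectral_projection B T' Q'" "T \<inter> T' = {}"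
  shows "Q *v (Q' *v v) = 0"
proof -
  have "Q' *v v \<in> spectral_subspace B T'"
    using assms(2) unfolding spectral_projection_def by blast
  also have "\<dots> \<subseteq> spectral_subspace B (- T)"
    using assms(3) by (intro spectral_subspace_mono) auto
  finally show ?thesis
    using assms(1) unfolding spectral_projection_def by blast
qed

lemma spectral_projection_idem:
  assumes "spectral_projection B T Q"
  shows "Q *v (Q *v v) = Q *v v"
  using assms by (metis matrix_vector_mul_assoc spectral_projection_def)

lemma spectral_projection_fixes:
  assumes "spectral_projection B T Q" "v \<in> spectral_subspace B T"
  shows "Q *v v = v"
proof -
  obtain u where "v = Q *v u"
    using assms unfolding spectral_projection_def by blast
  then show ?thesis
    using spectral_projection_idem[OF assms(1)] by simp
qed

text \<open>The residual \<open>w\<close> is annihilated by all three projections. The kernel of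
  \<open>Q1\<close> is by definition the spectral subspace of \<open>T2 \<union> T3\<close>, so
  \<open>w\<close> splits into a \<open>T2\<close> part and a \<open>T3\<close> part;
  \<open>Q2\<close> and \<open>Q3\<close> extract these parts from \<open>w\<close>, hence both are
  0.\<close>

lemma spectral_projection_sum3:
  assumes Q: "spectral_projection B T1 Q1" "spectral_projection B T2 Q2" "spectral_projection B T3 Q3"
    and disj: "T1 \<inter> T2 = {}" "T1 \<inter> T3 = {}" "T2 \<inter> T3 = {}" and un: "- T1 = T2 \<union> T3"
  shows "Q1 *v v + Q2 *v v + Q3 *v v = v"
proof -
  define w where "w = v - Q1 *v v - Q2 *v v - Q3 *v v"
  note dj = spectral_projection_disjoint
  have "Q1 *v w = 0" "Q2 *v w = 0" "Q3 *v w = 0"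
    unfolding w_def
    by (simp_all add: matrix_vector_mult_diff_distrib spectral_projection_idem[OF Q(1)]
        spectral_projection_idem[OF Q(2)] spectral_projection_idem[OF Q(3)]
        dj[OF Q(1,2)] dj[OF Q(1,3)] dj[OF Q(2,1)] dj[OF Q(2,3)] dj[OF Q(3,1)] dj[OF Q(3,2)]
        disj Int_commute[of T2 T1] Int_commute[of T3])
  then have "w \<in> spectral_subspace B (T2 \<union> T3)"
    using Q(1) un unfolding spectral_projection_def by auto
  then obtain a b where w: "w = a + b" and ab: "a \<in> spectral_subspace B T2" "b \<in> spectral_subspace B T3"
    unfolding spectral_subspace_def UN_Un vec.span_Un by auto
  have a: "Q2 *v a = a" and b: "Q3 *v b = b"
    using spectral_projection_fixes Q ab by blast+
  have "Q2 *v b = 0" "Q3 *v a = 0"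
    using dj[OF Q(2,3) disj(3), of b] dj[OF Q(3,2), of a] disj(3) a b by auto
  then have "a = 0" "b = 0"
    using \<open>Q2 *v w = 0\<close> \<open>Q3 *v w = 0\<close> a b w by (auto simp: matrix_vector_right_distrib)
  then have "w = 0" using w by simp
  then show ?thesis unfolding w_def by (simp add: algebra_simps)
qed

lemma gen_eigenspace_trivial:
  assumes "\<not> eigenvalue B \<mu>"
  shows "gen_eigenspace B \<mu> \<subseteq> {0}"
proof
  fix v assume "v \<in> gen_eigenspace B \<mu>"
  then obtain m where m: "((\<lambda>w. (B - mat \<mu>) *v w) ^^ m) v = 0"
    unfolding gen_eigenspace_def by blast
  have inj: "u = 0" if "(B - mat \<mu>) *v u = 0" for u
    using assms that unfolding eigenvalue_def
    by (auto simp: matrix_vector_mult_diff_rdistrib mat_vector_mult)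
  from m have "v = 0"
    by (induction m) (auto dest: inj)
  then show "v \<in> {0}" by simp
qed

text \<open>Purely imaginary numbers other than \<open>\<i> * of_real k\<close> have a trivial
  generalized eigenspace, so the center range lies in the one-dimensional one. This is what allows
  one scalar functional to measure the whole center component.\<close>

lemma simple_center_line:
  fixes B :: "complex^'n^'n"
  assumes Q: "spectral_projection B {\<mu>. Re \<mu> = 0} Q"
    and simple: "algebraic_multiplicity B (\<i> * of_real k) = 1"
    and only: "\<And>\<mu>. eigenvalue B \<mu> \<Longrightarrow> \<mu> \<noteq> \<i> * of_real k \<Longrightarrow> Re \<mu> \<noteq> 0"
  obtains r where "\<And>v. \<exists>s. Q *v v = s *s r"
proof -
  let ?V = "gen_eigenspace B (\<i> * of_real k)"
  obtain b where "b \<subseteq> ?V" "vec.independent b" and b: "?V \<subseteq> vec.span b" "card b = vec.dim ?V"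
    by (rule vec.basis_exists)
  have "card b = 1"
    by (rule trans[OF b(2) simple[unfolded algebraic_multiplicity_def]])
  then obtain r where r: "b = {r}"
    by (rule card_1_singletonE)
  have "gen_eigenspace B \<mu> \<subseteq> vec.span {r}" if "Re \<mu> = 0" for \<mu>
  proof (cases "\<mu> = \<i> * of_real k")
    case True
    then show ?thesis using b(1) r by simp
  next
    case False
    then have "gen_eigenspace B \<mu> \<subseteq> {0}"
      using only that by (intro gen_eigenspace_trivial) blast
    also have "\<dots> \<subseteq> vec.span {r}"
      by (simp add: vec.span_zero)
    finally show ?thesis .
  qed
  then have "spectral_subspace B {\<mu>. Re \<mu> = 0} \<subseteq> vec.span {r}"
    unfolding spectral_subspace_def by (intro vec.span_minimal) auto
  then have "Q *v v \<in> vec.span {r}" for v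
    using Q unfolding spectral_projection_def by blast
  then have "\<exists>s. Q *v v = s *s r" for v
    by (auto simp: vec.span_singleton)
  then show ?thesis using that by blast
qed

section \<open>Left eigenvectors\<close>

text \<open>Bilinear, without complex conjugation, so that a left eigenvector yields
  \<open>pairing l (A *v v) = \<mu> * pairing l v\<close> with \<open>\<mu>\<close> itself.\<close>

definition pairing :: "complex^'n \<Rightarrow> complex^'n \<Rightarrow> complex" where
  "pairing l v = (\<Sum>i\<in>UNIV. l $ i * v $ i)"

lemma norm_pairing_le: "norm (pairing l v) \<le> norm l * norm v"
proof -
  have "norm (pairing l v) \<le> (\<Sum>i\<in>UNIV. \<bar>norm (l $ i)\<bar> * \<bar>norm (v $ i)\<bar>)"
    unfolding pairing_def by (simp add: sum_norm_le norm_mult)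
  also have "\<dots> \<le> norm l * norm v"
    unfolding norm_vec_def by (rule L2_set_mult_ineq)
  finally show ?thesis .
qed

lemma pairing_smult_left: "pairing (c *s l) v = c * pairing l v"
  by (simp add: pairing_def sum_distrib_left mult.assoc)

lemma pairing_smult_right: "pairing l (c *s v) = c * pairing l v"
  by (simp add: pairing_def sum_distrib_left mult_ac)

lemma pairing_add_right: "pairing l (u + v) = pairing l u + pairing l v"
  by (simp add: pairing_def sum.distrib distrib_left)

lemma pairing_zero_right: "pairing l 0 = 0"
  by (simp add: pairing_def)

lemma pairing_diff_left: "pairing (l - l') v = pairing l v - pairing l' v"
  by (simp add: pairing_def sum_subtractf left_diff_distrib)

lemma bounded_linear_pairing: "bounded_linear (pairing l)"
proof (rule bounded_linear_intro)
  show "pairing l (r *\<^sub>R v) = r *\<^sub>R pairing l v" for r v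
    using pairing_smult_right[of l "of_real r" v] by (simp add: vector_smult_of_real scaleR_conv_of_real)
  show "norm (pairing l v) \<le> norm v * norm l" for v
    using norm_pairing_le[of l v] by (simp add: mult.commute)
qed (rule pairing_add_right)

lemma pairing_matrix_vector_mult: "pairing l (A *v v) = pairing (l v* A) v"
  unfolding pairing_def matrix_vector_mult_def vector_matrix_mult_def
  by (simp add: sum_distrib_left sum_distrib_right mult_ac) (rule sum.swap)

lemma det_eq_0_imp_kernel:
  fixes M :: "complex^'n^'n"
  assumes "det M = 0"
  obtains v where "v \<noteq> 0" "M *v v = 0"
proof -
  have "\<not> invertible M"
    using assms by (simp add: invertible_det_nz)
  then show ?thesis
    using that by (metis invertible_left_inverse matrix_left_invertible_ker)
qed

text \<open>A matrix and its transpose have the same determinant. The unit length is chosen so that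
  left eigenvectors at different parameters stay on a compact sphere.\<close>

lemma eigenvalue_left_eigenvector:
  fixes A :: "complex^'n^'n"
  assumes "eigenvalue A \<mu>"
  obtains l where "norm l = 1" "l v* A = \<mu> *s l"
proof -
  obtain v where v: "v \<noteq> 0" "A *v v = \<mu> *s v"
    using assms unfolding eigenvalue_def by blast
  have "\<not> invertible (A - mat \<mu>)"
  proof
    assume "invertible (A - mat \<mu>)"
    moreover have "(A - mat \<mu>) *v v = 0"
      using v by (simp add: matrix_vector_mult_diff_rdistrib mat_vector_mult)
    ultimately show False
      using v(1) by (metis invertible_left_inverse matrix_left_invertible_ker)
  qed
  then have "det (transpose (A - mat \<mu>)) = 0"
    by (simp add: invertible_det_nz)
  then obtain w where w: "w \<noteq> 0" "transpose (A - mat \<mu>) *v w = 0"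
    by (rule det_eq_0_imp_kernel)
  have mat: "w v* mat \<mu> = \<mu> *s w"
    using mat_vector_mult[of \<mu> w] by (metis transpose_mat transpose_matrix_vector)
  have eig: "w v* A = \<mu> *s w"
    using w(2) mat by (simp add: vector_matrix_mult_diff_rdistrib)
  define l where "l = of_real (1 / norm w) *s w"
  have "norm l = 1"
    using w(1) by (simp add: l_def norm_vector_smult norm_divide)
  moreover have "l v* A = \<mu> *s l"
    unfolding l_def by (simp add: scalar_vector_matrix_assoc eig vector_smult_assoc mult.commute)
  ultimately show ?thesis using that by blast
qed

text \<open>Biorthogonality: under the pairing with \<open>l\<close>, each application of
  \<open>B - mat \<mu>'\<close> becomes multiplication by \<open>\<mu> - \<mu>'\<close>, so the
  power that annihilates \<open>v\<close> forces the pairing to vanish.\<close>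

lemma pairing_gen_eigenspace:
  assumes l: "l v* B = \<mu> *s l" and v: "v \<in> gen_eigenspace B \<mu>'" and "\<mu>' \<noteq> \<mu>"
  shows "pairing l v = 0"
proof -
  have step: "pairing l ((B - mat \<mu>') *v u) = (\<mu> - \<mu>') * pairing l u" for u
    using bounded_linear.linear[OF bounded_linear_pairing, of l]
    by (simp add: matrix_vector_mult_diff_rdistrib linear_diff pairing_matrix_vector_mult[of l B] l
        pairing_smult_left pairing_smult_right mat_vector_mult left_diff_distrib)
  have pow: "pairing l (((\<lambda>w. (B - mat \<mu>') *v w) ^^ m) v) = (\<mu> - \<mu>') ^ m * pairing l v" for m
    by (induction m) (simp_all add: step)
  obtain m where "((\<lambda>w. (B - mat \<mu>') *v w) ^^ m) v = 0"
    using v unfolding gen_eigenspace_def by blast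
  then have "(\<mu> - \<mu>') ^ m * pairing l v = 0"
    using pow[of m] by (simp add: pairing_zero_right)
  then show ?thesis using assms(3) by simp
qed

lemma pairing_spectral_subspace:
  assumes l: "l v* B = \<mu> *s l" and v: "v \<in> spectral_subspace B T" and "\<mu> \<notin> T"
  shows "pairing l v = 0"
  using v unfolding spectral_subspace_def
proof (induction rule: vec.span_induct_alt)
  case (step c x y)
  then have "pairing l x = 0"
    using pairing_gen_eigenspace[OF l, of x] \<open>\<mu> \<notin> T\<close> by blast
  then show ?case using step by (simp add: pairing_add_right pairing_smult_right)
qed (rule pairing_zero_right)

text \<open>On the center line every left eigenvector is a multiple of the coordinate, so its
  modulus determines the center component.\<close>

lemma left_eigenvector_center_norm:
  fixes B :: "complex^'n^'n"
  assumes Qu: "spectral_projection B {\<mu>. Re \<mu> > 0} Qu"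
    and Qc: "spectral_projection B {\<mu>. Re \<mu> = 0} Qc"
    and Qs: "spectral_projection B {\<mu>. Re \<mu> < 0} Qs"
    and simple: "algebraic_multiplicity B (\<i> * of_real k) = 1"
    and only: "\<And>\<mu>. eigenvalue B \<mu> \<Longrightarrow> \<mu> \<noteq> \<i> * of_real k \<Longrightarrow> Re \<mu> \<noteq> 0"
    and l: "l v* B = (\<i> * of_real k) *s l" "l \<noteq> 0"
  obtains c where "c > 0" "\<And>v. norm (pairing l v) = c * norm (Qc *v v)"
proof -
  obtain r where r: "\<And>v. \<exists>s. Qc *v v = s *s r"
    using simple_center_line[OF Qc simple only] by blast
  have sum: "Qu *v v + Qc *v v + Qs *v v = v" for v
    by (rule spectral_projection_sum3[OF Qu Qc Qs]) auto
  have zero: "pairing l (Qu *v v) = 0" "pairing l (Qs *v v) = 0" for v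
  proof -
    have "Qu *v v \<in> spectral_subspace B {\<mu>. Re \<mu> > 0}" "Qs *v v \<in> spectral_subspace B {\<mu>. Re \<mu> < 0}"
      using Qu Qs unfolding spectral_projection_def by blast+
    then show "pairing l (Qu *v v) = 0" "pairing l (Qs *v v) = 0"
      by (auto intro: pairing_spectral_subspace[OF l(1)])
  qed
  have pc: "pairing l v = pairing l (Qc *v v)" for v
    using arg_cong[OF sum[of v], of "pairing l"] by (simp add: pairing_add_right zero)
  \<comment> \<open>Otherwise \<open>l\<close> would annihilate the center line too, hence every
    vector.\<close>
  have "pairing l r \<noteq> 0"
  proof
    assume "pairing l r = 0"
    then have z: "pairing l v = 0" for v
      using pc[of v] r[of v] by (auto simp: pairing_smult_right)
    have "l $ i = 0" for i
      using z[of "axis i 1"] by (simp add: pairing_def axis_def if_distrib cong: if_cong)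
    then show False using l(2) by (simp add: vec_eq_iff)
  qed
  then have "r \<noteq> 0" by (auto simp: pairing_zero_right)
  show ?thesis
  proof (rule that)
    show "norm (pairing l r) / norm r > 0"
      using \<open>r \<noteq> 0\<close> \<open>pairing l r \<noteq> 0\<close> by simp
    fix v
    obtain s where "Qc *v v = s *s r" using r by blast
    then show "norm (pairing l v) = norm (pairing l r) / norm r * norm (Qc *v v)"
      using pc[of v] \<open>r \<noteq> 0\<close> by (simp add: pairing_smult_right norm_mult norm_vector_smult)
  qed
qed

lemma bounded_bilinear_vector_matrix_mult:
  "bounded_bilinear (\<lambda>x (A :: complex^'n^'m). x v* A)"
proof
  show "\<exists>K. \<forall>x (A :: complex^'n^'m). norm (x v* A) \<le> norm x * norm A * K"
  proof -
    have "bounded_linear (transpose :: complex^'n^'m \<Rightarrow> complex^'m^'n)"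
      unfolding linear_conv_bounded_linear[symmetric]
      by (rule linearI) (auto simp: transpose_def vec_eq_iff)
    from bounded_linear.bounded[OF this]
    obtain K where K: "\<And>A :: complex^'n^'m. norm (transpose A) \<le> norm A * K"
      by auto
    have "norm (x v* A) \<le> norm x * norm A * K" for x and A :: "complex^'n^'m"
    proof -
      have "norm (x v* A) \<le> norm (transpose A) * norm x"
        using norm_matrix_vector_mult_le[of "transpose A" x] by simp
      also have "\<dots> \<le> norm A * K * norm x"
        by (rule mult_right_mono[OF K]) simp
      finally show ?thesis by (simp add: mult_ac)
    qed
    then show ?thesis by blast
  qed
  show "(r *\<^sub>R x) v* A = r *\<^sub>R (x v* A)" "x v* (r *\<^sub>R A) = r *\<^sub>R (x v* A)"
    for r x and A :: "complex^'n^'m"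
    by (simp_all add: vec_eq_iff vector_matrix_mult_def scaleR_right.sum)
qed (simp_all only: vector_matrix_left_distrib vector_matrix_mult_add_rdistrib)

text \<open>Compactness of the unit sphere replaces an analytic choice of the left eigenvector.\<close>

lemma approximate_center_functional:
  fixes A :: "complex \<Rightarrow> complex^'n^'n"
  assumes Qu: "spectral_projection (A zs) {\<mu>. Re \<mu> > 0} Qu"
    and Qc: "spectral_projection (A zs) {\<mu>. Re \<mu> = 0} Qc"
    and Qs: "spectral_projection (A zs) {\<mu>. Re \<mu> < 0} Qs"
    and simple: "algebraic_multiplicity (A zs) (\<i> * of_real k) = 1"
    and only: "\<And>\<mu>. eigenvalue (A zs) \<mu> \<Longrightarrow> \<mu> \<noteq> \<i> * of_real k \<Longrightarrow> Re \<mu> \<noteq> 0"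
    and cont: "isCont A zs" "isCont \<mu> zs" "\<mu> zs = \<i> * of_real k"
    and ev: "\<forall>\<^sub>F z in nhds zs. eigenvalue (A z) (\<mu> z)"
    and "e > 0"
  shows "\<forall>\<^sub>F z in nhds zs. \<exists>l. l v* A z = \<mu> z *s l \<and>
           (\<forall>v. \<bar>norm (pairing l v) - norm (Qc *v v)\<bar> \<le> e * norm v)"
    (is "\<forall>\<^sub>F z in nhds zs. ?P z")
proof (rule ccontr)
  assume no: "\<not> ?thesis"
  \<comment> \<open>A countable neighbourhood base turns the failure of the eventual statement into
    a sequence of bad parameters converging to \<open>zs\<close>.\<close>
  obtain V :: "nat \<Rightarrow> complex set"
    where V: "\<And>n. open (V n)" "\<And>n. zs \<in> V n" "\<And>F. \<forall>n. F n \<in> V n \<Longrightarrow> F \<longlonglongrightarrow> zs"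
    by (rule first_countable_topology_class.countable_basis[of zs]) blast
  have "\<exists>z. z \<in> V n \<and> eigenvalue (A z) (\<mu> z) \<and> \<not> ?P z" for n
  proof (rule ccontr)
    assume a: "\<not> ?thesis"
    have "\<forall>\<^sub>F z in nhds zs. z \<in> V n"
      using V(1,2) by (rule eventually_nhds_in_open)
    with ev have "\<forall>\<^sub>F z in nhds zs. ?P z"
      by eventually_elim (use a in blast)
    with no show False by simp
  qed
  then obtain z where "\<And>n. z n \<in> V n"
    and eig: "\<And>n. eigenvalue (A (z n)) (\<mu> (z n))" and nP: "\<And>n. \<not> ?P (z n)"
    by metis
  then have z_lim: "z \<longlonglongrightarrow> zs" using V(3) by blast
  have "\<exists>l. norm l = 1 \<and> l v* A (z n) = \<mu> (z n) *s l" for n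
    using eigenvalue_left_eigenvector[OF eig[of n]] by blast
  then obtain l where l: "\<And>n. norm (l n) = 1" "\<And>n. l n v* A (z n) = \<mu> (z n) *s l n"
    by metis
  \<comment> \<open>By continuity of \<open>A\<close> and \<open>\<mu>\<close>, a limit point of the
    unit left eigenvectors is a unit left eigenvector of \<open>A zs\<close>, whose pairing is known
    up to the factor \<open>c\<close>.\<close>
  obtain l0 r where r: "strict_mono r" and l0: "(l \<circ> r) \<longlonglongrightarrow> l0"
    using l(1) compact_sphere[of "0 :: complex^'n" 1] unfolding compact_def
    by (metis mem_sphere_0)
  have "(\<lambda>n. norm ((l \<circ> r) n)) \<longlonglongrightarrow> norm l0"
    by (rule tendsto_norm[OF l0])
  then have "norm l0 = 1"
    using l(1) by (simp add: LIMSEQ_const_iff)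
  then have "l0 \<noteq> 0" by auto
  have zr: "(z \<circ> r) \<longlonglongrightarrow> zs"
    by (rule LIMSEQ_subseq_LIMSEQ[OF z_lim r])
  have "(\<lambda>n. (l \<circ> r) n v* A ((z \<circ> r) n)) \<longlonglongrightarrow> l0 v* A zs"
    by (intro bounded_bilinear.tendsto[OF bounded_bilinear_vector_matrix_mult] l0
        isCont_tendsto_compose[OF cont(1) zr])
  moreover have "(\<lambda>n. \<mu> ((z \<circ> r) n) *s (l \<circ> r) n) \<longlonglongrightarrow> \<mu> zs *s l0"
    by (intro bounded_bilinear.tendsto[OF bounded_bilinear_vector_smult] l0
        isCont_tendsto_compose[OF cont(2) zr])
  ultimately have "l0 v* A zs = \<mu> zs *s l0"
    using l(2) by (simp add: LIMSEQ_unique o_def)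
  then obtain c where c: "c > 0" "\<And>v. norm (pairing l0 v) = c * norm (Qc *v v)"
    using left_eigenvector_center_norm[OF Qu Qc Qs simple only _ \<open>l0 \<noteq> 0\<close>] cont(3) by metis
  obtain n where n: "norm ((l \<circ> r) n - l0) < c * e"
    using LIMSEQ_D[OF l0, of "c * e"] c(1) \<open>e > 0\<close> by auto
  \<comment> \<open>Rescaling by \<open>1 / c\<close> normalizes the pairing to the center norm
    itself; it divides the error by \<open>c\<close>, whence the tolerance \<open>c * e\<close>
    above.\<close>
  define m where "m = of_real (1 / c) *s l (r n)"
  have "m v* A (z (r n)) = \<mu> (z (r n)) *s m"
    unfolding m_def by (simp add: scalar_vector_matrix_assoc l(2) vector_smult_assoc mult.commute)
  moreover have "\<bar>norm (pairing m v) - norm (Qc *v v)\<bar> \<le> e * norm v" for v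
  proof -
    have "\<bar>norm (pairing (l (r n)) v) - norm (pairing l0 v)\<bar> \<le> norm (pairing (l (r n) - l0) v)"
      unfolding pairing_diff_left by (rule norm_triangle_ineq3)
    also have "\<dots> \<le> norm (l (r n) - l0) * norm v"
      by (rule norm_pairing_le)
    also have "\<dots> \<le> c * e * norm v"
      using n by (intro mult_right_mono) auto
    finally have "\<bar>norm (pairing (l (r n)) v) - c * norm (Qc *v v)\<bar> \<le> c * (e * norm v)"
      by (simp add: c(2) mult.assoc)
    moreover have "norm (pairing m v) - norm (Qc *v v)
        = (norm (pairing (l (r n)) v) - c * norm (Qc *v v)) / c"
      using c(1) by (simp add: m_def pairing_smult_left norm_mult norm_divide diff_divide_distrib)
    ultimately show ?thesis
      using c(1) by (simp add: abs_divide divide_le_eq mult.commute)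
  qed
  ultimately show False using nP[of "r n"] by blast
qed

section \<open>Matching at the origin\<close>

lemma span_columns_coordinates:
  fixes R :: "complex^'n^'n"
  assumes "p \<in> vec.span ((\<lambda>i. column i R) ` J)"
  obtains x where "p = R *v x" "\<And>i. i \<notin> J \<Longrightarrow> x $ i = 0"
proof -
  have "\<exists>x. p = R *v x \<and> (\<forall>i. i \<notin> J \<longrightarrow> x $ i = 0)"
    using assms
  proof (induction rule: vec.span_induct_alt)
    case base
    show ?case by (rule exI[of _ 0]) simp
  next
    case (step c y q)
    then obtain j x where "j \<in> J" "y = column j R" and x: "q = R *v x" "\<And>i. i \<notin> J \<Longrightarrow> x $ i = 0"
      by blast
    have "column j R = R *v axis j 1"
      by (simp add: vec_eq_iff column_def matrix_vector_mult_def axis_def if_distrib cong: if_cong)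
    then have "c *s y + q = R *v (c *s axis j 1 + x)"
      using \<open>y = column j R\<close> x(1) by (simp add: matrix_vector_right_distrib vector_scalar_commute)
    moreover have "(c *s axis j 1 + x) $ i = 0" if "i \<notin> J" for i
      using that \<open>j \<in> J\<close> x(2) by (auto simp: axis_def)
    ultimately show ?case by blast
  qed
  then show ?thesis using that by blast
qed

text \<open>With disjoint supports nothing cancels in \<open>x - y\<close>, so a bound on the
  difference bounds each vector separately.\<close>

lemma norm_le_norm_diff_disjoint:
  fixes x y :: "complex^'n"
  assumes "\<And>i. x $ i = 0 \<or> y $ i = 0"
  shows "norm x \<le> norm (x - y)" "norm y \<le> norm (x - y)"
proof -
  have "norm (x $ i) \<le> norm ((x - y) $ i)" "norm (y $ i) \<le> norm ((x - y) $ i)" for i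
    using assms[of i] by auto
  then show "norm x \<le> norm (x - y)" "norm y \<le> norm (x - y)"
    unfolding norm_vec_def by (auto intro!: L2_set_mono)
qed

text \<open>A nonzero Evans determinant means that the columns in \<open>J\<close> carried by
  \<open>Pm\<close> and the others carried by \<open>Pp\<close> form an invertible matrix
  \<open>M\<close>. For \<open>p\<close> and \<open>q\<close> in the two spans the mismatch
  \<open>Pm *v p - Pp *v q\<close> is \<open>M\<close> applied to a difference of coordinate vectors
  with disjoint supports, so the inverse of \<open>M\<close> bounds both. General \<open>a\<close>
  and \<open>b\<close> differ from \<open>p\<close> and \<open>q\<close> by terms that are added on
  the right.\<close>

lemma evans_quotient_bound:
  fixes Pm Pp R :: "complex^'n^'n"
  assumes ne: "evans_quotient Pm Pp R J \<noteq> 0"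
  obtains K where "K > 0"
    "\<And>a b p q. p \<in> vec.span ((\<lambda>i. column i R) ` J) \<Longrightarrow> q \<in> vec.span ((\<lambda>i. column i R) ` (- J)) \<Longrightarrow>
       norm a + norm b \<le> K * (norm (a - p) + norm (b - q) + norm (Pm *v a - Pp *v b))"
proof -
  define M :: "complex^'n^'n" where
    "M = (\<chi> i j. if j \<in> J then (Pm ** R) $ i $ j else (Pp ** R) $ i $ j)"
  have "invertible M"
    using ne unfolding evans_quotient_def M_def[symmetric] by (simp add: invertible_det_nz)
  then obtain Mi where Mi: "Mi ** M = mat 1"
    unfolding invertible_def by blast
  \<comment> \<open>One factor \<open>norm R * norm Mi\<close> for \<open>p\<close> and one for
    \<open>q\<close>.\<close>
  define k where "k = 2 * norm R * norm Mi"
  have "k \<ge> 0" by (simp add: k_def)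
  define K where "K = 1 + k * (1 + norm Pm + norm Pp)"
  have K: "1 \<le> K" "k \<le> K" "k * norm Pm + 1 \<le> K" "k * norm Pp + 1 \<le> K"
    unfolding K_def using \<open>k \<ge> 0\<close> by (auto simp: algebra_simps)
  have core: "norm p + norm q \<le> k * norm (Pm *v p - Pp *v q)"
    if p: "p \<in> vec.span ((\<lambda>i. column i R) ` J)" and q: "q \<in> vec.span ((\<lambda>i. column i R) ` (- J))" for p q
  proof -
    obtain x where x: "p = R *v x" "\<And>i. i \<notin> J \<Longrightarrow> x $ i = 0"
      using span_columns_coordinates[OF p] by blast
    obtain y where y: "q = R *v y" "\<And>i. i \<in> J \<Longrightarrow> y $ i = 0"
      using span_columns_coordinates[OF q] by auto
    have "M *v (x - y) = (Pm ** R) *v x - (Pp ** R) *v y"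
    proof -
      have "(if j \<in> J then (Pm ** R) $ i $ j else (Pp ** R) $ i $ j) * (x $ j - y $ j)
          = (Pm ** R) $ i $ j * x $ j - (Pp ** R) $ i $ j * y $ j" for i j
        using x(2)[of j] y(2)[of j] by auto
      then show ?thesis
        by (simp add: vec_eq_iff M_def matrix_vector_mult_def sum_subtractf)
    qed
    then have "M *v (x - y) = Pm *v p - Pp *v q"
      by (simp add: x(1) y(1) matrix_vector_mul_assoc)
    then have "x - y = Mi *v (Pm *v p - Pp *v q)"
      using Mi by (metis matrix_vector_mul_assoc matrix_vector_mul_lid)
    then have "norm (x - y) \<le> norm Mi * norm (Pm *v p - Pp *v q)"
      by (simp add: norm_matrix_vector_mult_le)
    moreover have "norm x \<le> norm (x - y)" "norm y \<le> norm (x - y)"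
      using x(2) y(2) by (blast intro: norm_le_norm_diff_disjoint)+
    moreover have "norm p \<le> norm R * norm x" "norm q \<le> norm R * norm y"
      by (simp_all add: x(1) y(1) norm_matrix_vector_mult_le)
    ultimately have "norm p \<le> norm R * (norm Mi * norm (Pm *v p - Pp *v q))"
      "norm q \<le> norm R * (norm Mi * norm (Pm *v p - Pp *v q))"
      by (meson mult_left_mono norm_ge_zero order_trans)+
    then show ?thesis by (simp add: k_def mult.assoc)
  qed
  show ?thesis
  proof (rule that[of K])
    show "K > 0" using K(1) by linarith
    fix a b p q
    assume pq: "p \<in> vec.span ((\<lambda>i. column i R) ` J)" "q \<in> vec.span ((\<lambda>i. column i R) ` (- J))"
    have eq: "Pm *v p - Pp *v q = (Pm *v a - Pp *v b) - Pm *v (a - p) + Pp *v (b - q)"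
      by (simp add: matrix_vector_mult_diff_distrib)
    have "norm (Pm *v p - Pp *v q)
        \<le> norm (Pm *v a - Pp *v b) + norm (Pm *v (a - p)) + norm (Pp *v (b - q))"
      using norm_triangle_ineq[of "Pm *v a - Pp *v b - Pm *v (a - p)" "Pp *v (b - q)"]
        norm_triangle_ineq4[of "Pm *v a - Pp *v b" "Pm *v (a - p)"] unfolding eq by linarith
    also have "\<dots> \<le> norm (Pm *v a - Pp *v b) + norm Pm * norm (a - p) + norm Pp * norm (b - q)"
      by (intro add_mono norm_matrix_vector_mult_le order_refl)
    finally have "k * norm (Pm *v p - Pp *v q)
        \<le> k * (norm (Pm *v a - Pp *v b) + norm Pm * norm (a - p) + norm Pp * norm (b - q))"
      using \<open>k \<ge> 0\<close> by (rule mult_left_mono)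
    with core[OF pq] have "norm p + norm q
        \<le> k * norm (Pm *v a - Pp *v b) + (k * norm Pm) * norm (a - p) + (k * norm Pp) * norm (b - q)"
      by (simp add: algebra_simps)
    moreover have "norm a \<le> norm p + norm (a - p)" "norm b \<le> norm q + norm (b - q)"
      by (rule norm_triangle_sub)+
    ultimately have "norm a + norm b \<le> k * norm (Pm *v a - Pp *v b)
        + (k * norm Pm + 1) * norm (a - p) + (k * norm Pp + 1) * norm (b - q)"
      by (simp add: algebra_simps)
    also have "\<dots> \<le> K * norm (Pm *v a - Pp *v b) + K * norm (a - p) + K * norm (b - q)"
      by (intro add_mono mult_right_mono K) auto
    finally show "norm a + norm b \<le> K * (norm (a - p) + norm (b - q) + norm (Pm *v a - Pp *v b))"
      by (simp add: algebra_simps)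
  qed
qed

text \<open>Here \<open>a\<close> is the value left of the origin and \<open>b\<close> the value
  right of it. The first Evans function counts the center column on the left, so the center part of
  \<open>a\<close> is allowed and that of \<open>b\<close> is a remainder: the right center
  component controls everything. The second Evans function exchanges the two sides.\<close>

lemma homoclinic_matching:
  fixes Pm Pp R Qsu Qc Qss :: "complex^'n^'n"
  assumes frame: "spectral_frame Qsu Qc Qss Jsu Jc R"
    and sum: "\<And>v. Qsu *v v + Qc *v v + Qss *v v = v"
    and D1: "evans_quotient Pm Pp R (Jsu \<union> Jc) \<noteq> 0"
    and D2: "evans_quotient Pm Pp R Jsu \<noteq> 0"
  obtains K where "K > 0"
    "\<And>a b. norm a + norm b \<le> K * (norm (Qc *v b) + norm (Qss *v a) + norm (Qsu *v b) + norm (Pm *v a - Pp *v b))"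
    "\<And>a b. norm a + norm b \<le> K * (norm (Qc *v a) + norm (Qss *v a) + norm (Qsu *v b) + norm (Pm *v a - Pp *v b))"
proof -
  obtain K1 where K1: "K1 > 0" "\<And>a b p q. p \<in> vec.span ((\<lambda>i. column i R) ` (Jsu \<union> Jc)) \<Longrightarrow>
      q \<in> vec.span ((\<lambda>i. column i R) ` (- (Jsu \<union> Jc))) \<Longrightarrow>
       norm a + norm b \<le> K1 * (norm (a - p) + norm (b - q) + norm (Pm *v a - Pp *v b))"
    by (rule evans_quotient_bound[OF D1]) blast
  obtain K2 where K2: "K2 > 0" "\<And>a b p q. p \<in> vec.span ((\<lambda>i. column i R) ` Jsu) \<Longrightarrow>
      q \<in> vec.span ((\<lambda>i. column i R) ` (- Jsu)) \<Longrightarrow>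
       norm a + norm b \<le> K2 * (norm (a - p) + norm (b - q) + norm (Pm *v a - Pp *v b))"
    by (rule evans_quotient_bound[OF D2]) blast
  let ?S = "\<lambda>J. vec.span ((\<lambda>i. column i R) ` J)"
  have mono: "?S J \<subseteq> ?S J'" if "J \<subseteq> J'" for J J'
    using that by (intro vec.span_mono image_mono)
  have u: "Qsu *v v \<in> ?S Jsu" and c: "Qc *v v \<in> ?S Jc" and s: "Qss *v v \<in> ?S (- (Jsu \<union> Jc))" for v
    using frame unfolding spectral_frame_def by auto
  have uc: "Qsu *v v + Qc *v v \<in> ?S (Jsu \<union> Jc)" for v
    using u[of v] c[of v] mono[of Jsu "Jsu \<union> Jc"] mono[of Jc "Jsu \<union> Jc"] by (intro vec.span_add) auto
  have "Jc \<subseteq> - Jsu"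
    using frame unfolding spectral_frame_def by auto
  then have cs: "Qc *v v + Qss *v v \<in> ?S (- Jsu)" for v
    using c[of v] s[of v] mono[of Jc "- Jsu"] mono[of "- (Jsu \<union> Jc)" "- Jsu"]
    by (intro vec.span_add) auto
  have 1: "norm a + norm b \<le> K1 * (norm (Qc *v b) + norm (Qss *v a) + norm (Qsu *v b) + norm (Pm *v a - Pp *v b))" for a b
  proof -
    \<comment> \<open>The approximants are \<open>p = Qsu *v a + Qc *v a\<close> and
      \<open>q = Qss *v b\<close>; the remainders are the complementary components.\<close>
    have "a - (Qsu *v a + Qc *v a) = Qss *v a" "b - Qss *v b = Qc *v b + Qsu *v b"
      using sum[of a, symmetric] sum[of b, symmetric] by (simp_all only: diff_eq_eq ac_simps)
    then have "norm a + norm b \<le> K1 * (norm (Qss *v a) + norm (Qc *v b + Qsu *v b) + norm (Pm *v a - Pp *v b))"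
      using K1(2)[OF uc[of a] s[of b], where a = a and b = b] by (simp only:)
    also have "\<dots> \<le> K1 * (norm (Qc *v b) + norm (Qss *v a) + norm (Qsu *v b) + norm (Pm *v a - Pp *v b))"
      using K1(1) norm_triangle_ineq[of "Qc *v b" "Qsu *v b"] by (intro mult_left_mono) auto
    finally show ?thesis .
  qed
  have 2: "norm a + norm b \<le> K2 * (norm (Qc *v a) + norm (Qss *v a) + norm (Qsu *v b) + norm (Pm *v a - Pp *v b))" for a b
  proof -
    have "a - Qsu *v a = Qc *v a + Qss *v a" "b - (Qc *v b + Qss *v b) = Qsu *v b"
      using sum[of a, symmetric] sum[of b, symmetric] by (simp_all only: diff_eq_eq ac_simps)
    then have "norm a + norm b \<le> K2 * (norm (Qc *v a + Qss *v a) + norm (Qsu *v b) + norm (Pm *v a - Pp *v b))"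
      using K2(2)[OF u[of a] cs[of b], where a = a and b = b] by (simp only:)
    also have "\<dots> \<le> K2 * (norm (Qc *v a) + norm (Qss *v a) + norm (Qsu *v b) + norm (Pm *v a - Pp *v b))"
      using K2(1) norm_triangle_ineq[of "Qc *v a" "Qss *v a"] by (intro mult_left_mono) auto
    finally show ?thesis .
  qed
  show ?thesis
  proof (rule that[of "max K1 K2"])
    show "max K1 K2 > 0" using K1(1) by simp
    fix a b
    show "norm a + norm b \<le> max K1 K2 * (norm (Qc *v b) + norm (Qss *v a) + norm (Qsu *v b) + norm (Pm *v a - Pp *v b))"
      by (rule order_trans[OF 1], rule mult_right_mono) auto
    show "norm a + norm b \<le> max K1 K2 * (norm (Qc *v a) + norm (Qss *v a) + norm (Qsu *v b) + norm (Pm *v a - Pp *v b))"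
      by (rule order_trans[OF 2], rule mult_right_mono) auto
  qed
qed

section \<open>Conjugated systems\<close>

lemma matrix_inv_mult:
  fixes A :: "complex^'n^'n"
  assumes "invertible A"
  shows "A ** matrix_inv A = mat 1" "matrix_inv A ** A = mat 1"
proof -
  have "\<exists>A'. A ** A' = mat 1 \<and> A' ** A = mat 1"
    using assms unfolding invertible_def .
  from someI_ex[OF this] show "A ** matrix_inv A = mat 1" "matrix_inv A ** A = mat 1"
    unfolding matrix_inv_def by blast+
qed

text \<open>Since \<open>g x = 0\<close>, the product rule has no term with the derivative of
  \<open>h\<close>, and continuity of \<open>h\<close> suffices. This serves for
  \<open>h y = matrix_inv (P y)\<close>.\<close>

lemma has_vector_derivative_mult_zero:
  fixes h :: "real \<Rightarrow> complex^'n^'m" and g :: "real \<Rightarrow> complex^'n"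
  assumes h: "(h \<longlongrightarrow> h x) (at x within S)"
    and g: "(g has_vector_derivative d) (at x within S)" and "g x = 0"
  shows "((\<lambda>y. h y *v g y) has_vector_derivative (h x *v d)) (at x within S)"
proof -
  define q where "q y = (1 / norm (y - x)) *\<^sub>R (g y - (y - x) *\<^sub>R d)" for y
  have "(q \<longlongrightarrow> 0) (at x within S)"
    using g \<open>g x = 0\<close> unfolding has_vector_derivative_def has_derivative_within q_def by simp
  then have 1: "((\<lambda>y. h y *v q y) \<longlongrightarrow> h x *v 0) (at x within S)"
    by (rule bounded_bilinear.tendsto[OF bounded_bilinear_matrix_vector_mult h])
  have "((\<lambda>y. (h y - h x) *v d) \<longlongrightarrow> 0 *v d) (at x within S)"
    using h by (intro bounded_bilinear.tendsto[OF bounded_bilinear_matrix_vector_mult]) (auto simp: LIM_zero)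
  then have "((\<lambda>y. norm ((h y - h x) *v d)) \<longlongrightarrow> 0) (at x within S)"
    by (auto dest: tendsto_norm)
  then have 2: "((\<lambda>y. ((y - x) / norm (y - x)) *\<^sub>R ((h y - h x) *v d)) \<longlongrightarrow> 0) (at x within S)"
    by (rule Lim_null_comparison[rotated]) (auto intro!: always_eventually)
  have eq: "h y *v q y + ((y - x) / norm (y - x)) *\<^sub>R ((h y - h x) *v d)
      = (1 / norm (y - x)) *\<^sub>R (h y *v g y - (h x *v g x + (y - x) *\<^sub>R (h x *v d)))" for y
    using \<open>g x = 0\<close>
    by (simp add: q_def matrix_vector_mult_diff_distrib matrix_vector_mult_diff_rdistrib
        linear_scale[OF matrix_vector_mul_linear] scaleR_diff_right)
  from tendsto_add[OF 1 2]
  have "((\<lambda>y. (1 / norm (y - x)) *\<^sub>R (h y *v g y - (h x *v g x + (y - x) *\<^sub>R (h x *v d)))) \<longlongrightarrow> 0) (at x within S)"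
    unfolding eq by simp
  then show ?thesis
    unfolding has_vector_derivative_def has_derivative_within
    by (simp add: bounded_linear_scaleR_left)
qed

text \<open>The resolvent identity writes the difference of the inverses as
  \<open>matrix_inv (P y) ** (P x - P y) ** matrix_inv (P x)\<close>, and both inverses are bounded
  by \<open>K\<close>.\<close>

lemma matrix_inv_tendsto:
  fixes P :: "real \<Rightarrow> complex^'n^'n"
  assumes P: "(P \<longlongrightarrow> P x) (at x within S)" and x: "x \<in> S"
    and inv: "\<And>y. y \<in> S \<Longrightarrow> invertible (P y)" "\<And>y. y \<in> S \<Longrightarrow> norm (matrix_inv (P y)) \<le> K"
  shows "((\<lambda>y. matrix_inv (P y)) \<longlongrightarrow> matrix_inv (P x)) (at x within S)"
proof -
  have "K \<ge> 0" using inv(2)[OF x] norm_ge_zero order_trans by blast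
  have "((\<lambda>y. K * norm (P y - P x) * K) \<longlongrightarrow> K * norm (P x - P x) * K) (at x within S)"
    by (intro tendsto_intros P)
  then have lim: "((\<lambda>y. K * norm (P y - P x) * K) \<longlongrightarrow> 0) (at x within S)" by simp
  have "norm (matrix_inv (P y) - matrix_inv (P x)) \<le> K * norm (P y - P x) * K" if "y \<in> S" for y
  proof -
    note bb = bounded_bilinear_matrix_matrix_mult
    have "matrix_inv (P y) ** (P x - P y) ** matrix_inv (P x)
        = matrix_inv (P y) ** (P x ** matrix_inv (P x)) - (matrix_inv (P y) ** P y) ** matrix_inv (P x)"
      by (simp only: bounded_bilinear.diff_right[OF bb] bounded_bilinear.diff_left[OF bb] matrix_mul_assoc)
    then have "matrix_inv (P y) - matrix_inv (P x) = matrix_inv (P y) ** (P x - P y) ** matrix_inv (P x)"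
      by (simp only: matrix_inv_mult(1)[OF inv(1)[OF x]] matrix_inv_mult(2)[OF inv(1)[OF that]]
          matrix_mul_lid matrix_mul_rid)
    then have "norm (matrix_inv (P y) - matrix_inv (P x)) \<le> norm (matrix_inv (P y) ** (P x - P y)) * norm (matrix_inv (P x))"
      by (simp only: norm_matrix_matrix_mult_le)
    also have "\<dots> \<le> (norm (matrix_inv (P y)) * norm (P x - P y)) * norm (matrix_inv (P x))"
      by (intro mult_right_mono norm_matrix_matrix_mult_le) auto
    also have "\<dots> \<le> (K * norm (P y - P x)) * K"
      using inv(2) that x \<open>K \<ge> 0\<close> by (intro mult_mono) (auto simp: norm_minus_commute)
    finally show ?thesis .
  qed
  then have "\<forall>\<^sub>F y in at x within S. norm (matrix_inv (P y) - matrix_inv (P x)) \<le> K * norm (P y - P x) * K"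
    by (auto simp: eventually_at_filter)
  from Lim_null_comparison[OF this lim] show ?thesis
    by (rule LIM_zero_cancel)
qed

text \<open>For \<open>A1 = A0\<close> the substitution \<open>W = P Z\<close> gives exactly
  \<open>Z' = B Z\<close>. A perturbation of \<open>A0\<close> appears conjugated, as
  \<open>matrix_inv (P x) ** (A1 x - A0 x) ** P x\<close>, and the two factors \<open>K\<close>
  bound the conjugation.\<close>

lemma conjugated_system:
  fixes P A0 A1 :: "real \<Rightarrow> complex^'n^'n" and W :: "real \<Rightarrow> complex^'n"
  assumes P': "\<And>x. x \<in> S \<Longrightarrow> (P has_vector_derivative (A0 x ** P x - P x ** B)) (at x within S)"
    and inv: "\<And>x. x \<in> S \<Longrightarrow> invertible (P x)" "\<And>x. x \<in> S \<Longrightarrow> norm (P x) \<le> K"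
      "\<And>x. x \<in> S \<Longrightarrow> norm (matrix_inv (P x)) \<le> K"
    and W': "\<And>x. x \<in> S \<Longrightarrow> (W has_vector_derivative (A1 x *v W x)) (at x within S)"
    and close: "\<And>x. x \<in> S \<Longrightarrow> norm (A1 x - A0 x) \<le> \<delta>"
  obtains Z G where "\<And>x. x \<in> S \<Longrightarrow> P x *v Z x = W x"
    "\<And>x. x \<in> S \<Longrightarrow> (Z has_vector_derivative (G x *v Z x)) (at x within S)"
    "\<And>x. x \<in> S \<Longrightarrow> norm (G x - B) \<le> K * \<delta> * K"
proof -
  define Z where "Z x = matrix_inv (P x) *v W x" for x
  define G where "G x = B + matrix_inv (P x) ** (A1 x - A0 x) ** P x" for x
  have PZ: "P x *v Z x = W x" if "x \<in> S" for x
    using matrix_inv_mult(1)[OF inv(1)[OF that]] by (simp add: Z_def matrix_vector_mul_assoc)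
  have ZP: "matrix_inv (P x) *v (P x *v v) = v" if "x \<in> S" for x v
    using matrix_inv_mult(2)[OF inv(1)[OF that]] by (simp add: matrix_vector_mul_assoc)
  have Z': "(Z has_vector_derivative (G x *v Z x)) (at x within S)" if x: "x \<in> S" for x
  proof -
    have contP: "(P \<longlongrightarrow> P x) (at x within S)"
      using has_vector_derivative_continuous[OF P'[OF x]] by (simp add: continuous_within)
    \<comment> \<open>With \<open>Z x\<close> frozen, \<open>W y - P y *v Z x\<close> vanishes at
      \<open>y = x\<close> and has derivative \<open>d\<close> there; \<open>Z y\<close> is its
      image under \<open>matrix_inv (P y)\<close> plus the constant \<open>Z x\<close>.\<close>
    define d where "d = A1 x *v W x - (A0 x ** P x - P x ** B) *v Z x"
    have "((\<lambda>y. W y - P y *v Z x) has_vector_derivative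
        (A1 x *v W x - (P x *v 0 + (A0 x ** P x - P x ** B) *v Z x))) (at x within S)"
      by (intro has_vector_derivative_diff has_vector_derivative_matrix_vector_mult W' P' x
          has_vector_derivative_const)
    then have gd: "((\<lambda>y. W y - P y *v Z x) has_vector_derivative d) (at x within S)"
      by (simp add: d_def)
    have hc: "((\<lambda>y. matrix_inv (P y)) \<longlongrightarrow> matrix_inv (P x)) (at x within S)"
      by (rule matrix_inv_tendsto[OF contP x inv(1) inv(3)])
    have g0: "W x - P x *v Z x = 0"
      using PZ[OF x] by simp
    have "((\<lambda>y. matrix_inv (P y) *v (W y - P y *v Z x)) has_vector_derivative (matrix_inv (P x) *v d)) (at x within S)"
      by (rule has_vector_derivative_mult_zero[of "\<lambda>y. matrix_inv (P y)" x S "\<lambda>y. W y - P y *v Z x" d, OF hc gd g0])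
    then have der: "((\<lambda>y. matrix_inv (P y) *v (W y - P y *v Z x) + Z x) has_vector_derivative (matrix_inv (P x) *v d + 0)) (at x within S)"
      by (rule has_vector_derivative_add[OF _ has_vector_derivative_const])
    have "Z y = matrix_inv (P y) *v (W y - P y *v Z x) + Z x" if "y \<in> S" for y
      unfolding matrix_vector_mult_diff_distrib ZP[OF that] by (simp add: Z_def)
    then have "(Z has_vector_derivative (matrix_inv (P x) *v d + 0)) (at x within S)"
      by (rule has_vector_derivative_transform[OF x _ der])
    moreover have "matrix_inv (P x) *v d + 0 = G x *v Z x"
    proof -
      have "d = (A1 x - A0 x) *v (P x *v Z x) + P x *v (B *v Z x)"
        unfolding d_def PZ[OF x, symmetric] matrix_vector_mult_diff_rdistrib matrix_vector_mul_assoc[symmetric]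
        by (simp only: diff_diff_eq2 diff_add_eq)
      then have "matrix_inv (P x) *v d = matrix_inv (P x) *v ((A1 x - A0 x) *v (P x *v Z x)) + B *v Z x"
        by (simp only: matrix_vector_right_distrib ZP[OF x])
      then show ?thesis
        unfolding G_def matrix_vector_mult_add_rdistrib matrix_vector_mul_assoc[symmetric]
        by (simp only: add.commute add_0)
    qed
    ultimately show ?thesis by metis
  qed
  have "norm (G x - B) \<le> K * \<delta> * K" if x: "x \<in> S" for x
  proof -
    have K: "0 \<le> K" using inv(2)[OF x] norm_ge_zero order_trans by blast
    have \<delta>: "0 \<le> \<delta>" using close[OF x] norm_ge_zero order_trans by blast
    have "norm (G x - B) \<le> norm (matrix_inv (P x) ** (A1 x - A0 x)) * norm (P x)"
      unfolding G_def by (simp add: norm_matrix_matrix_mult_le)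
    also have "\<dots> \<le> (norm (matrix_inv (P x)) * norm (A1 x - A0 x)) * norm (P x)"
      by (intro mult_right_mono norm_matrix_matrix_mult_le) auto
    also have "\<dots> \<le> (K * \<delta>) * K"
      using K \<delta> x by (intro mult_mono inv close) auto
    finally show ?thesis .
  qed
  with PZ Z' show ?thesis using that by blast
qed

section \<open>Transport along a half-period\<close>

text \<open>The unstable projection of \<open>B\<close> is the stable projection of
  \<open>- B\<close>: the nilpotent powers for \<open>- B\<close> at \<open>\<mu>\<close> and for
  \<open>B\<close> at \<open>- \<mu>\<close> differ by a sign only. \<open>U\<close> is therefore
  the backward propagator, and the worse of the two constants and rates serves for both.\<close>

lemma hyperbolic_decay:
  fixes B :: "complex^'n^'n"
  assumes Qu: "spectral_projection B {\<mu>. Re \<mu> > 0} Qu"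
    and Qs: "spectral_projection B {\<mu>. Re \<mu> < 0} Qs"
  obtains S U K \<alpha> where "0 < \<alpha>" "0 < K" "S 0 = Qs" "U 0 = Qu"
    "\<And>t. t \<ge> 0 \<Longrightarrow> (S has_vector_derivative (S t ** B)) (at t)"
    "\<And>t. t \<ge> 0 \<Longrightarrow> (U has_vector_derivative (U t ** (- B))) (at t)"
    "\<And>t. t \<ge> 0 \<Longrightarrow> norm (S t) \<le> K * exp (- \<alpha> * t)"
    "\<And>t. t \<ge> 0 \<Longrightarrow> norm (U t) \<le> K * exp (- \<alpha> * t)"
proof -
  have gen: "gen_eigenspace (- B) \<mu> = gen_eigenspace B (- \<mu>)" for \<mu>
  proof -
    have "((\<lambda>w. (- B - mat \<mu>) *v w) ^^ m) v = (-1) ^ m *s ((\<lambda>w. (B - mat (- \<mu>)) *v w) ^^ m) v" for m v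
    proof (induction m)
      case (Suc m)
      have "(- B - mat \<mu>) *v u = (-1) *s ((B - mat (- \<mu>)) *v u)" for u
        by (simp add: matrix_vector_mult_diff_rdistrib mat_vector_mult matrix_uminus_vector_mult
            vec_eq_iff)
      then show ?case using Suc by (simp add: vector_scalar_commute vector_smult_assoc)
    qed simp
    then show ?thesis
      unfolding gen_eigenspace_def by (auto simp: vector_mul_eq_0)
  qed
  have sub: "spectral_subspace (- B) T = spectral_subspace B (uminus ` T)" for T
    unfolding spectral_subspace_def by (simp add: gen)
  have "uminus ` T = {\<mu>. - \<mu> \<in> T}" for T :: "complex set"
    by force
  then have 1: "uminus ` {\<mu>. Re \<mu> < 0} = {\<mu>. Re \<mu> > 0}"
    and 2: "uminus ` (- {\<mu>. Re \<mu> < 0}) = - {\<mu>. Re \<mu> > 0}"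
    by auto
  have Qu': "spectral_projection (- B) {\<mu>. Re \<mu> < 0} Qu"
    using Qu unfolding spectral_projection_def sub 1 2 .
  obtain S K \<alpha> where S: "0 < \<alpha>" "0 < K" "S 0 = Qs"
    "\<And>t. t \<ge> 0 \<Longrightarrow> (S has_vector_derivative (S t ** B)) (at t)"
    "\<And>t. t \<ge> 0 \<Longrightarrow> norm (S t) \<le> K * exp (- \<alpha> * t)"
    by (rule spectral_decay[OF Qs order_refl]) blast
  obtain U K' \<alpha>' where U: "0 < \<alpha>'" "0 < K'" "U 0 = Qu"
    "\<And>t. t \<ge> 0 \<Longrightarrow> (U has_vector_derivative (U t ** (- B))) (at t)"
    "\<And>t. t \<ge> 0 \<Longrightarrow> norm (U t) \<le> K' * exp (- \<alpha>' * t)"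
    by (rule spectral_decay[OF Qu' order_refl]) blast
  have le: "K * exp (- \<alpha> * t) \<le> max K K' * exp (- min \<alpha> \<alpha>' * t)"
    "K' * exp (- \<alpha>' * t) \<le> max K K' * exp (- min \<alpha> \<alpha>' * t)" if "t \<ge> 0" for t
    using that S(2) by (auto intro!: mult_mono mult_right_mono)
  show ?thesis
  proof (rule that[of "min \<alpha> \<alpha>'" "max K K'" S U])
    show "norm (S t) \<le> max K K' * exp (- min \<alpha> \<alpha>' * t)" if "t \<ge> 0" for t
      by (rule order_trans[OF S(5)[OF that] le(1)[OF that]])
    show "norm (U t) \<le> max K K' * exp (- min \<alpha> \<alpha>' * t)" if "t \<ge> 0" for t
      by (rule order_trans[OF U(5)[OF that] le(2)[OF that]])
    show "0 < min \<alpha> \<alpha>'" "0 < max K K'" using S(1,2) U(1) by auto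
    show "(S has_vector_derivative (S t ** B)) (at t)"
      "(U has_vector_derivative (U t ** (- B))) (at t)" if "t \<ge> 0" for t
      by (rule S(4)[OF that] U(4)[OF that])+
  qed (rule S(3) U(3))+
qed

text \<open>Two reference matrices are in play. The hyperbolic components are compared with the base
  point matrix \<open>B\<close>, since decay absorbs the constant error
  \<open>\<delta> + \<delta>'\<close>. The center component is compared with \<open>A\<close>, whose
  left eigenvector \<open>l\<close> is exact, so that only \<open>\<delta> * L\<close> accumulates.
  The last conclusion recovers the size in the interior from the ends: stable part from 0, unstable
  part from \<open>L\<close>, center part from 0.\<close>

lemma half_period_transport:
  fixes S U :: "real \<Rightarrow> complex^'n^'n" and Z :: "real \<Rightarrow> complex^'n"
  assumes decay: "0 < \<alpha>" "0 < K" "S 0 = Qs" "U 0 = Qu"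
      "\<And>t. t \<ge> 0 \<Longrightarrow> (S has_vector_derivative (S t ** B)) (at t)"
      "\<And>t. t \<ge> 0 \<Longrightarrow> (U has_vector_derivative (U t ** (- B))) (at t)"
      "\<And>t. t \<ge> 0 \<Longrightarrow> norm (S t) \<le> K * exp (- \<alpha> * t)"
      "\<And>t. t \<ge> 0 \<Longrightarrow> norm (U t) \<le> K * exp (- \<alpha> * t)"
    and sum: "\<And>v. Qu *v v + Qc *v v + Qs *v v = v"
    and Z': "\<And>x. x \<in> {0..L} \<Longrightarrow> (Z has_vector_derivative (G x *v Z x)) (at x within {0..L})"
    and G: "\<And>x. x \<in> {0..L} \<Longrightarrow> norm (G x - A) \<le> \<delta>"
    and AB: "norm (A - B) \<le> \<delta>'"
    and N: "\<And>x. x \<in> {0..L} \<Longrightarrow> norm (Z x) \<le> N"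
    and l: "\<And>v. pairing l (A *v v) = \<mu> * pairing l v"
      "\<And>v. \<bar>norm (pairing l v) - norm (Qc *v v)\<bar> \<le> e * norm v"
    and e: "0 \<le> e"
    and \<mu>: "\<bar>Re \<mu>\<bar> * L \<le> c"
    and L: "0 \<le> L"
    and \<tau>1: "K * exp (- \<alpha> * L) + K * (\<delta> + \<delta>') / \<alpha> \<le> \<tau>"
    and \<tau>2: "2 * K * (\<delta> + \<delta>') / \<alpha> + (exp (2 * c) * (norm Qc + e) * \<delta> * L + e * (1 + exp c)) \<le> \<tau>"
  shows "norm (Qs *v Z L) \<le> \<tau> * N"
    and "norm (Qu *v Z 0) \<le> \<tau> * N"
    and "\<bar>norm (Qc *v Z L) - exp (Re \<mu> * L) * norm (Qc *v Z 0)\<bar> \<le> \<tau> * N"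
    and "\<And>x. x \<in> {0..L} \<Longrightarrow>
      norm (Z x) \<le> K * (norm (Z 0) + norm (Z L)) + exp c * norm (Qc *v Z 0) + \<tau> * N"
proof -
  have N0: "0 \<le> N" using N[of 0] L norm_ge_zero order_trans by (metis atLeastAtMost_iff order_refl)
  have \<delta>: "0 \<le> \<delta>" using G[of 0] L norm_ge_zero order_trans by (metis atLeastAtMost_iff order_refl)
  have \<delta>': "0 \<le> \<delta>'" using AB norm_ge_zero order_trans by blast
  have c: "0 \<le> c" using \<mu> L by (meson abs_ge_zero mult_nonneg_nonneg order_trans)
  let ?d = "\<delta> + \<delta>'"
  \<comment> \<open>The first summand is the transport error of the functional. The second pays for
    exchanging \<open>pairing l\<close> and the center norm twice: at \<open>x\<close>, and at 0,
    where the exponential multiplies it.\<close>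
  define \<omega> where "\<omega> = exp (2 * c) * (norm Qc + e) * \<delta> * L + e * (1 + exp c)"
  have "0 \<le> \<omega>"
    unfolding \<omega>_def using e \<delta> L by simp
  have GB: "norm (G x - B) \<le> ?d" if "x \<in> {0..L}" for x
    using norm_triangle_ineq[of "G x - A" "A - B"] G[OF that] AB by simp
  have st: "norm (Qs *v Z x) \<le> K * exp (- \<alpha> * x) * norm (Z 0) + K * ?d * N / \<alpha>" if "x \<in> {0..L}" for x
    by (rule stable_component_bound[OF decay(3,5,7,1,2) Z' GB N that])
  have un: "norm (Qu *v Z x) \<le> K * exp (- \<alpha> * (L - x)) * norm (Z L) + K * ?d * N / \<alpha>" if "x \<in> {0..L}" for x
    by (rule unstable_component_bound[OF decay(4,6,8,1,2) Z' GB N that])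
  have F: "norm (pairing l v) \<le> (norm Qc + e) * norm v" for v
    using l(2)[of v] norm_matrix_vector_mult_le[of Qc v] by (simp add: distrib_right)
  have ce: "\<bar>norm (Qc *v Z x) - exp (Re \<mu> * x) * norm (Qc *v Z 0)\<bar> \<le> \<omega> * N" if x: "x \<in> {0..L}" for x
  proof -
    have "\<bar>norm (pairing l (Z x)) - exp (Re \<mu> * x) * norm (pairing l (Z 0))\<bar>
        \<le> exp (2 * c) * (norm Qc + e) * \<delta> * N * L"
      using e by (intro center_component_bound[OF bounded_linear_pairing l(1) F Z' G N \<mu> _ x]) auto
    moreover have "\<bar>norm (pairing l (Z x)) - norm (Qc *v Z x)\<bar> \<le> e * N"
      using order_trans[OF l(2) mult_left_mono[OF N[OF x] e]] .
    moreover have "\<bar>exp (Re \<mu> * x) * norm (pairing l (Z 0)) - exp (Re \<mu> * x) * norm (Qc *v Z 0)\<bar> \<le> exp c * (e * N)"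
    proof -
      have "Re \<mu> * x \<le> \<bar>Re \<mu>\<bar> * L"
        using x by (intro mult_mono) auto
      then have "exp (Re \<mu> * x) \<le> exp c" using \<mu> by simp
      moreover have "\<bar>norm (pairing l (Z 0)) - norm (Qc *v Z 0)\<bar> \<le> e * N"
        using order_trans[OF l(2) mult_left_mono[OF N e]] L by simp
      ultimately have "exp (Re \<mu> * x) * \<bar>norm (pairing l (Z 0)) - norm (Qc *v Z 0)\<bar> \<le> exp c * (e * N)"
        by (intro mult_mono) auto
      then show ?thesis by (simp add: abs_mult flip: right_diff_distrib)
    qed
    ultimately have "\<bar>norm (Qc *v Z x) - exp (Re \<mu> * x) * norm (Qc *v Z 0)\<bar>
        \<le> exp (2 * c) * (norm Qc + e) * \<delta> * N * L + e * N + exp c * (e * N)"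
      by linarith
    also have "\<dots> = \<omega> * N" by (simp add: \<omega>_def algebra_simps)
    finally show ?thesis .
  qed
  have end1: "K * exp (- \<alpha> * L) * N + K * ?d * N / \<alpha> \<le> \<tau> * N"
    using mult_right_mono[OF \<tau>1 N0] by (simp add: algebra_simps)
  have d0: "0 \<le> K * ?d / \<alpha>" using decay(1,2) \<delta> \<delta>' by simp
  have \<tau>2': "2 * (K * ?d / \<alpha>) + \<omega> \<le> \<tau>"
    using \<tau>2 unfolding \<omega>_def[symmetric] by (simp only: times_divide_eq_right mult.assoc)
  with d0 have \<omega>\<tau>: "\<omega> \<le> \<tau>" by linarith
  have d\<tau>: "2 * (K * ?d * N / \<alpha>) + \<omega> * N \<le> \<tau> * N"
    using mult_right_mono[OF \<tau>2' N0] by (simp add: algebra_simps)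
  show "norm (Qs *v Z L) \<le> \<tau> * N"
  proof -
    have "K * exp (- \<alpha> * L) * norm (Z 0) \<le> K * exp (- \<alpha> * L) * N"
      using N[of 0] L decay(2) by (intro mult_left_mono) auto
    then show ?thesis using st[of L] end1 L by auto
  qed
  show "norm (Qu *v Z 0) \<le> \<tau> * N"
  proof -
    have "K * exp (- \<alpha> * L) * norm (Z L) \<le> K * exp (- \<alpha> * L) * N"
      using N[of L] L decay(2) by (intro mult_left_mono) auto
    then show ?thesis using un[of 0] end1 L by auto
  qed
  show "\<bar>norm (Qc *v Z L) - exp (Re \<mu> * L) * norm (Qc *v Z 0)\<bar> \<le> \<tau> * N"
    using ce[of L] mult_right_mono[OF \<omega>\<tau> N0] L by auto
  define X where "X = K * ?d * N / \<alpha>"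
  fix x assume x: "x \<in> {0..L}"
  have "norm (Z x) \<le> norm (Qu *v Z x) + norm (Qc *v Z x) + norm (Qs *v Z x)"
    using norm_triangle_ineq[of "Qu *v Z x + Qc *v Z x" "Qs *v Z x"]
      norm_triangle_ineq[of "Qu *v Z x" "Qc *v Z x"] sum[of "Z x"] by simp
  moreover have "norm (Qs *v Z x) \<le> K * norm (Z 0) + X"
  proof -
    have "K * exp (- \<alpha> * x) * norm (Z 0) \<le> K * 1 * norm (Z 0)"
      using x decay(1,2) by (intro mult_right_mono mult_left_mono) auto
    then show ?thesis using st[OF x] unfolding X_def[symmetric] by simp
  qed
  moreover have "norm (Qu *v Z x) \<le> K * norm (Z L) + X"
  proof -
    have "K * exp (- \<alpha> * (L - x)) * norm (Z L) \<le> K * 1 * norm (Z L)"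
      using x decay(1,2) by (intro mult_right_mono mult_left_mono) auto
    then show ?thesis using un[OF x] unfolding X_def[symmetric] by simp
  qed
  moreover have "norm (Qc *v Z x) \<le> exp c * norm (Qc *v Z 0) + \<omega> * N"
  proof -
    have "Re \<mu> * x \<le> \<bar>Re \<mu>\<bar> * L"
      using x by (intro mult_mono) auto
    then have "exp (Re \<mu> * x) * norm (Qc *v Z 0) \<le> exp c * norm (Qc *v Z 0)"
      using \<mu> by (intro mult_right_mono) auto
    then show ?thesis using ce[OF x] by linarith
  qed
  ultimately have "norm (Z x) \<le> K * norm (Z 0) + K * norm (Z L) + exp c * norm (Qc *v Z 0) + (2 * X + \<omega> * N)"
    by linarith
  also have "\<dots> \<le> K * norm (Z 0) + K * norm (Z L) + exp c * norm (Qc *v Z 0) + \<tau> * N"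
    using d\<tau> unfolding X_def by (intro add_left_mono)
  finally show "norm (Z x) \<le> K * (norm (Z 0) + norm (Z L)) + exp c * norm (Qc *v Z 0) + \<tau> * N"
    by (simp only: distrib_left)
qed

text \<open>Here \<open>p\<close>, \<open>q\<close>, \<open>s\<close>, \<open>t\<close> are the sizes of the center components at the right and left of
  the origin and at the right and left ends of a period, and \<open>\<rho>\<close> is the center growth over half
  a period. The tolerance \<open>\<tau>\<close> may depend on \<open>E\<close>, but the resulting bounds on \<open>\<rho>\<^sup>2\<close> do not.\<close>

definition growth_tolerance :: "real \<Rightarrow> real \<Rightarrow> real \<Rightarrow> real \<Rightarrow> real \<Rightarrow> bool" where
  "growth_tolerance \<kappa> K1 K E \<tau> \<longleftrightarrow>
    (\<forall>N p q s t na na' nb nb' \<rho>. N > 0 \<longrightarrow> 0 \<le> p \<longrightarrow> 0 \<le> q \<longrightarrow> 0 < \<rho> \<longrightarrow> \<rho> \<le> E \<longrightarrow>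
      na + na' \<le> K1 * p + 3 * K1 * \<tau> * N \<longrightarrow> na + na' \<le> K1 * q + 3 * K1 * \<tau> * N \<longrightarrow>
      0 \<le> na \<longrightarrow> 0 \<le> na' \<longrightarrow> q \<le> \<kappa> * na \<longrightarrow> p \<le> \<kappa> * na' \<longrightarrow>
      nb' \<le> E * p + (3 + \<kappa>) * \<tau> * N \<longrightarrow> nb \<le> nb' + \<tau> * N \<longrightarrow>
      N \<le> K * (na + na' + nb + nb') + E * (p + q) + 2 * \<tau> * N \<longrightarrow>
      \<bar>s - t\<bar> \<le> \<kappa> * \<tau> * N \<longrightarrow> \<bar>s - \<rho> * p\<bar> \<le> \<tau> * N \<longrightarrow> \<bar>t - q / \<rho>\<bar> \<le> \<tau> * N \<longrightarrow>
      \<rho>\<^sup>2 \<le> 2 * \<kappa> * K1 \<and> 1 \<le> 2 * \<kappa> * K1 * \<rho>\<^sup>2)"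

text \<open>The matching inequalities make \<open>p\<close> and \<open>q\<close> comparable with
  factor \<open>\<kappa> * K1\<close>, up to multiples of \<open>\<tau> * N\<close>. They also bound
  \<open>N\<close> by \<open>p\<close> up to such an error, so a small \<open>\<tau>\<close> gives
  \<open>N \<le> 2 * H * p\<close>, and every remaining error is at most \<open>p / 2\<close>.
  Eliminating \<open>s\<close> and \<open>t\<close> leaves \<open>\<rho>\<^sup>2 * p\<close> close
  to \<open>q\<close>, and comparability of \<open>p\<close> and \<open>q\<close> bounds
  \<open>\<rho>\<^sup>2\<close> on both sides.\<close>

lemma growth_tolerance_exists:
  fixes \<kappa> K1 K E :: real
  assumes "\<kappa> \<ge> 1" "K1 \<ge> 1" "K \<ge> 0" "E \<ge> 1"
  obtains \<tau> where "\<tau> > 0" "growth_tolerance \<kappa> K1 K E \<tau>"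
proof -
  \<comment> \<open>\<open>H\<close> and \<open>J\<close> collect the coefficients of
    \<open>p\<close> and of \<open>\<tau> * N\<close> in the bound for \<open>N\<close>;
    \<open>M\<close> adds up all coefficients of \<open>\<tau> * N\<close> in the final
    comparison.\<close>
  define H where "H = K * (K1 + 2 * E) + E + E * \<kappa> * K1"
  define J where "J = K * (3 * K1 + 7 + 2 * \<kappa>) + 3 * E * \<kappa> * K1 + 2"
  define M where "M = 3 * \<kappa> * K1 + E * (\<kappa> + 2) + \<kappa> * K1 * (E * (\<kappa> + 2))"
  have "H \<ge> 1" "J \<ge> 1"
  proof -
    have "0 \<le> K * (K1 + 2 * E)" "0 \<le> E * \<kappa> * K1" "0 \<le> K * (3 * K1 + 7 + 2 * \<kappa>)" "0 \<le> 3 * E * \<kappa> * K1"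
      using assms by simp_all
    then show "H \<ge> 1" "J \<ge> 1" using assms unfolding H_def J_def by linarith+
  qed
  have parts: "0 \<le> 3 * \<kappa> * K1" "1 \<le> E * (\<kappa> + 2)" "0 \<le> \<kappa> * K1 * (E * (\<kappa> + 2))"
    "3 * \<kappa> * K1 \<ge> 3" "E * (\<kappa> + 2) \<ge> 0"
    using assms mult_mono[of 1 E 1 "\<kappa> + 2"] mult_mono[of 1 \<kappa> 1 K1] by simp_all
  then have "M \<ge> 1" unfolding M_def by linarith
  \<comment> \<open>The first bound moves \<open>J * \<tau> * N\<close> to the left side, the second
    turns \<open>M * \<tau> * N\<close> into at most \<open>p / 2\<close>. Only here does
    \<open>E\<close> influence the outcome.\<close>
  define \<tau> where "\<tau> = min (1 / (2 * J)) (1 / (4 * M * H))"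
  have "\<tau> > 0" using \<open>H \<ge> 1\<close> \<open>J \<ge> 1\<close> \<open>M \<ge> 1\<close> by (simp add: \<tau>_def)
  have \<tau>J: "J * \<tau> \<le> 1 / 2"
  proof -
    have "J * \<tau> \<le> J * (1 / (2 * J))"
      unfolding \<tau>_def using \<open>J \<ge> 1\<close> by (intro mult_left_mono) auto
    then show ?thesis using \<open>J \<ge> 1\<close> by simp
  qed
  have \<tau>M: "M * \<tau> * (2 * H) \<le> 1 / 2"
  proof -
    have "(2 * M * H) * \<tau> \<le> (2 * M * H) * (1 / (4 * M * H))"
      unfolding \<tau>_def using \<open>M \<ge> 1\<close> \<open>H \<ge> 1\<close> by (intro mult_left_mono) auto
    then show ?thesis using \<open>M \<ge> 1\<close> \<open>H \<ge> 1\<close> by (simp add: mult_ac)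
  qed
  show ?thesis
  proof (rule that[OF \<open>\<tau> > 0\<close>], unfold growth_tolerance_def, intro allI impI)
    fix N p q s t na na' nb nb' \<rho> :: real
    assume N: "N > 0" and pq: "0 \<le> p" "0 \<le> q" and \<rho>: "0 < \<rho>" "\<rho> \<le> E"
      and m1: "na + na' \<le> K1 * p + 3 * K1 * \<tau> * N" and m2: "na + na' \<le> K1 * q + 3 * K1 * \<tau> * N"
      and na: "0 \<le> na" "0 \<le> na'" "q \<le> \<kappa> * na" "p \<le> \<kappa> * na'"
      and nb: "nb' \<le> E * p + (3 + \<kappa>) * \<tau> * N" "nb \<le> nb' + \<tau> * N"
      and sup: "N \<le> K * (na + na' + nb + nb') + E * (p + q) + 2 * \<tau> * N"
      and st: "\<bar>s - t\<bar> \<le> \<kappa> * \<tau> * N" "\<bar>s - \<rho> * p\<bar> \<le> \<tau> * N" "\<bar>t - q / \<rho>\<bar> \<le> \<tau> * N"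
    define n where "n = \<tau> * N"
    have n: "0 < n" using N \<open>\<tau> > 0\<close> by (simp add: n_def)
    have qp: "q \<le> \<kappa> * K1 * p + 3 * \<kappa> * K1 * n"
    proof -
      have "\<kappa> * na \<le> \<kappa> * (K1 * p + 3 * K1 * n)"
        using m1 na(2) assms by (intro mult_left_mono) (auto simp: n_def mult.assoc)
      then show ?thesis using na(3) by (simp add: algebra_simps)
    qed
    have pq': "p \<le> \<kappa> * K1 * q + 3 * \<kappa> * K1 * n"
    proof -
      have "\<kappa> * na' \<le> \<kappa> * (K1 * q + 3 * K1 * n)"
        using m2 na(1) assms by (intro mult_left_mono) (auto simp: n_def mult.assoc)
      then show ?thesis using na(4) by (simp add: algebra_simps)
    qed
    have "K * (na + na' + nb + nb') \<le> K * (K1 * p + 3 * K1 * n + 2 * E * p + (7 + 2 * \<kappa>) * n)"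
      using assms m1 nb by (intro mult_left_mono) (auto simp: n_def algebra_simps)
    moreover have "E * (p + q) \<le> E * (p + (\<kappa> * K1 * p + 3 * \<kappa> * K1 * n))"
      using assms qp by (intro mult_left_mono) auto
    ultimately have "N \<le> K * (K1 * p + 3 * K1 * n + 2 * E * p + (7 + 2 * \<kappa>) * n)
        + E * (p + (\<kappa> * K1 * p + 3 * \<kappa> * K1 * n)) + 2 * n"
      using sup unfolding n_def by linarith
    also have "\<dots> = H * p + J * n"
      by (simp add: H_def J_def algebra_simps)
    finally have "N \<le> H * p + J * n" .
    moreover have "J * n \<le> 1 / 2 * N"
      using mult_right_mono[OF \<tau>J, of N] N by (simp add: n_def mult.assoc)
    ultimately have Np: "N \<le> 2 * H * p" by simp
    have "p \<noteq> 0" using Np N by auto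
    then have "p > 0" using pq(1) by simp
    have Mn: "M * n \<le> p / 2"
    proof -
      have "M * \<tau> * N \<le> M * \<tau> * (2 * H * p)"
        using Np \<open>M \<ge> 1\<close> \<open>\<tau> > 0\<close> by (intro mult_left_mono) auto
      also have "\<dots> = (M * \<tau> * (2 * H)) * p" by simp
      also have "\<dots> \<le> 1 / 2 * p"
        using \<tau>M pq(1) by (rule mult_right_mono)
      finally show ?thesis by (simp add: n_def mult.assoc)
    qed
    \<comment> \<open>Both sides are center sizes at the common end of the period, which agree up to
      \<open>\<kappa> * \<tau> * N\<close>; each transport adds one \<open>\<tau> * N\<close>.
      Multiplication by \<open>\<rho> \<le> E\<close> follows.\<close>
    have "\<bar>\<rho> * p - q / \<rho>\<bar> \<le> (\<kappa> + 2) * n"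
      using st unfolding n_def by (simp add: algebra_simps)
    then have "\<rho> * \<bar>\<rho> * p - q / \<rho>\<bar> \<le> E * ((\<kappa> + 2) * n)"
      using \<rho> assms n by (intro mult_mono) auto
    moreover have "\<rho> * \<bar>\<rho> * p - q / \<rho>\<bar> = \<bar>\<rho> * (\<rho> * p - q / \<rho>)\<bar>"
      using \<rho>(1) by (simp add: abs_mult)
    moreover have "\<rho> * (\<rho> * p - q / \<rho>) = \<rho>\<^sup>2 * p - q"
      using \<rho>(1) by (simp add: right_diff_distrib power2_eq_square)
    ultimately have main: "\<bar>\<rho>\<^sup>2 * p - q\<bar> \<le> E * (\<kappa> + 2) * n"
      by (simp add: mult.assoc)
    have K1: "1 \<le> \<kappa> * K1" using assms mult_mono[of 1 \<kappa> 1 K1] by simp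
    have Mn': "3 * \<kappa> * K1 * n + E * (\<kappa> + 2) * n + \<kappa> * K1 * (E * (\<kappa> + 2)) * n \<le> p / 2"
      using Mn by (simp add: M_def distrib_right)
    have nn: "0 \<le> 3 * \<kappa> * K1 * n" "0 \<le> E * (\<kappa> + 2) * n" "0 \<le> \<kappa> * K1 * (E * (\<kappa> + 2)) * n"
      using parts n by simp_all
    have "\<rho>\<^sup>2 * p \<le> \<kappa> * K1 * p + p / 2"
      using main qp Mn' nn by linarith
    also have "\<dots> \<le> 2 * (\<kappa> * K1 * p)"
      using mult_right_mono[OF K1 pq(1)] pq(1) by linarith
    also have "\<dots> = (2 * \<kappa> * K1) * p"
      by simp
    finally have "\<rho>\<^sup>2 \<le> 2 * \<kappa> * K1"
      using \<open>p > 0\<close> by simp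
    moreover have "1 \<le> 2 * \<kappa> * K1 * \<rho>\<^sup>2"
    proof -
      have "\<kappa> * K1 * q \<le> \<kappa> * K1 * (\<rho>\<^sup>2 * p + E * (\<kappa> + 2) * n)"
        using main K1 by (intro mult_left_mono) auto
      then have "\<kappa> * K1 * q \<le> \<kappa> * K1 * (\<rho>\<^sup>2 * p) + \<kappa> * K1 * (E * (\<kappa> + 2)) * n"
        by (simp add: algebra_simps)
      then have "p \<le> \<kappa> * K1 * (\<rho>\<^sup>2 * p) + p / 2"
        using pq' Mn' nn by linarith
      then have "1 * p \<le> (2 * \<kappa> * K1 * \<rho>\<^sup>2) * p" by simp
      then show ?thesis using \<open>p > 0\<close> by (rule mult_right_le_imp_le)
    qed
    ultimately show "\<rho>\<^sup>2 \<le> 2 * \<kappa> * K1 \<and> 1 \<le> 2 * \<kappa> * K1 * \<rho>\<^sup>2" ..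
  qed
qed

section \<open>The center eigenvalue near the arc\<close>

text \<open>Near \<open>z0\<close> the derivative of \<open>f z - deriv f z0 * z\<close> is at most
  half of \<open>norm (deriv f z0)\<close>, so \<open>f\<close> is a bi-Lipschitz perturbation of a
  nonzero linear map. The upper bound keeps \<open>\<mu>c\<close> near the imaginary axis; the lower
  one returns to distances in the spectral plane.\<close>

lemma analytic_local_bounds:
  fixes f :: "complex \<Rightarrow> complex"
  assumes an: "f analytic_on {z0}" and d: "deriv f z0 \<noteq> 0"
  obtains r K where "r > 0" "K > 0"
    "\<And>z w. z \<in> ball z0 r \<Longrightarrow> w \<in> ball z0 r \<Longrightarrow> norm (z - w) \<le> K * norm (f z - f w)"
    "\<And>z w. z \<in> ball z0 r \<Longrightarrow> w \<in> ball z0 r \<Longrightarrow> norm (f z - f w) \<le> K * norm (z - w)"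
proof -
  obtain s where s: "s > 0" "f holomorphic_on ball z0 s"
    using an unfolding analytic_on_def by blast
  have "continuous_on (ball z0 s) (deriv f)"
    by (intro holomorphic_on_imp_continuous_on holomorphic_deriv s) auto
  then have "isCont (deriv f) z0"
    using s(1) by (simp add: continuous_on_eq_continuous_at)
  then obtain r where r: "r > 0" "\<And>z. dist z z0 < r \<Longrightarrow> dist (deriv f z) (deriv f z0) < norm (deriv f z0) / 2"
    using d unfolding continuous_at_eps_delta by (metis half_gt_zero zero_less_norm_iff)
  define \<rho> where "\<rho> = min r s"
  have rho: "\<rho> > 0" using r s by (simp add: \<rho>_def)
  have approx: "norm ((f z - deriv f z0 * z) - (f w - deriv f z0 * w)) \<le> norm (deriv f z0) / 2 * norm (z - w)"
    if "z \<in> ball z0 \<rho>" "w \<in> ball z0 \<rho>" for z w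
  proof (rule field_differentiable_bound[of "ball z0 \<rho>" _ "\<lambda>u. deriv f u - deriv f z0"])
    fix u assume u: "u \<in> ball z0 \<rho>"
    then have "(f has_field_derivative deriv f u) (at u)"
      using s(2) by (intro holomorphic_derivI[of f "ball z0 s"]) (auto simp: \<rho>_def)
    then show "((\<lambda>u. f u - deriv f z0 * u) has_field_derivative deriv f u - deriv f z0) (at u within ball z0 \<rho>)"
      by (auto intro!: derivative_eq_intros intro: has_field_derivative_at_within)
    show "norm (deriv f u - deriv f z0) \<le> norm (deriv f z0) / 2"
      using r(2)[of u] u by (auto simp: \<rho>_def dist_norm norm_minus_commute)
  qed (use that in auto)
  define D where "D = norm (deriv f z0)"
  have D: "D > 0" using d by (simp add: D_def)
  have two: "D / 2 * norm (z - w) \<le> norm (f z - f w)" "norm (f z - f w) \<le> 3 * D / 2 * norm (z - w)"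
    if "z \<in> ball z0 \<rho>" "w \<in> ball z0 \<rho>" for z w
  proof -
    have a: "norm ((f z - f w) - deriv f z0 * (z - w)) \<le> D / 2 * norm (z - w)"
      using approx[OF that] by (simp add: D_def algebra_simps)
    have b: "norm (deriv f z0 * (z - w)) = D * norm (z - w)"
      by (simp add: norm_mult D_def)
    show "D / 2 * norm (z - w) \<le> norm (f z - f w)"
      using a b norm_triangle_sub[of "deriv f z0 * (z - w)" "f z - f w"]
      by (simp add: norm_minus_commute)
    show "norm (f z - f w) \<le> 3 * D / 2 * norm (z - w)"
      using a b norm_triangle_sub[of "f z - f w" "deriv f z0 * (z - w)"] by simp
  qed
  show ?thesis
  proof (rule that[OF rho])
    show "max (2 / D) (3 * D / 2) > 0" using D by (simp add: less_max_iff_disj)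
    fix z w assume zw: "z \<in> ball z0 \<rho>" "w \<in> ball z0 \<rho>"
    have "norm (z - w) \<le> 2 / D * norm (f z - f w)"
      using two(1)[OF zw] D by (simp add: field_simps)
    also have "\<dots> \<le> max (2 / D) (3 * D / 2) * norm (f z - f w)"
      by (intro mult_right_mono) auto
    finally show "norm (z - w) \<le> max (2 / D) (3 * D / 2) * norm (f z - f w)" .
    show "norm (f z - f w) \<le> max (2 / D) (3 * D / 2) * norm (z - w)"
      by (rule order_trans[OF two(2)[OF zw]]) (intro mult_right_mono; simp)
  qed
qed

lemma exists_congruent_near:
  fixes k y X :: real
  assumes "X > 0"
  obtains l :: int where "\<bar>y - (k + of_int l * (2 * pi / X))\<bar> \<le> pi / X"
proof -
  define l where "l = round ((y - k) * X / (2 * pi))"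
  have "\<bar>of_int l - (y - k) * X / (2 * pi)\<bar> \<le> 1 / 2"
    unfolding l_def by (rule of_int_round_abs_le)
  then have "(2 * pi / X) * \<bar>of_int l - (y - k) * X / (2 * pi)\<bar> \<le> (2 * pi / X) * (1 / 2)"
    using assms by (intro mult_left_mono) auto
  moreover have "(2 * pi / X) * \<bar>of_int l - (y - k) * X / (2 * pi)\<bar>
      = \<bar>(2 * pi / X) * (of_int l - (y - k) * X / (2 * pi))\<bar>"
    using assms by (simp add: abs_mult)
  moreover have "(2 * pi / X) * (of_int l - (y - k) * X / (2 * pi)) = of_int l * (2 * pi / X) - (y - k)"
    using assms by (simp add: field_simps)
  ultimately have "\<bar>y - (k + of_int l * (2 * pi / X))\<bar> \<le> pi / X"
    by (simp add: abs_minus_commute algebra_simps)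
  then show ?thesis using that by blast
qed

text \<open>By (H2), \<open>Ainf\<close> is the uniform limit on \<open>ball z0 1\<close> of the
  analytic functions \<open>A 0 (real n)\<close>, and uniform limits preserve continuity.\<close>

lemma H2_limit_continuous:
  fixes A :: "real \<Rightarrow> real \<Rightarrow> complex \<Rightarrow> complex^'n^'n"
  assumes an: "\<And>x. matrix_analytic_on (A 0 x) UNIV" and "\<nu> > 0" and H2: "H2 A Ainf \<nu>"
  shows "isCont Ainf z0"
proof -
  define M where "M = norm z0 + 1"
  have "M > 0" by (simp add: M_def add_nonneg_pos)
  then obtain K where K: "K > 0" "\<And>x z. norm z \<le> M \<Longrightarrow> norm (A 0 x z - Ainf z) \<le> K * exp (- \<nu> * \<bar>x\<bar>)"
    using H2 unfolding H2_def by blast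
  have "uniform_limit (ball z0 1) (\<lambda>n. A 0 (real n)) Ainf sequentially"
  proof (rule uniform_limitI)
    fix e :: real assume "e > 0"
    have "(\<lambda>n. K * exp (- \<nu>) ^ n) \<longlonglongrightarrow> 0"
      using \<open>\<nu> > 0\<close> by (intro tendsto_mult_right_zero LIMSEQ_power_zero) simp
    then have "(\<lambda>n. K * exp (- \<nu> * real n)) \<longlonglongrightarrow> 0"
      by (simp add: exp_of_nat_mult[symmetric] mult.commute)
    then have "\<forall>\<^sub>F n in sequentially. K * exp (- \<nu> * real n) < e"
      using \<open>e > 0\<close> by (rule order_tendstoD)
    then show "\<forall>\<^sub>F n in sequentially. \<forall>z\<in>ball z0 1. dist (A 0 (real n) z) (Ainf z) < e"
    proof eventually_elim
      case (elim n)
      have "norm z \<le> M" if "z \<in> ball z0 1" for z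
        using that norm_triangle_sub[of z z0] by (simp add: M_def dist_norm norm_minus_commute)
      then show ?case using K(2)[of _ "real n"] elim
        by (fastforce simp: dist_norm)
    qed
  qed
  moreover have "continuous_on (ball z0 1) (A 0 x)" for x
  proof -
    have "(\<lambda>z. A 0 x z $ i $ j) analytic_on UNIV" for i j
      using an[of x] unfolding matrix_analytic_on_def by blast
    then have "continuous_on (ball z0 1) (\<lambda>z. A 0 x z $ i $ j)" for i j
      by (meson analytic_imp_holomorphic continuous_on_subset holomorphic_on_imp_continuous_on subset_UNIV)
    then have "continuous_on (ball z0 1) (\<lambda>z. \<chi> i j. A 0 x z $ i $ j)"
      by (intro continuous_on_vec_lambda)
    then show ?thesis by simp
  qed
  ultimately have "continuous_on (ball z0 1) Ainf"
    by (intro uniform_limit_theorem) auto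
  then show ?thesis
    by (simp add: continuous_on_eq_continuous_at)
qed

section \<open>Center growth of Floquet solutions\<close>

text \<open>\<open>W'\<close> is the Floquet solution on the left half-period, read from the origin
  outwards: dividing \<open>W (X - x)\<close> by \<open>\<gamma>\<close> continues it to
  \<open>- x\<close>. In this form \<open>W' 0 = W 0\<close> is the eigenvector equation, the
  relation at \<open>X / 2\<close> holds by construction, and periodicity replaces
  \<open>A (X - x)\<close> by \<open>A (- x)\<close>.\<close>

lemma floquet_half_solutions:
  fixes \<Psi> A :: "real \<Rightarrow> complex^'n^'n"
  assumes \<Psi>0: "\<Psi> 0 = mat 1"
    and \<Psi>': "\<And>x. (\<Psi> has_vector_derivative (A x ** \<Psi> x)) (at x)"
    and per: "\<And>x. A (x + X) = A x"
    and det: "det (\<Psi> X - mat \<gamma>) = 0" and \<gamma>: "norm \<gamma> = 1"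
  obtains W W' where "W 0 \<noteq> 0" "W' 0 = W 0" "W (X / 2) = \<gamma> *s W' (X / 2)"
    "\<And>x S. (W has_vector_derivative (A x *v W x)) (at x within S)"
    "\<And>x S. (W' has_vector_derivative ((- A (- x)) *v W' x)) (at x within S)"
proof -
  obtain v where v: "v \<noteq> 0" "(\<Psi> X - mat \<gamma>) *v v = 0"
    by (rule det_eq_0_imp_kernel[OF det])
  then have \<Psi>v: "\<Psi> X *v v = \<gamma> *s v"
    by (simp add: matrix_vector_mult_diff_rdistrib mat_vector_mult)
  have "\<gamma> \<noteq> 0" using \<gamma> by auto
  define W where "W x = \<Psi> x *v v" for x
  define W' where "W' x = inverse \<gamma> *s W (X - x)" for x
  have dW: "(W has_vector_derivative (A x *v W x)) (at x within S)" for x S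
  proof -
    have "(W has_vector_derivative (\<Psi> x *v 0 + (A x ** \<Psi> x) *v v)) (at x)"
      unfolding W_def by (intro has_vector_derivative_matrix_vector_mult \<Psi>' has_vector_derivative_const)
    then show ?thesis
      by (simp add: W_def matrix_vector_mul_assoc has_vector_derivative_at_within)
  qed
  have dW': "(W' has_vector_derivative ((- A (- x)) *v W' x)) (at x within S)" for x S
  proof -
    have "(\<lambda>y. X - y) ` UNIV = UNIV" by (auto intro!: image_eqI[of _ _ "X - _"])
    then have "((\<lambda>y. W (X - y)) has_vector_derivative - (A (X - x) *v W (X - x))) (at x)"
      using has_vector_derivative_reflect[OF dW[of "X - x" UNIV]] by simp
    from has_vector_derivative_vector_smult[OF has_vector_derivative_const this, of "inverse \<gamma>"]
    have "(W' has_vector_derivative (inverse \<gamma> *s - (A (X - x) *v W (X - x)))) (at x)"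
      unfolding W'_def by simp
    moreover have "inverse \<gamma> *s - (A (X - x) *v W (X - x)) = (- A (- x)) *v W' x"
      using per[of "- x"] unfolding W'_def
      by (simp add: matrix_uminus_vector_mult vector_scalar_commute vector_smult_rneg add.commute)
    ultimately show ?thesis by (simp add: has_vector_derivative_at_within)
  qed
  show ?thesis
  proof (rule that[OF _ _ _ dW dW'])
    show "W 0 \<noteq> 0" using v(1) by (simp add: W_def \<Psi>0)
    show "W' 0 = W 0"
      using \<open>\<gamma> \<noteq> 0\<close> \<Psi>v by (simp add: W'_def W_def \<Psi>0 vector_smult_assoc)
    show "W (X / 2) = \<gamma> *s W' (X / 2)"
      using \<open>\<gamma> \<noteq> 0\<close> by (simp add: W'_def vector_smult_assoc)
  qed
qed

lemma continuous_bounded_attained: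
  fixes Z :: "real \<Rightarrow> complex^'n"
  assumes "0 \<le> L" and Z': "\<And>x. x \<in> {0..L} \<Longrightarrow> (Z has_vector_derivative D x) (at x within {0..L})"
  shows "\<exists>x\<in>{0..L}. \<forall>y\<in>{0..L}. norm (Z y) \<le> norm (Z x)"
proof -
  have "continuous_on {0..L} Z"
    unfolding continuous_on_eq_continuous_within
    using has_vector_derivative_continuous[OF Z'] by blast
  then have "continuous_on {0..L} (\<lambda>x. norm (Z x))"
    by (rule continuous_on_norm)
  then show ?thesis
    using continuous_attains_sup[of "{0..L}" "\<lambda>x. norm (Z x)"] assms(1) by auto
qed

text \<open>The analysis at one fixed parameter ends in the scalar inequalities of
  \<open>growth_tolerance\<close>. \<open>Pm0\<close> and \<open>Pp0\<close> stand for the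
  conjugators at the base point, because the matching constant \<open>K1\<close> belongs to them;
  replacing \<open>Pm 0\<close> and \<open>Pp 0\<close> by them costs \<open>\<tau> / 2\<close> on
  each side.\<close>

lemma floquet_center_growth:
  fixes S U \<Psi> A0 A1 Pm Pp :: "real \<Rightarrow> complex^'n^'n" and A B Qu Qc Qs Pm0 Pp0 :: "complex^'n^'n"
  assumes decay: "0 < \<alpha>" "0 < K" "S 0 = Qs" "U 0 = Qu"
      "\<And>t. t \<ge> 0 \<Longrightarrow> (S has_vector_derivative (S t ** B)) (at t)"
      "\<And>t. t \<ge> 0 \<Longrightarrow> (U has_vector_derivative (U t ** (- B))) (at t)"
      "\<And>t. t \<ge> 0 \<Longrightarrow> norm (S t) \<le> K * exp (- \<alpha> * t)"
      "\<And>t. t \<ge> 0 \<Longrightarrow> norm (U t) \<le> K * exp (- \<alpha> * t)"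
    and sum: "\<And>v. Qu *v v + Qc *v v + Qs *v v = v"
    and \<kappa>: "1 \<le> \<kappa>" "norm Qu \<le> \<kappa>" "norm Qc \<le> \<kappa>"
    and K1: "0 < K1"
    and match: "\<And>a b. norm a + norm b \<le> K1 * (norm (Qc *v b) + norm (Qs *v a) + norm (Qu *v b) + norm (Pm0 *v a - Pp0 *v b))"
      "\<And>a b. norm a + norm b \<le> K1 * (norm (Qc *v a) + norm (Qs *v a) + norm (Qu *v b) + norm (Pm0 *v a - Pp0 *v b))"
    and \<Psi>: "\<Psi> 0 = mat 1" "\<And>x. (\<Psi> has_vector_derivative (A1 x ** \<Psi> x)) (at x)"
      "\<And>x. A1 (x + X) = A1 x" "det (\<Psi> X - mat \<gamma>) = 0" "norm \<gamma> = 1" "0 < X"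
    and close: "\<And>x. \<bar>x\<bar> \<le> X / 2 \<Longrightarrow> norm (A1 x - A0 x) \<le> \<delta>"
    and Pp: "\<And>x. x \<ge> 0 \<Longrightarrow> (Pp has_vector_derivative (A0 x ** Pp x - Pp x ** A)) (at x within {0..})"
      "\<And>x. x \<ge> 0 \<Longrightarrow> invertible (Pp x)" "\<And>x. x \<ge> 0 \<Longrightarrow> norm (Pp x) \<le> Kp"
      "\<And>x. x \<ge> 0 \<Longrightarrow> norm (matrix_inv (Pp x)) \<le> Kp"
    and Pm: "\<And>x. x \<le> 0 \<Longrightarrow> (Pm has_vector_derivative (A0 x ** Pm x - Pm x ** A)) (at x within {..0})"
      "\<And>x. x \<le> 0 \<Longrightarrow> invertible (Pm x)" "\<And>x. x \<le> 0 \<Longrightarrow> norm (Pm x) \<le> Kp"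
      "\<And>x. x \<le> 0 \<Longrightarrow> norm (matrix_inv (Pm x)) \<le> Kp"
    and ends: "norm (Pp (X / 2) - mat 1) \<le> \<tau> / 2" "norm (Pm (- (X / 2)) - mat 1) \<le> \<tau> / 2"
    and origin: "norm (Pp0 - Pp 0) \<le> \<tau> / 2" "norm (Pm0 - Pm 0) \<le> \<tau> / 2"
    and AB: "norm (A - B) \<le> \<delta>'"
    and l: "\<And>v. pairing l (A *v v) = \<mu> * pairing l v"
      "\<And>v. \<bar>norm (pairing l v) - norm (Qc *v v)\<bar> \<le> e * norm v" "0 \<le> e"
    and \<mu>: "\<bar>Re \<mu>\<bar> * (X / 2) \<le> c"
    and \<tau>1: "K * exp (- \<alpha> * (X / 2)) + K * (Kp * \<delta> * Kp + \<delta>') / \<alpha> \<le> \<tau>"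
    and \<tau>2: "2 * K * (Kp * \<delta> * Kp + \<delta>') / \<alpha>
      + (exp (2 * c) * (norm Qc + e) * (Kp * \<delta> * Kp) * (X / 2) + e * (1 + exp c)) \<le> \<tau>"
    and tol: "growth_tolerance \<kappa> K1 K (exp c) \<tau>"
  defines "\<rho> \<equiv> exp (Re \<mu> * (X / 2))"
  shows "\<rho>\<^sup>2 \<le> 2 * \<kappa> * K1 \<and> 1 \<le> 2 * \<kappa> * K1 * \<rho>\<^sup>2"
proof -
  define L where "L = X / 2"
  have L: "0 < L" using \<Psi>(6) by (simp add: L_def)
  obtain W W' where W: "W 0 \<noteq> 0" "W' 0 = W 0" "W (X / 2) = \<gamma> *s W' (X / 2)"
    and dW: "\<And>x S. (W has_vector_derivative (A1 x *v W x)) (at x within S)"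
    and dW': "\<And>x S. (W' has_vector_derivative ((- A1 (- x)) *v W' x)) (at x within S)"
    by (rule floquet_half_solutions[OF \<Psi>(1-5)]) blast
  have sub: "{0..L} \<subseteq> {0..}" by auto
  obtain Zp Gp where Zp: "\<And>x. x \<in> {0..L} \<Longrightarrow> Pp x *v Zp x = W x"
    "\<And>x. x \<in> {0..L} \<Longrightarrow> (Zp has_vector_derivative (Gp x *v Zp x)) (at x within {0..L})"
    "\<And>x. x \<in> {0..L} \<Longrightarrow> norm (Gp x - A) \<le> Kp * \<delta> * Kp"
  proof (rule conjugated_system[of "{0..L}" Pp A0 A Kp W A1 \<delta>])
    fix x assume x: "x \<in> {0..L}"
    show "(Pp has_vector_derivative A0 x ** Pp x - Pp x ** A) (at x within {0..L})"
      using x by (intro has_vector_derivative_within_subset[OF Pp(1) sub]) auto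
    show "norm (A1 x - A0 x) \<le> \<delta>" using x by (intro close) (auto simp: L_def)
  qed (use Pp dW in auto)
  \<comment> \<open>The left half-period is reflected to \<open>{0..L}\<close>, so all coefficient
    matrices change sign.\<close>
  obtain Zm Gm where Zm: "\<And>x. x \<in> {0..L} \<Longrightarrow> Pm (- x) *v Zm x = W' x"
    "\<And>x. x \<in> {0..L} \<Longrightarrow> (Zm has_vector_derivative (Gm x *v Zm x)) (at x within {0..L})"
    "\<And>x. x \<in> {0..L} \<Longrightarrow> norm (Gm x - (- A)) \<le> Kp * \<delta> * Kp"
  proof (rule conjugated_system[of "{0..L}" "\<lambda>x. Pm (- x)" "\<lambda>x. - A0 (- x)" "- A" Kp W' "\<lambda>x. - A1 (- x)" \<delta>])
    fix x assume x: "x \<in> {0..L}"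
    have "(\<lambda>x. 0 - x) ` {..0} = {0 :: real..}" by (auto simp: image_iff intro!: bexI[of _ "- _"])
    then have "((\<lambda>x. Pm (- x)) has_vector_derivative - (A0 (- x) ** Pm (- x) - Pm (- x) ** A)) (at x within {0..})"
      using has_vector_derivative_reflect[of Pm "A0 (- x) ** Pm (- x) - Pm (- x) ** A" 0 x "{..0}"]
        Pm(1)[of "- x"] x by (simp del: minus_diff_eq)
    moreover have "- (A0 (- x) ** Pm (- x) - Pm (- x) ** A) = (- A0 (- x)) ** Pm (- x) - Pm (- x) ** (- A)"
      by (simp add: bounded_bilinear.minus_left[OF bounded_bilinear_matrix_matrix_mult]
          bounded_bilinear.minus_right[OF bounded_bilinear_matrix_matrix_mult])
    ultimately show "((\<lambda>x. Pm (- x)) has_vector_derivative (- A0 (- x)) ** Pm (- x) - Pm (- x) ** (- A)) (at x within {0..L})"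
      using has_vector_derivative_within_subset[OF _ sub] by metis
    show "norm (- A1 (- x) - - A0 (- x)) \<le> \<delta>"
      using close[of "- x"] x by (auto simp: L_def norm_minus_commute)
  qed (use Pm dW' in auto)
  obtain x1 where x1: "x1 \<in> {0..L}" "\<And>y. y \<in> {0..L} \<Longrightarrow> norm (Zp y) \<le> norm (Zp x1)"
    using continuous_bounded_attained[OF less_imp_le[OF L] Zp(2)] by blast
  obtain x2 where x2: "x2 \<in> {0..L}" "\<And>y. y \<in> {0..L} \<Longrightarrow> norm (Zm y) \<le> norm (Zm x2)"
    using continuous_bounded_attained[OF less_imp_le[OF L] Zm(2)] by blast
  \<comment> \<open>One supremum for both halves, since the matching at the origin and at the ends
    mixes them.\<close>
  define N where "N = max (norm (Zp x1)) (norm (Zm x2))"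
  have Np: "norm (Zp y) \<le> N" and Nm: "norm (Zm y) \<le> N" if "y \<in> {0..L}" for y
    using x1(2)[OF that] x2(2)[OF that] by (auto simp: N_def)
  have mem: "0 \<in> {0..L}" "L \<in> {0..L}" using L by auto
  have "Zp 0 \<noteq> 0" using Zp(1)[OF mem(1)] W(1) by auto
  then have N: "0 < N" using Np[OF mem(1)] by (meson less_le_trans zero_less_norm_iff)
  have lm: "pairing l ((- A) *v v) = (- \<mu>) * pairing l v" for v
    using l(1)[of v] by (simp add: matrix_uminus_vector_mult linear_neg[OF bounded_linear.linear[OF bounded_linear_pairing]])
  have \<mu>': "\<bar>Re (- \<mu>)\<bar> * L \<le> c" "\<bar>Re \<mu>\<bar> * L \<le> c" using \<mu> by (simp_all add: L_def)
  have sum': "Qs *v v + Qc *v v + Qu *v v = v" for v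
    using sum[of v] by (simp only: ac_simps)
  have AB': "norm (- A - - B) \<le> \<delta>'" using AB by (simp add: norm_minus_commute)
  have decay5': "(S has_vector_derivative (S t ** (- (- B)))) (at t)" if "t \<ge> 0" for t
    using decay(5)[OF that] by simp
  note tp = half_period_transport[OF decay sum Zp(2,3) AB Np l \<mu>'(2) less_imp_le[OF L] \<tau>1[folded L_def] \<tau>2[folded L_def]]
  \<comment> \<open>Under reflection the propagators \<open>S\<close> and \<open>U\<close> and the
    projections \<open>Qs\<close> and \<open>Qu\<close> change places, and \<open>\<mu>\<close>
    becomes \<open>- \<mu>\<close>, so the center factor is \<open>1 / \<rho>\<close>.\<close>
  note tm = half_period_transport[OF decay(1,2,4,3,6) decay5' decay(8,7) sum' Zm(2,3) AB' Nm lm l(2,3) \<mu>'(1) less_imp_le[OF L]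
      \<tau>1[folded L_def] \<tau>2[folded L_def]]
  \<comment> \<open>Unprimed letters belong to the left half, primed ones to the right half;
    \<open>a\<close> and \<open>a'\<close> are values at the origin, \<open>b\<close> and
    \<open>b'\<close> at the outer ends.\<close>
  define a a' b b' where "a = Zm 0" and "a' = Zp 0" and "b = Zm L" and "b' = Zp L"
  have nN: "norm a \<le> N" "norm a' \<le> N" "norm b \<le> N" "norm b' \<le> N"
    unfolding a_def a'_def b_def b'_def by (intro Nm Np mem)+
  have \<tau>0: "0 \<le> \<tau>" using ends(1) norm_ge_zero[of "Pp (X / 2) - mat 1"] by linarith
  have near: "norm (M *v u - M' *v u) \<le> \<tau> / 2 * N" if "norm (M - M') \<le> \<tau> / 2" "norm u \<le> N"
    for M M' :: "complex^'n^'n" and u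
  proof -
    have "norm (M *v u - M' *v u) \<le> norm (M - M') * norm u"
      using norm_matrix_vector_mult_le[of "M - M'" u] by (simp only: matrix_vector_mult_diff_rdistrib)
    also have "\<dots> \<le> \<tau> / 2 * N"
      using that \<tau>0 by (intro mult_mono) auto
    finally show ?thesis .
  qed
  have origin': "norm (Pm0 *v a - Pp0 *v a') \<le> \<tau> * N"
  proof -
    have "Pm 0 *v a = Pp 0 *v a'"
      using Zp(1)[OF mem(1)] Zm(1)[OF mem(1)] W(2) by (simp add: a_def a'_def)
    then have "Pm0 *v a - Pp0 *v a' = (Pm0 *v a - Pm 0 *v a) - (Pp0 *v a' - Pp 0 *v a')"
      by simp
    then have "norm (Pm0 *v a - Pp0 *v a') \<le> norm (Pm0 *v a - Pm 0 *v a) + norm (Pp0 *v a' - Pp 0 *v a')"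
      by (metis norm_triangle_ineq4)
    with near[OF origin(2) nN(1)] near[OF origin(1) nN(2)] show ?thesis by simp
  qed
  have ends': "norm (b' - \<gamma> *s b) \<le> \<tau> * N"
  proof -
    have "Pp L *v b' = \<gamma> *s (Pm (- L) *v b)"
      using Zp(1)[OF mem(2)] Zm(1)[OF mem(2)] W(3) by (simp add: b_def b'_def L_def)
    then have "b' - \<gamma> *s b = \<gamma> *s (Pm (- L) *v b - mat 1 *v b) - (Pp L *v b' - mat 1 *v b')"
      by (simp add: vector_ssub_ldistrib)
    then have "norm (b' - \<gamma> *s b) \<le> norm (\<gamma> *s (Pm (- L) *v b - mat 1 *v b)) + norm (Pp L *v b' - mat 1 *v b')"
      by (metis norm_triangle_ineq4)
    moreover have "norm (\<gamma> *s (Pm (- L) *v b - mat 1 *v b)) = norm (Pm (- L) *v b - mat 1 *v b)"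
      using \<Psi>(5) by (simp only: norm_vector_smult mult_1)
    ultimately show ?thesis
      using near[OF ends(2)[folded L_def] nN(3)] near[OF ends(1)[folded L_def] nN(4)] by simp
  qed
  have Q: "norm (Q *v u) \<le> \<kappa> * norm u" if "norm Q \<le> \<kappa>" for Q :: "complex^'n^'n" and u
    by (rule order_trans[OF norm_matrix_vector_mult_le]) (use that in \<open>intro mult_right_mono; simp\<close>)
  \<comment> \<open>As \<open>norm \<gamma> = 1\<close>, the near equality of \<open>b'\<close> and
    \<open>\<gamma> *s b\<close> compares the norms of their components.\<close>
  have \<gamma>Q: "norm (Q *v b') \<le> norm (Q *v b) + \<kappa> * \<tau> * N" "norm (Q *v b) \<le> norm (Q *v b') + \<kappa> * \<tau> * N"
    if "norm Q \<le> \<kappa>" for Q :: "complex^'n^'n"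
  proof -
    have "norm (Q *v (b' - \<gamma> *s b)) \<le> \<kappa> * (\<tau> * N)"
      by (rule order_trans[OF Q[OF that] mult_left_mono[OF ends']]) (use \<kappa>(1) in simp)
    moreover have "Q *v (b' - \<gamma> *s b) = Q *v b' - \<gamma> *s (Q *v b)"
      by (simp only: matrix_vector_mult_diff_distrib vector_scalar_commute)
    moreover have "norm (\<gamma> *s (Q *v b)) = norm (Q *v b)"
      using \<Psi>(5) by (simp only: norm_vector_smult mult_1)
    ultimately show "norm (Q *v b') \<le> norm (Q *v b) + \<kappa> * \<tau> * N" "norm (Q *v b) \<le> norm (Q *v b') + \<kappa> * \<tau> * N"
      using norm_triangle_sub[of "Q *v b'" "\<gamma> *s (Q *v b)"] norm_triangle_sub[of "\<gamma> *s (Q *v b)" "Q *v b'"]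
      by (simp_all add: norm_minus_commute mult.assoc)
  qed
  have \<rho>: "\<rho> = exp (Re \<mu> * L)" "0 < \<rho>" "\<rho> \<le> exp c" "exp (Re (- \<mu>) * L) = inverse \<rho>"
    using \<mu> by (auto simp: \<rho>_def L_def exp_minus abs_le_iff) (smt (verit) \<Psi>(6) mult_right_mono divide_right_mono)
  have stable: "norm (Qs *v a) \<le> \<tau> * N" "norm (Qu *v a') \<le> \<tau> * N" "norm (Qs *v b') \<le> \<tau> * N" "norm (Qu *v b) \<le> \<tau> * N"
    using tp(1,2) tm(1,2) by (simp_all add: a_def a'_def b_def b'_def)
  have center: "\<bar>norm (Qc *v b') - \<rho> * norm (Qc *v a')\<bar> \<le> \<tau> * N"
    "\<bar>norm (Qc *v b) - norm (Qc *v a) / \<rho>\<bar> \<le> \<tau> * N"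
    using tp(3) tm(3) unfolding \<rho>(4) \<rho>(1)[symmetric] a_def a'_def b_def b'_def
    by (simp_all add: divide_inverse mult.commute)
  have match': "norm a + norm a' \<le> K1 * r + 3 * K1 * \<tau> * N"
    if "norm a + norm a' \<le> K1 * (r + norm (Qs *v a) + norm (Qu *v a') + norm (Pm0 *v a - Pp0 *v a'))" for r
  proof -
    have "K1 * (r + norm (Qs *v a) + norm (Qu *v a') + norm (Pm0 *v a - Pp0 *v a')) \<le> K1 * (r + 3 * (\<tau> * N))"
      using K1 stable(1,2) origin' by (intro mult_left_mono) auto
    with that show ?thesis by (simp add: algebra_simps)
  qed
  \<comment> \<open>Transport on the right half does not make the unstable part small at its outer
    end. It is close in size to the unstable part of \<open>b\<close>, which is small because the
    reflected left half treats it as stable.\<close>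
  have nb': "norm b' \<le> exp c * norm (Qc *v a') + (3 + \<kappa>) * \<tau> * N"
  proof -
    have "norm b' \<le> norm (Qu *v b') + norm (Qc *v b') + norm (Qs *v b')"
      using norm_triangle_ineq[of "Qu *v b' + Qc *v b'" "Qs *v b'"]
        norm_triangle_ineq[of "Qu *v b'" "Qc *v b'"] sum[of b'] by simp
    moreover have "norm (Qu *v b') \<le> \<tau> * N + \<kappa> * \<tau> * N"
      using \<gamma>Q(1)[OF \<kappa>(2)] stable(4) by simp
    moreover have "\<rho> * norm (Qc *v a') \<le> exp c * norm (Qc *v a')"
      using \<rho>(3) by (intro mult_right_mono) auto
    then have "norm (Qc *v b') \<le> exp c * norm (Qc *v a') + \<tau> * N"
      using center(1) by linarith
    moreover have "(3 + \<kappa>) * \<tau> * N = 3 * (\<tau> * N) + \<kappa> * \<tau> * N"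
      by (simp add: algebra_simps)
    ultimately show ?thesis using stable(3) by linarith
  qed
  have nb: "norm b \<le> norm b' + \<tau> * N"
  proof -
    have "norm b = norm (\<gamma> *s b)"
      using \<Psi>(5) by (simp only: norm_vector_smult mult_1)
    then show ?thesis
      using norm_triangle_sub[of "\<gamma> *s b" b'] ends' by (simp add: norm_minus_commute)
  qed
  have sup: "N \<le> K * (norm a + norm a' + norm b + norm b') + exp c * (norm (Qc *v a') + norm (Qc *v a)) + 2 * \<tau> * N"
  proof -
    have pos: "0 \<le> \<tau> * N" "0 \<le> exp c * norm (Qc *v a')" "0 \<le> exp c * norm (Qc *v a)"
      "0 \<le> K * norm a" "0 \<le> K * norm a'" "0 \<le> K * norm b" "0 \<le> K * norm b'"
      using \<tau>0 N decay(2) by simp_all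
    have "norm (Zp x1) \<le> K * norm a' + K * norm b' + exp c * norm (Qc *v a') + \<tau> * N"
      using tp(4)[of x1] x1(1) unfolding a'_def b'_def by (simp add: distrib_left)
    moreover have "norm (Zm x2) \<le> K * norm a + K * norm b + exp c * norm (Qc *v a) + \<tau> * N"
      using tm(4)[of x2] x2(1) unfolding a_def b_def by (simp add: distrib_left)
    ultimately have "N \<le> K * norm a + K * norm a' + K * norm b + K * norm b'
        + (exp c * norm (Qc *v a') + exp c * norm (Qc *v a)) + 2 * (\<tau> * N)"
      using pos unfolding N_def by linarith
    then show ?thesis by (simp only: distrib_left mult.assoc)
  qed
  have st: "\<bar>norm (Qc *v b') - norm (Qc *v b)\<bar> \<le> \<kappa> * \<tau> * N"
    using \<gamma>Q[OF \<kappa>(3)] by linarith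
  \<comment> \<open>The center sizes of \<open>a'\<close>, \<open>a\<close>, \<open>b'\<close> and
    \<open>b\<close> play the roles of \<open>p\<close>, \<open>q\<close>, \<open>s\<close> and
    \<open>t\<close>.\<close>
  show ?thesis
    using tol[unfolded growth_tolerance_def, rule_format,
        OF N norm_ge_zero norm_ge_zero \<rho>(2,3) match'[OF match(1)] match'[OF match(2)] norm_ge_zero norm_ge_zero
        Q[OF \<kappa>(3)] Q[OF \<kappa>(3)] nb' nb sup st center] .
qed

section \<open>Continuity, uniform bounds and limits for the choice of thresholds\<close>

lemma matrix_analytic_isCont:
  assumes "matrix_analytic_on F U" "z \<in> U"
  shows "isCont F z"
proof -
  have "isCont (\<lambda>z. F z $ i $ j) z" for i j
    using assms unfolding matrix_analytic_on_def
    by (meson analytic_at_imp_isCont analytic_on_analytic_at)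
  then have "((\<lambda>z. \<chi> i j. F z $ i $ j) \<longlongrightarrow> (\<chi> i j. F z $ i $ j)) (at z)"
    unfolding isCont_def by (intro tendsto_vec_lambda)
  then show ?thesis unfolding isCont_def by simp
qed

lemma conjugator_onE:
  assumes "conjugator_on H U A0 Ainf \<eta> P"
  obtains K K' where
    "\<And>x z. x \<in> H \<Longrightarrow> z \<in> U \<Longrightarrow> invertible (P x z) \<and> norm (P x z) \<le> K \<and> norm (matrix_inv (P x z)) \<le> K"
    "\<And>x z. x \<in> H \<Longrightarrow> z \<in> U \<Longrightarrow> norm (P x z - mat 1) \<le> K' * exp (- \<eta> * \<bar>x\<bar>)"
    "\<And>x z. x \<in> H \<Longrightarrow> z \<in> U \<Longrightarrow>
      ((\<lambda>y. P y z) has_vector_derivative (A0 x z ** P x z - P x z ** Ainf z)) (at x within H)"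
    "\<And>x. x \<in> H \<Longrightarrow> matrix_analytic_on (P x) U"
  using assms unfolding conjugator_on_def by (elim conjE exE) blast

lemma exp_decay_tendsto_0:
  fixes a :: real
  assumes "a > 0"
  shows "((\<lambda>x. exp (- a * x)) \<longlongrightarrow> 0) at_top" "((\<lambda>x. exp (- a * x) * x) \<longlongrightarrow> 0) at_top"
proof -
  have lim: "filterlim (\<lambda>x. a * x) at_top at_top"
    using assms by (intro filterlim_tendsto_pos_mult_at_top[OF tendsto_const _ filterlim_ident])
  from filterlim_compose[OF tendsto_power_div_exp_0[of 0] lim]
  show "((\<lambda>x. exp (- a * x)) \<longlongrightarrow> 0) at_top"
    by (simp add: exp_minus divide_inverse)
  have "1 / a * ((a * x) ^ 1 / exp (a * x)) = exp (- a * x) * x" for x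
    using assms by (simp add: exp_minus field_simps)
  with tendsto_mult_left[OF filterlim_compose[OF tendsto_power_div_exp_0[of 1] lim], of "1 / a"]
  show "((\<lambda>x. exp (- a * x) * x) \<longlongrightarrow> 0) at_top"
    by simp
qed

theorem corollary5p1:
  fixes I :: "real set"
    and A :: "real \<Rightarrow> real \<Rightarrow> complex \<Rightarrow> complex^'n^'n"
    and X :: "real \<Rightarrow> real"
    and Ainf :: "complex \<Rightarrow> complex^'n^'n"
    and \<nu> \<theta> \<eta> :: real
    and \<Psi> :: "real \<Rightarrow> real \<Rightarrow> complex \<Rightarrow> complex^'n^'n"
    and m j :: nat
    and lam :: "nat \<Rightarrow> real \<Rightarrow> complex"
    and ks :: real
    and zs :: complex
    and \<mu>c :: "complex \<Rightarrow> complex"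
    and Qsu Qc Qss :: "complex \<Rightarrow> complex^'n^'n"
    and Pm Pp :: "real \<Rightarrow> complex \<Rightarrow> complex^'n^'n"
    and R :: "complex \<Rightarrow> complex^'n^'n"
    and Jsu Jc :: "'n set"
  assumes family: "system_family I A X"
    and H1: "H1 X"
    and H2: "\<nu> > 0" "H2 A Ainf \<nu>"
    and H3: "\<theta> > 0" "H3 I A X \<theta>"
    and \<Psi>: "\<And>\<epsilon>. \<epsilon> \<in> I \<Longrightarrow> \<epsilon> > 0 \<Longrightarrow> solution_operator (A \<epsilon>) (\<Psi> \<epsilon>)"
    and curves: "spectral_curves Ainf m lam"
    and arc: "isolated_arc Ainf m lam j ks \<mu>c"
    and zs: "zs = lam j ks"
    and Qsu: "analytic_spectral_projection Ainf zs {z. Re z > 0} Qsu"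
    and Qc: "analytic_spectral_projection Ainf zs {z. Re z = 0} Qc"
    and Qss: "analytic_spectral_projection Ainf zs {z. Re z < 0} Qss"
    and conj: "0 < \<eta>" "\<eta> < min \<theta> \<nu>" "conjugators_near zs (A 0) Ainf \<eta> Pm Pp"
    and frame: "\<forall>\<^sub>F z in nhds zs. spectral_frame (Qsu z) (Qc z) (Qss z) Jsu Jc (R z)"
    and D1: "homoclinic_evans1 Pm Pp R Jsu Jc zs \<noteq> 0"
    and D2: "homoclinic_evans2 Pm Pp R Jsu zs \<noteq> 0"
  shows "\<exists>C1>0. \<forall>C>0. \<exists>X0. \<forall>\<epsilon>\<in>I. \<epsilon> > 0 \<and> X \<epsilon> > X0 \<longrightarrow>
           (\<forall>k::real. \<forall>z\<in>ball zs (C / X \<epsilon>).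
              periodic_evans (\<Psi> \<epsilon>) (X \<epsilon>) z (exp (\<i> * of_real (k * X \<epsilon>))) = 0 \<longrightarrow>
              (\<exists>\<zeta> \<in> {lam j \<kappa> |\<kappa>. \<exists>l::int. \<kappa> = k + of_int l * (2 * pi / X \<epsilon>)}.
                 dist z \<zeta> \<le> C1 / X \<epsilon>))"
proof -
  define B where "B = Ainf zs"
  have arc': "j < m" "algebraic_multiplicity B (\<i> * of_real ks) = 1"
    "\<And>\<mu>. eigenvalue B \<mu> \<Longrightarrow> \<mu> \<noteq> \<i> * of_real ks \<Longrightarrow> Re \<mu> \<noteq> 0"
    "\<mu>c analytic_on {zs}" "\<mu>c zs = \<i> * of_real ks" "deriv \<mu>c zs \<noteq> 0"
    "\<forall>\<^sub>F z in nhds zs. eigenvalue (Ainf z) (\<mu>c z)"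
    "\<forall>\<^sub>F k in nhds ks. \<mu>c (lam j k) = \<i> * of_real k"
    using arc unfolding isolated_arc_def B_def zs by auto
  have proj: "spectral_projection B {\<mu>. Re \<mu> > 0} (Qsu zs)" "spectral_projection B {\<mu>. Re \<mu> = 0} (Qc zs)"
    "spectral_projection B {\<mu>. Re \<mu> < 0} (Qss zs)"
    using Qsu Qc Qss unfolding analytic_spectral_projection_def B_def by auto
  have sum: "Qsu zs *v v + Qc zs *v v + Qss zs *v v = v" for v
    by (rule spectral_projection_sum3[OF proj]) auto
  obtain K0 where K0: "K0 > 0"
    "\<And>a b. norm a + norm b \<le> K0 * (norm (Qc zs *v b) + norm (Qss zs *v a) + norm (Qsu zs *v b) + norm (Pm 0 zs *v a - Pp 0 zs *v b))"
    "\<And>a b. norm a + norm b \<le> K0 * (norm (Qc zs *v a) + norm (Qss zs *v a) + norm (Qsu zs *v b) + norm (Pm 0 zs *v a - Pp 0 zs *v b))"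
    using homoclinic_matching[OF eventually_nhds_x_imp_x[OF frame] sum
        D1[unfolded homoclinic_evans1_def] D2[unfolded homoclinic_evans2_def]] by metis
  \<comment> \<open>The scalar lemma asks for a constant that is at least 1.\<close>
  define K1 where "K1 = K0 + 1"
  have K1: "K1 \<ge> 1" "K0 \<le> K1" using K0(1) by (auto simp: K1_def)
  have match: "norm a + norm b \<le> K1 * (norm (Qc zs *v b) + norm (Qss zs *v a) + norm (Qsu zs *v b) + norm (Pm 0 zs *v a - Pp 0 zs *v b))"
    "norm a + norm b \<le> K1 * (norm (Qc zs *v a) + norm (Qss zs *v a) + norm (Qsu zs *v b) + norm (Pm 0 zs *v a - Pp 0 zs *v b))" for a b
    by (rule order_trans[OF K0(2)], rule mult_right_mono[OF K1(2)], simp)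
      (rule order_trans[OF K0(3)], rule mult_right_mono[OF K1(2)], simp)
  obtain S U K \<alpha> where decay: "0 < \<alpha>" "0 < K" "S 0 = Qss zs" "U 0 = Qsu zs"
    "\<And>t. t \<ge> 0 \<Longrightarrow> (S has_vector_derivative (S t ** B)) (at t)"
    "\<And>t. t \<ge> 0 \<Longrightarrow> (U has_vector_derivative (U t ** (- B))) (at t)"
    "\<And>t. t \<ge> 0 \<Longrightarrow> norm (S t) \<le> K * exp (- \<alpha> * t)"
    "\<And>t. t \<ge> 0 \<Longrightarrow> norm (U t) \<le> K * exp (- \<alpha> * t)"
    by (rule hyperbolic_decay[OF proj(1,3)]) blast
  obtain V where V: "open V" "zs \<in> V" "conjugator_on {..0} V (A 0) Ainf \<eta> Pm" "conjugator_on {0..} V (A 0) Ainf \<eta> Pp"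
    using conj(3) unfolding conjugators_near_def by blast
  obtain km em where km: "\<And>x z. x \<in> {..0} \<Longrightarrow> z \<in> V \<Longrightarrow> invertible (Pm x z) \<and> norm (Pm x z) \<le> km \<and> norm (matrix_inv (Pm x z)) \<le> km"
    "\<And>x z. x \<in> {..0} \<Longrightarrow> z \<in> V \<Longrightarrow> norm (Pm x z - mat 1) \<le> em * exp (- \<eta> * \<bar>x\<bar>)"
    "\<And>x z. x \<in> {..0} \<Longrightarrow> z \<in> V \<Longrightarrow> ((\<lambda>y. Pm y z) has_vector_derivative (A 0 x z ** Pm x z - Pm x z ** Ainf z)) (at x within {..0})"
    "\<And>x. x \<in> {..0} \<Longrightarrow> matrix_analytic_on (Pm x) V"
    by (rule conjugator_onE[OF V(3)]) blast
  obtain kp ep where kp: "\<And>x z. x \<in> {0..} \<Longrightarrow> z \<in> V \<Longrightarrow> invertible (Pp x z) \<and> norm (Pp x z) \<le> kp \<and> norm (matrix_inv (Pp x z)) \<le> kp"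
    "\<And>x z. x \<in> {0..} \<Longrightarrow> z \<in> V \<Longrightarrow> norm (Pp x z - mat 1) \<le> ep * exp (- \<eta> * \<bar>x\<bar>)"
    "\<And>x z. x \<in> {0..} \<Longrightarrow> z \<in> V \<Longrightarrow> ((\<lambda>y. Pp y z) has_vector_derivative (A 0 x z ** Pp x z - Pp x z ** Ainf z)) (at x within {0..})"
    "\<And>x. x \<in> {0..} \<Longrightarrow> matrix_analytic_on (Pp x) V"
    by (rule conjugator_onE[OF V(4)]) blast
  define Kp where "Kp = max km kp"
  define Ke where "Ke = max em ep"
  have contP: "isCont (Pm 0) zs" "isCont (Pp 0) zs"
    using matrix_analytic_isCont[OF km(4) V(2)] matrix_analytic_isCont[OF kp(4) V(2)] by auto
  have fam: "0 \<in> I" "\<And>\<epsilon> x. \<epsilon> \<in> I \<Longrightarrow> matrix_analytic_on (A \<epsilon> x) UNIV"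
    "\<And>\<epsilon> x z. \<epsilon> \<in> I \<Longrightarrow> \<epsilon> > 0 \<Longrightarrow> A \<epsilon> (x + X \<epsilon>) z = A \<epsilon> x z"
    using family unfolding system_family_def by auto
  have contA: "isCont Ainf zs"
    by (rule H2_limit_continuous[where A = A, OF fam(2)[OF fam(1)] H2])
  have cont\<mu>: "isCont \<mu>c zs"
    using arc'(4) by (rule analytic_at_imp_isCont)
  obtain r L where r: "r > 0" "L > 0"
    "\<And>z w. z \<in> ball zs r \<Longrightarrow> w \<in> ball zs r \<Longrightarrow> norm (z - w) \<le> L * norm (\<mu>c z - \<mu>c w)"
    "\<And>z w. z \<in> ball zs r \<Longrightarrow> w \<in> ball zs r \<Longrightarrow> norm (\<mu>c z - \<mu>c w) \<le> L * norm (z - w)"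
    by (rule analytic_local_bounds[OF arc'(4,6)]) blast
  have "isCont (lam j) ks"
    using curves arc'(1) unfolding spectral_curves_def by (auto simp: continuous_on_eq_continuous_at)
  then have "\<forall>\<^sub>F k in nhds ks. lam j k \<in> ball zs r"
    using r(1) unfolding zs isCont_def tendsto_at_iff_tendsto_nhds
    by (intro topological_tendstoD) auto
  with arc'(8) have "\<forall>\<^sub>F k in nhds ks. \<mu>c (lam j k) = \<i> * of_real k \<and> lam j k \<in> ball zs r"
    by (rule eventually_conj)
  \<comment> \<open>For wave numbers within \<open>d\<close> of \<open>ks\<close> the curve stays in
    the ball where \<open>\<mu>c\<close> is bi-Lipschitz and is parametrized by
    \<open>\<mu>c = \<i> k\<close>.\<close>
  then obtain d where d: "d > 0" "\<And>k. dist k ks < d \<Longrightarrow> \<mu>c (lam j k) = \<i> * of_real k"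
    "\<And>k. dist k ks < d \<Longrightarrow> lam j k \<in> ball zs r"
    unfolding eventually_nhds_metric by blast
  define M where "M = norm zs + 1"
  have "M > 0" by (simp add: M_def add_nonneg_pos)
  then obtain K3 where K3: "K3 > 0" "\<And>\<epsilon> x z. \<epsilon> \<in> I \<Longrightarrow> \<epsilon> > 0 \<Longrightarrow> norm z \<le> M \<Longrightarrow> \<bar>x\<bar> \<le> X \<epsilon> / 2 \<Longrightarrow>
      norm (A \<epsilon> x z - A 0 x z) \<le> K3 * exp (- \<theta> * X \<epsilon> / 2)"
    using H3(2) unfolding H3_def by meson
  define \<kappa> where "\<kappa> = 1 + norm (Qsu zs) + norm (Qc zs)"
  have \<kappa>: "1 \<le> \<kappa>" "norm (Qsu zs) \<le> \<kappa>" "norm (Qc zs) \<le> \<kappa>"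
    by (auto simp: \<kappa>_def)
  \<comment> \<open>\<open>C2\<close> will bound \<open>\<bar>Re (\<mu>c z)\<bar>\<close> times the
    period. It and \<open>C1\<close> are fixed before \<open>C\<close> enters.\<close>
  define C2 where "C2 = ln (2 * \<kappa> * K1)"
  have \<kappa>K: "1 \<le> 2 * \<kappa> * K1" using \<kappa>(1) K1(1) mult_mono[of 1 \<kappa> 1 K1] by simp
  then have C2: "C2 \<ge> 0" by (simp add: C2_def)
  define C1 where "C1 = L * (C2 + pi)"
  have "C1 > 0" using r(2) C2 by (simp add: C1_def add_nonneg_pos)
  have main: "\<exists>X0. \<forall>\<epsilon>\<in>I. \<epsilon> > 0 \<and> X \<epsilon> > X0 \<longrightarrow>
           (\<forall>k::real. \<forall>z\<in>ball zs (C / X \<epsilon>).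
              periodic_evans (\<Psi> \<epsilon>) (X \<epsilon>) z (exp (\<i> * of_real (k * X \<epsilon>))) = 0 \<longrightarrow>
              (\<exists>\<zeta> \<in> {lam j \<kappa> |\<kappa>. \<exists>l::int. \<kappa> = k + of_int l * (2 * pi / X \<epsilon>)}.
                 dist z \<zeta> \<le> C1 / X \<epsilon>))" if "C > 0" for C
  proof -
    \<comment> \<open>From \<open>norm (\<mu>c z - \<i> * of_real ks) \<le> L * C / X\<close> the
      real part times half a period is at most \<open>c\<close>. The possibly huge
      \<open>exp c\<close> is seen by the tolerance \<open>\<tau>\<close> only.\<close>
    define c where "c = L * C / 2"
    have c: "exp c \<ge> 1" using r(2) \<open>C > 0\<close> by (simp add: c_def)
    obtain \<tau> where \<tau>: "\<tau> > 0" "growth_tolerance \<kappa> K1 K (exp c) \<tau>"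
      by (rule growth_tolerance_exists[OF \<kappa>(1) K1(1) less_imp_le[OF decay(2)] c])
    define e where "e = \<tau> / (4 * (1 + exp c))"
    have pexp: "0 < 1 + exp c" by (simp add: add_pos_pos)
    have "x / (4 * y) * y = x / 4" if "y \<noteq> 0" for x y :: real
      using that by simp
    from this[of "1 + exp c" \<tau>] have e: "e > 0" "e * (1 + exp c) = \<tau> / 4"
      using \<tau>(1) pexp unfolding e_def by auto
    define \<sigma> where "\<sigma> = \<alpha> * \<tau> / (8 * K)"
    have \<sigma>: "\<sigma> > 0" "K * \<sigma> / \<alpha> = \<tau> / 8"
      using \<tau>(1) decay(1,2) by (simp_all add: \<sigma>_def)
    have close_ev: "\<forall>\<^sub>F z in nhds zs. norm (F z - F zs) < s" if "isCont F zs" "s > 0"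
      for F :: "complex \<Rightarrow> complex^'n^'n" and s
      using that tendstoD[of F "F zs" "nhds zs" s]
      by (simp add: isCont_def tendsto_at_iff_tendsto_nhds dist_norm)
    have "\<forall>\<^sub>F z in nhds zs. z \<in> V \<and> z \<in> ball zs r \<and> z \<in> ball zs 1 \<and> norm (Ainf z - Ainf zs) < \<sigma> \<and>
        norm (Pm 0 z - Pm 0 zs) < \<tau> / 2 \<and> norm (Pp 0 z - Pp 0 zs) < \<tau> / 2 \<and>
        (\<exists>l. l v* Ainf z = \<mu>c z *s l \<and> (\<forall>v. \<bar>norm (pairing l v) - norm (Qc zs *v v)\<bar> \<le> e * norm v))"
      using V(1,2) r(1) \<sigma>(1) \<tau>(1)
      by (intro eventually_conj eventually_nhds_in_open close_ev contA contP
          approximate_center_functional[where k = ks and Qu = "Qsu zs" and Qs = "Qss zs"]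
          proj[unfolded B_def] arc'(2)[unfolded B_def] arc'(3)[unfolded B_def] cont\<mu> arc'(5,7) e(1)) auto
    \<comment> \<open>The radius depends on \<open>C\<close> through \<open>\<tau>\<close>; this is
      harmless because the disk has radius \<open>C / X\<close> and shrinks into it.\<close>
    then obtain r2 where r2: "r2 > 0" and z_near: "\<And>z. dist z zs < r2 \<Longrightarrow>
        z \<in> V \<and> z \<in> ball zs r \<and> z \<in> ball zs 1 \<and> norm (Ainf z - Ainf zs) < \<sigma> \<and>
        norm (Pm 0 z - Pm 0 zs) < \<tau> / 2 \<and> norm (Pp 0 z - Pp 0 zs) < \<tau> / 2 \<and>
        (\<exists>l. l v* Ainf z = \<mu>c z *s l \<and> (\<forall>v. \<bar>norm (pairing l v) - norm (Qc zs *v v)\<bar> \<le> e * norm v))"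
      unfolding eventually_nhds_metric by blast
    define \<delta> where "\<delta> x = K3 * exp (- \<theta> * x / 2)" for x
    have lim_exp: "((\<lambda>x. a * exp (- b * x / 2)) \<longlongrightarrow> 0) at_top" if "b > 0" for a b :: real
      using tendsto_mult_right_zero[OF exp_decay_tendsto_0(1)[of "b / 2"], of a] that by simp
    have lim_exp': "((\<lambda>x. a * (exp (- b * x / 2) * x)) \<longlongrightarrow> 0) at_top" if "b > 0" for a b :: real
      using tendsto_mult_right_zero[OF exp_decay_tendsto_0(2)[of "b / 2"], of a] that by simp
    have lim_inv: "((\<lambda>x. a / x) \<longlongrightarrow> 0) at_top" for a :: real
      by (rule tendsto_divide_0[OF tendsto_const filterlim_at_top_imp_at_infinity[OF filterlim_ident]])
    have "\<forall>\<^sub>F x in at_top. 0 < x \<and> C / x < r2 \<and> (pi + L * C) / x < d \<and>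
        K * exp (- \<alpha> * x / 2) < \<tau> / 2 \<and>
        K * Kp * K3 * Kp / \<alpha> * exp (- \<theta> * x / 2) < \<tau> / 8 \<and>
        exp (2 * c) * (norm (Qc zs) + e) * Kp * K3 * Kp / 2 * (exp (- \<theta> * x / 2) * x) < \<tau> / 4 \<and>
        Ke * exp (- \<eta> * x / 2) < \<tau> / 2"
      using r2 d(1) \<tau>(1)
      by (intro eventually_conj eventually_gt_at_top order_tendstoD(2)[OF lim_inv]
          order_tendstoD(2)[OF lim_exp[OF decay(1)]] order_tendstoD(2)[OF lim_exp[OF H3(1)]]
          order_tendstoD(2)[OF lim_exp'[OF H3(1)]] order_tendstoD(2)[OF lim_exp[OF conj(1)]]) auto
    \<comment> \<open>The center error still carries a factor \<open>x\<close> from the length of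
      the half-period; the exponential decay from (H3) beats it.\<close>
    then obtain X0 where X0: "\<And>x. x \<ge> X0 \<Longrightarrow> 0 < x \<and> C / x < r2 \<and> (pi + L * C) / x < d \<and>
        K * exp (- \<alpha> * x / 2) < \<tau> / 2 \<and>
        K * Kp * K3 * Kp / \<alpha> * exp (- \<theta> * x / 2) < \<tau> / 8 \<and>
        exp (2 * c) * (norm (Qc zs) + e) * Kp * K3 * Kp / 2 * (exp (- \<theta> * x / 2) * x) < \<tau> / 4 \<and>
        Ke * exp (- \<eta> * x / 2) < \<tau> / 2"
      unfolding eventually_at_top_linorder by blast
    show ?thesis
    proof (intro exI[of _ X0] ballI impI allI)
      fix \<epsilon> k z
      assume \<epsilon>: "\<epsilon> \<in> I" "\<epsilon> > 0 \<and> X \<epsilon> > X0" and zC: "z \<in> ball zs (C / X \<epsilon>)"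
        and ev0: "periodic_evans (\<Psi> \<epsilon>) (X \<epsilon>) z (exp (\<i> * of_real (k * X \<epsilon>))) = 0"
      define Y where "Y = X \<epsilon>"
      have Y: "0 < Y" "C / Y < r2" "(pi + L * C) / Y < d"
        "K * exp (- \<alpha> * Y / 2) < \<tau> / 2" "K * Kp * K3 * Kp / \<alpha> * exp (- \<theta> * Y / 2) < \<tau> / 8"
        "exp (2 * c) * (norm (Qc zs) + e) * Kp * K3 * Kp / 2 * (exp (- \<theta> * Y / 2) * Y) < \<tau> / 4"
        "Ke * exp (- \<eta> * Y / 2) < \<tau> / 2"
        using X0[of Y] \<epsilon>(2) by (auto simp: Y_def)
      have dz: "dist z zs < C / Y" using zC by (simp add: Y_def dist_commute)
      then have z: "z \<in> V" "z \<in> ball zs r" "z \<in> ball zs 1" "norm (Ainf z - Ainf zs) < \<sigma>"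
        "norm (Pm 0 z - Pm 0 zs) < \<tau> / 2" "norm (Pp 0 z - Pp 0 zs) < \<tau> / 2"
        using z_near[of z] Y(2) by auto
      obtain l where l: "l v* Ainf z = \<mu>c z *s l" "\<And>v. \<bar>norm (pairing l v) - norm (Qc zs *v v)\<bar> \<le> e * norm v"
        using z_near[of z] dz Y(2) by force
      have "zs \<in> ball zs r" using r(1) by simp
      then have \<mu>z: "norm (\<mu>c z - \<i> * of_real ks) \<le> L * (C / Y)"
        using r(4)[OF z(2), of zs] mult_left_mono[OF less_imp_le[OF dz], of L] r(2) arc'(5)
        by (simp add: dist_norm)
      have Re\<mu>: "\<bar>Re (\<mu>c z)\<bar> * (Y / 2) \<le> c"
      proof -
        have "\<bar>Re (\<mu>c z)\<bar> \<le> L * (C / Y)"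
          using abs_Re_le_cmod[of "\<mu>c z - \<i> * of_real ks"] \<mu>z by simp
        then have "\<bar>Re (\<mu>c z)\<bar> * (Y / 2) \<le> L * (C / Y) * (Y / 2)"
          using Y(1) by (intro mult_right_mono) auto
        then show ?thesis using Y(1) by (simp add: c_def)
      qed
      have zM: "norm z \<le> M"
        using z(3) norm_triangle_sub[of z zs] by (simp add: M_def dist_norm norm_minus_commute)
      have sol: "\<Psi> \<epsilon> 0 z = mat 1" "\<And>x. ((\<lambda>y. \<Psi> \<epsilon> y z) has_vector_derivative (A \<epsilon> x z ** \<Psi> \<epsilon> x z)) (at x)"
        using \<Psi>[OF \<epsilon>(1)] \<epsilon>(2) unfolding solution_operator_def by auto
      have KpB: "\<And>x. x \<le> 0 \<Longrightarrow> norm (Pm x z) \<le> Kp" "\<And>x. x \<le> 0 \<Longrightarrow> norm (matrix_inv (Pm x z)) \<le> Kp"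
        "\<And>x. x \<ge> 0 \<Longrightarrow> norm (Pp x z) \<le> Kp" "\<And>x. x \<ge> 0 \<Longrightarrow> norm (matrix_inv (Pp x z)) \<le> Kp"
        using km(1)[OF _ z(1)] kp(1)[OF _ z(1)] unfolding Kp_def
        by (simp_all add: max.coboundedI1 max.coboundedI2)
      have Pend: "norm (Pp (Y / 2) z - mat 1) \<le> \<tau> / 2" "norm (Pm (- (Y / 2)) z - mat 1) \<le> \<tau> / 2"
      proof -
        have "norm (Pp (Y / 2) z - mat 1) \<le> ep * exp (- \<eta> * Y / 2)" "norm (Pm (- (Y / 2)) z - mat 1) \<le> em * exp (- \<eta> * Y / 2)"
          using kp(2)[OF _ z(1), of "Y / 2"] km(2)[OF _ z(1), of "- (Y / 2)"] Y(1) by simp_all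
        moreover have "ep * exp (- \<eta> * Y / 2) \<le> Ke * exp (- \<eta> * Y / 2)" "em * exp (- \<eta> * Y / 2) \<le> Ke * exp (- \<eta> * Y / 2)"
          unfolding Ke_def by (intro mult_right_mono; simp)+
        ultimately show "norm (Pp (Y / 2) z - mat 1) \<le> \<tau> / 2" "norm (Pm (- (Y / 2)) z - mat 1) \<le> \<tau> / 2"
          using Y(7) by linarith+
      qed
      have small: "K * (Kp * \<delta> Y * Kp) / \<alpha> \<le> \<tau> / 8"
        "exp (2 * c) * (norm (Qc zs) + e) * (Kp * \<delta> Y * Kp) * (Y / 2) \<le> \<tau> / 4"
        using Y(5,6) by (simp_all add: \<delta>_def mult_ac)
      have split: "K * (Kp * \<delta> Y * Kp + \<sigma>) / \<alpha> = K * (Kp * \<delta> Y * Kp) / \<alpha> + K * \<sigma> / \<alpha>"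
        by (simp add: distrib_left add_divide_distrib)
      have "(exp (Re (\<mu>c z) * (Y / 2)))\<^sup>2 \<le> 2 * \<kappa> * K1 \<and> 1 \<le> 2 * \<kappa> * K1 * (exp (Re (\<mu>c z) * (Y / 2)))\<^sup>2"
      proof (rule floquet_center_growth[where S = S and U = U and \<Psi> = "\<lambda>x. \<Psi> \<epsilon> x z" and ?A0.0 = "\<lambda>x. A 0 x z"
            and ?A1.0 = "\<lambda>x. A \<epsilon> x z" and Pm = "\<lambda>x. Pm x z" and Pp = "\<lambda>x. Pp x z" and A = "Ainf z" and B = B
            and Qu = "Qsu zs" and Qc = "Qc zs" and Qs = "Qss zs" and ?Pm0.0 = "Pm 0 zs" and ?Pp0.0 = "Pp 0 zs"
            and \<alpha> = \<alpha> and K = K and \<gamma> = "exp (\<i> * of_real (k * X \<epsilon>))" and \<delta> = "\<delta> Y" and Kp = Kp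
            and \<tau> = \<tau> and \<delta>' = \<sigma> and l = l and e = e and c = c,
            OF decay sum \<kappa> _ match sol])
        show "A \<epsilon> (x + Y) z = A \<epsilon> x z" for x using fam(3) \<epsilon> by (simp add: Y_def)
        show "det (\<Psi> \<epsilon> Y z - mat (exp (\<i> * of_real (k * X \<epsilon>)))) = 0"
          using ev0 by (simp add: periodic_evans_def Y_def)
        show "norm (exp (\<i> * of_real (k * X \<epsilon>))) = 1" by simp
        show "norm (A \<epsilon> x z - A 0 x z) \<le> \<delta> Y" if "\<bar>x\<bar> \<le> Y / 2" for x
          using K3(2)[OF \<epsilon>(1) _ zM, of x] \<epsilon>(2) that by (simp add: \<delta>_def Y_def)
        show "pairing l (Ainf z *v v) = \<mu>c z * pairing l v" for v
          by (simp add: pairing_matrix_vector_mult l(1) pairing_smult_left)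
        show "K * exp (- \<alpha> * (Y / 2)) + K * (Kp * \<delta> Y * Kp + \<sigma>) / \<alpha> \<le> \<tau>"
        proof -
          have "K * exp (- \<alpha> * (Y / 2)) < \<tau> / 2" using Y(4) by simp
          then show ?thesis
            using small(1) \<sigma>(2) \<tau>(1) unfolding split by linarith
        qed
        have "2 * K * (Kp * \<delta> Y * Kp + \<sigma>) / \<alpha> = 2 * (K * (Kp * \<delta> Y * Kp) / \<alpha> + K * \<sigma> / \<alpha>)"
          unfolding split[symmetric] by simp
        also have "\<dots> \<le> 2 * (\<tau> / 8 + \<tau> / 8)"
          using small(1) \<sigma>(2) by (intro mult_left_mono add_mono) auto
        finally have "2 * K * (Kp * \<delta> Y * Kp + \<sigma>) / \<alpha> \<le> \<tau> / 2" by simp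
        from add_mono[OF this add_mono[OF small(2) eq_refl[OF e(2)]]]
        show "2 * K * (Kp * \<delta> Y * Kp + \<sigma>) / \<alpha>
            + (exp (2 * c) * (norm (Qc zs) + e) * (Kp * \<delta> Y * Kp) * (Y / 2) + e * (1 + exp c)) \<le> \<tau>"
          by simp
      qed (use K1 Y(1) kp km z(1) KpB Pend z(4,5,6) l(2) e(1) Re\<mu> \<tau>(2) in
          \<open>auto simp: B_def norm_minus_commute less_imp_le\<close>)
      \<comment> \<open>The square of the growth over half a period is the growth over the full
        period.\<close>
      then have \<rho>: "exp (Re (\<mu>c z) * Y) \<le> 2 * \<kappa> * K1" "1 \<le> 2 * \<kappa> * K1 * exp (Re (\<mu>c z) * Y)"
        by (simp_all add: power2_eq_square mult.commute[of Y] flip: exp_add)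
      have "\<bar>Re (\<mu>c z) * Y\<bar> \<le> C2"
      proof -
        have "Re (\<mu>c z) * Y \<le> C2"
          unfolding C2_def using \<rho>(1) by (subst ln_ge_iff) (use \<kappa>K in linarith, simp)
        moreover have "exp (- (Re (\<mu>c z) * Y)) \<le> 2 * \<kappa> * K1"
          using \<rho>(2) by (simp add: exp_minus inverse_eq_divide divide_le_eq)
        then have "- (Re (\<mu>c z) * Y) \<le> C2"
          unfolding C2_def by (subst ln_ge_iff) (use \<kappa>K in linarith, simp)
        ultimately show ?thesis by linarith
      qed
      then have ReY: "\<bar>Re (\<mu>c z)\<bar> \<le> C2 / Y"
        using Y(1) by (simp add: abs_mult le_divide_eq)
      \<comment> \<open>The congruent wave number is chosen by its distance to
        \<open>Im (\<mu>c z)\<close>, at most half the spacing \<open>2 * pi / Y\<close>. It also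
        lies within \<open>(pi + L * C) / Y\<close> of \<open>ks\<close>, which the threshold puts
        below \<open>d\<close>, so its curve point belongs to the local arc.\<close>
      obtain i :: int where i: "\<bar>Im (\<mu>c z) - (k + of_int i * (2 * pi / Y))\<bar> \<le> pi / Y"
        by (rule exists_congruent_near[OF Y(1)])
      define q where "q = k + of_int i * (2 * pi / Y)"
      have "\<bar>Im (\<mu>c z) - ks\<bar> \<le> L * (C / Y)"
        using abs_Im_le_cmod[of "\<mu>c z - \<i> * of_real ks"] \<mu>z by simp
      then have "dist q ks \<le> pi / Y + L * (C / Y)"
        using i unfolding q_def[symmetric] dist_real_def by linarith
      also have "\<dots> = (pi + L * C) / Y" by (simp add: add_divide_distrib)
      finally have q: "dist q ks < d" using Y(3) by linarith
      have "dist z (lam j q) \<le> L * norm (\<mu>c z - \<i> * of_real q)"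
        using r(3)[OF z(2) d(3)[OF q]] d(2)[OF q] by (simp add: dist_norm)
      also have "\<dots> \<le> L * (C2 / Y + pi / Y)"
      proof (rule mult_left_mono)
        have "norm (\<mu>c z - \<i> * of_real q) \<le> \<bar>Re (\<mu>c z - \<i> * of_real q)\<bar> + \<bar>Im (\<mu>c z - \<i> * of_real q)\<bar>"
          by (rule cmod_le)
        then show "norm (\<mu>c z - \<i> * of_real q) \<le> C2 / Y + pi / Y"
          using ReY i by (simp add: q_def)
      qed (use r(2) in simp)
      also have "\<dots> = C1 / X \<epsilon>"
        by (simp add: C1_def Y_def add_divide_distrib distrib_left)
      finally have "dist z (lam j q) \<le> C1 / X \<epsilon>" .
      then show "\<exists>\<zeta> \<in> {lam j \<kappa> |\<kappa>. \<exists>l::int. \<kappa> = k + of_int l * (2 * pi / X \<epsilon>)}. dist z \<zeta> \<le> C1 / X \<epsilon>"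
        unfolding q_def Y_def by blast
    qed
  qed
  with \<open>C1 > 0\<close> show ?thesis by blast
qed

end
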